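(* Given an MV-algebra $A$, the following are equivalent: (i) $A$ is polyhedral; (ii) $A$ is semisimple and $\mathscr{W}(A)\subseteq[0,1]^A$ is a (possibly infinite dimensional) polyhedron; (iii) each finitely generated subalgebra of $A$ is polyhedral.
   Context: An MV-algebra is an abelian monoid $(A,\oplus,0)$ with a unary operation $\neg$ such that $\neg\neg x=x$, $x\oplus\neg 0=\neg 0$, and $x\oplus\neg(x\oplus\neg y)=y\oplus\neg(y\oplus\neg x)$. The standard MV-algebra is $[0,1]$ with $x\oplus y=\min\{x+y,1\}$, $\neg x=1-x$. An MV-algebra is semisimple if it is a subdirect product of simple MV-algebras, equivalently if it belongs to $\mathbb{ISP}([0,1])$. $\mathscr{W}(A)=\mathsf{Hom}(A,[0,1])$ is the set of MV-homomorphisms from $A$ to the standard MV-algebra, viewed as a (closed) subspace of the cube $[0,1]^A$ with product topology. $\mathscr{F}(I)$ is the free MV-algebra on $I$; for $p\in[0,1]^I$, $\bar p\colon\mathscr{F}(I)\to[0,1]$ is the unique homomorphism extending $p$. For closed $X\subseteq[0,1]^I$, $\mathscr{M}(X)$ is the MV-algebra (with pointwise operations, a subalgebra of $[0,1]^X$) of all definable maps $X\to[0,1]$, i.e. all maps of the form $p\mapsto\bar p(t)$ with $t\in\mathscr{F}(I)$. A (finite dimensional) polyhedron in $\mathbb{R}^n$ is a finite (possibly empty) union of closed simplices. A closed set $X\subseteq[0,1]^Y$ ($Y$ any set) is an infinite dimensional polyhedron if for every finite $Z\subseteq Y$ the projection $\pi^Y_Z(X)\subseteq[0,1]^Z$ is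 a (finite dimensional) polyhedron. An MV-algebra is polyhedral if it is isomorphic to $\mathscr{M}(X)$ for some polyhedron $X$ in this sense (not necessarily finite dimensional). *)

theory Defs
  imports "HOL-Analysis.Analysis" "HOL-Library.Function_Algebras" "HOL-Algebra.Group"
begin

section \<open>MV-algebras\<close>

record 'a mv_struct = "'a partial_object" +
  mv_plus :: "['a, 'a] \<Rightarrow> 'a" (infixl \<open>\<oplus>\<index>\<close> 65)
  mv_zero :: 'a (\<open>\<zero>\<index>\<close>)
  mv_neg :: "'a \<Rightarrow> 'a" (\<open>\<sim>\<index> _\<close> [81] 80)

locale mv_algebra =
  fixes A :: "('a, 'm) mv_struct_scheme" (structure)
  assumes plus_comm_monoid:
      "comm_monoid \<lparr>carrier = carrier A, mult = mv_plus A, one = mv_zero A\<rparr>"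
    and neg_closed: "x \<in> carrier A \<Longrightarrow> \<sim> x \<in> carrier A"
    and neg_neg: "x \<in> carrier A \<Longrightarrow> \<sim> (\<sim> x) = x"
    and plus_neg_zero: "x \<in> carrier A \<Longrightarrow> x \<oplus> \<sim> \<zero> = \<sim> \<zero>"
    and lukasiewicz: "x \<in> carrier A \<Longrightarrow> y \<in> carrier A \<Longrightarrow>
      x \<oplus> \<sim> (x \<oplus> \<sim> y) = y \<oplus> \<sim> (y \<oplus> \<sim> x)"

definition mv_hom :: "('a, 'm) mv_struct_scheme \<Rightarrow> ('b, 'n) mv_struct_scheme \<Rightarrow> ('a \<Rightarrow> 'b) set" where
  "mv_hom A B = {h \<in> carrier A \<rightarrow> carrier B.
     (\<forall>x\<in>carrier A. \<forall>y\<in>carrier A. h (x \<oplus>\<^bsub>A\<^esub> y) = h x \<oplus>\<^bsub>B\<^esub> h y) \<and>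
     h \<zero>\<^bsub>A\<^esub> = \<zero>\<^bsub>B\<^esub> \<and>
     (\<forall>x\<in>carrier A. h (\<sim>\<^bsub>A\<^esub> x) = \<sim>\<^bsub>B\<^esub> (h x))}"

definition mv_isomorphic :: "('a, 'm) mv_struct_scheme \<Rightarrow> ('b, 'n) mv_struct_scheme \<Rightarrow> bool" where
  "mv_isomorphic A B \<longleftrightarrow> (\<exists>h \<in> mv_hom A B. bij_betw h (carrier A) (carrier B))"

definition mv_subalgebra :: "'a set \<Rightarrow> ('a, 'm) mv_struct_scheme \<Rightarrow> bool" where
  "mv_subalgebra S A \<longleftrightarrow> S \<subseteq> carrier A \<and> \<zero>\<^bsub>A\<^esub> \<in> S \<and>
     (\<forall>x\<in>S. \<forall>y\<in>S. x \<oplus>\<^bsub>A\<^esub> y \<in> S) \<and> (\<forall>x\<in>S. \<sim>\<^bsub>A\<^esub> x \<in> S)"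

definition mv_finitely_generated :: "('a, 'm) mv_struct_scheme \<Rightarrow> bool" where
  "mv_finitely_generated A \<longleftrightarrow>
     (\<exists>G. finite G \<and> G \<subseteq> carrier A \<and> (\<lambda>S. mv_subalgebra S A) hull G = carrier A)"

definition mv_product :: "'i set \<Rightarrow> ('i \<Rightarrow> ('b, 'n) mv_struct_scheme) \<Rightarrow> ('i \<Rightarrow> 'b) mv_struct" where
  "mv_product I B = \<lparr>carrier = (\<Pi>\<^sub>E i\<in>I. carrier (B i)),
     mv_plus = (\<lambda>f g. \<lambda>i\<in>I. f i \<oplus>\<^bsub>B i\<^esub> g i),
     mv_zero = (\<lambda>i\<in>I. \<zero>\<^bsub>B i\<^esub>),
     mv_neg = (\<lambda>f. \<lambda>i\<in>I. \<sim>\<^bsub>B i\<^esub> (f i))\<rparr>"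

definition std_mv :: "real mv_struct" where
  "std_mv = \<lparr>carrier = {0..1}, mv_plus = (\<lambda>x y. min (x + y) 1), mv_zero = 0,
     mv_neg = (\<lambda>x. 1 - x)\<rparr>"

lemma std_mv_simps [simp]:
  "carrier std_mv = {0..1}" "x \<oplus>\<^bsub>std_mv\<^esub> y = min (x + y) 1" "\<zero>\<^bsub>std_mv\<^esub> = 0" "\<sim>\<^bsub>std_mv\<^esub> x = 1 - x"
  by (simp_all add: std_mv_def)

lemma (in mv_algebra) plus_closed: "x \<in> carrier A \<Longrightarrow> y \<in> carrier A \<Longrightarrow> x \<oplus> y \<in> carrier A"
  using monoid.m_closed[OF comm_monoid.axioms(1)[OF plus_comm_monoid]] by simp

lemma (in mv_algebra) plus_assoc:
  "x \<in> carrier A \<Longrightarrow> y \<in> carrier A \<Longrightarrow> z \<in> carrier A \<Longrightarrow> (x \<oplus> y) \<oplus> z = x \<oplus> (y \<oplus> z)"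
  using monoid.m_assoc[OF comm_monoid.axioms(1)[OF plus_comm_monoid]] by simp

lemma (in mv_algebra) plus_comm: "x \<in> carrier A \<Longrightarrow> y \<in> carrier A \<Longrightarrow> x \<oplus> y = y \<oplus> x"
  using comm_monoid.m_comm[OF plus_comm_monoid] by simp

lemma (in mv_algebra) zero_closed: "\<zero> \<in> carrier A"
  using monoid.one_closed[OF comm_monoid.axioms(1)[OF plus_comm_monoid]] by simp

lemma (in mv_algebra) zero_plus: "x \<in> carrier A \<Longrightarrow> \<zero> \<oplus> x = x"
  using monoid.l_one[OF comm_monoid.axioms(1)[OF plus_comm_monoid]] by simp

lemma mv_algebraI:
  fixes A :: "('a, 'm) mv_struct_scheme" (structure)
  assumes "\<And>x y. x \<in> carrier A \<Longrightarrow> y \<in> carrier A \<Longrightarrow> x \<oplus> y \<in> carrier A"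
    and "\<zero> \<in> carrier A"
    and "\<And>x y z. x \<in> carrier A \<Longrightarrow> y \<in> carrier A \<Longrightarrow> z \<in> carrier A \<Longrightarrow>
      (x \<oplus> y) \<oplus> z = x \<oplus> (y \<oplus> z)"
    and "\<And>x y. x \<in> carrier A \<Longrightarrow> y \<in> carrier A \<Longrightarrow> x \<oplus> y = y \<oplus> x"
    and "\<And>x. x \<in> carrier A \<Longrightarrow> \<zero> \<oplus> x = x"
    and "\<And>x. x \<in> carrier A \<Longrightarrow> \<sim> x \<in> carrier A"
    and "\<And>x. x \<in> carrier A \<Longrightarrow> \<sim> (\<sim> x) = x"
    and "\<And>x. x \<in> carrier A \<Longrightarrow> x \<oplus> \<sim> \<zero> = \<sim> \<zero>"
    and "\<And>x y. x \<in> carrier A \<Longrightarrow> y \<in> carrier A \<Longrightarrow>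
      x \<oplus> \<sim> (x \<oplus> \<sim> y) = y \<oplus> \<sim> (y \<oplus> \<sim> x)"
  shows "mv_algebra A"
proof (rule mv_algebra.intro)
  show "comm_monoid \<lparr>carrier = carrier A, mult = mv_plus A, one = mv_zero A\<rparr>"
    by (rule comm_monoidI) (use assms in auto)
qed (use assms in auto)

lemma mv_algebra_std_mv: "mv_algebra std_mv"
  by (rule mv_algebraI) (auto simp: min_def split: if_splits)


section \<open>Simple and semisimple MV-algebras\<close>

definition mv_congruence :: "('a, 'm) mv_struct_scheme \<Rightarrow> 'a rel \<Rightarrow> bool" where
  "mv_congruence A \<theta> \<longleftrightarrow> equiv (carrier A) \<theta> \<and>
     (\<forall>(x, y)\<in>\<theta>. \<forall>(u, v)\<in>\<theta>. (x \<oplus>\<^bsub>A\<^esub> u, y \<oplus>\<^bsub>A\<^esub> v) \<in> \<theta>) \<and>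
     (\<forall>(x, y)\<in>\<theta>. (\<sim>\<^bsub>A\<^esub> x, \<sim>\<^bsub>A\<^esub> y) \<in> \<theta>)"

text \<open>Simple algebras are nontrivial.\<close>

definition mv_simple :: "('a, 'm) mv_struct_scheme \<Rightarrow> bool" where
  "mv_simple A \<longleftrightarrow> mv_algebra A \<and> (\<exists>x\<in>carrier A. \<exists>y\<in>carrier A. x \<noteq> y) \<and>
     (\<forall>\<theta>. mv_congruence A \<theta> \<longrightarrow> \<theta> = Id_on (carrier A) \<or> \<theta> = carrier A \<times> carrier A)"

definition mv_subdirect_rep ::
    "('a, 'm) mv_struct_scheme \<Rightarrow> 'i set \<Rightarrow> ('i \<Rightarrow> ('b, 'n) mv_struct_scheme) \<Rightarrow> ('a \<Rightarrow> 'i \<Rightarrow> 'b) \<Rightarrow> bool" where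
  "mv_subdirect_rep A I B f \<longleftrightarrow> f \<in> mv_hom A (mv_product I B) \<and> inj_on f (carrier A) \<and>
     (\<forall>i\<in>I. (\<lambda>x. f x i) ` carrier A = carrier (B i))"

text \<open>
  HOL cannot quantify over the types of the index set and of the factors. Factors with carriers in
  \<^typ>\<open>'a set\<close>, indexed by a set of relations on \<^typ>\<open>'a\<close>, are no restriction, because each factor is the
  quotient of \<open>A\<close> by the kernel of a projection; \<open>mv_semisimpleI\<close> below proves this.
\<close>

definition mv_semisimple :: "('a, 'm) mv_struct_scheme \<Rightarrow> bool" where
  "mv_semisimple A \<longleftrightarrow> (\<exists>(I :: 'a rel set) (B :: 'a rel \<Rightarrow> 'a set mv_struct) f.
     (\<forall>i\<in>I. mv_simple (B i)) \<and> mv_subdirect_rep A I B f)"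


definition mv_transport :: "('b \<Rightarrow> 'c) \<Rightarrow> ('b, 'n) mv_struct_scheme \<Rightarrow> 'c mv_struct" where
  "mv_transport g B = \<lparr>carrier = g ` carrier B,
     mv_plus = (\<lambda>u v. g (inv_into (carrier B) g u \<oplus>\<^bsub>B\<^esub> inv_into (carrier B) g v)),
     mv_zero = g \<zero>\<^bsub>B\<^esub>,
     mv_neg = (\<lambda>u. g (\<sim>\<^bsub>B\<^esub> (inv_into (carrier B) g u)))\<rparr>"

lemma mv_transport_simps:
  assumes "inj_on g (carrier B)"
  shows "carrier (mv_transport g B) = g ` carrier B" "\<zero>\<^bsub>mv_transport g B\<^esub> = g \<zero>\<^bsub>B\<^esub>"
    "x \<in> carrier B \<Longrightarrow> y \<in> carrier B \<Longrightarrow> g x \<oplus>\<^bsub>mv_transport g B\<^esub> g y = g (x \<oplus>\<^bsub>B\<^esub> y)"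
    "x \<in> carrier B \<Longrightarrow> \<sim>\<^bsub>mv_transport g B\<^esub> (g x) = g (\<sim>\<^bsub>B\<^esub> x)"
  using assms by (simp_all add: mv_transport_def)

lemma mv_simple_transport:
  assumes inj: "inj_on g (carrier B)" and simple: "mv_simple B"
  shows "mv_simple (mv_transport g B)"
proof -
  interpret mv_algebra B using simple by (simp add: mv_simple_def)
  note T = mv_transport_simps[OF inj]
  note closed = plus_closed zero_closed neg_closed
  have "mv_algebra (mv_transport g B)"
    by (rule mv_algebraI; (subst (asm) T, elim imageE)?; (subst (asm) T, elim imageE)?;
        (subst (asm) T, elim imageE)?; simp add: T closed plus_assoc zero_plus neg_neg plus_neg_zero;
        (metis plus_comm lukasiewicz)?)
  moreover have "\<exists>x\<in>carrier (mv_transport g B). \<exists>y\<in>carrier (mv_transport g B). x \<noteq> y"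
    using simple inj by (auto simp: mv_simple_def T inj_on_def)
  moreover have "\<theta> = Id_on (carrier (mv_transport g B)) \<or>
      \<theta> = carrier (mv_transport g B) \<times> carrier (mv_transport g B)"
    if \<theta>: "mv_congruence (mv_transport g B) \<theta>" for \<theta>
  proof -
    define \<eta> where "\<eta> = {(x, y). x \<in> carrier B \<and> y \<in> carrier B \<and> (g x, g y) \<in> \<theta>}"
    have eq: "\<theta> \<subseteq> g ` carrier B \<times> g ` carrier B" "refl_on (g ` carrier B) \<theta>" "Relation.sym \<theta>" "Relation.trans \<theta>"
      and cong: "\<And>x y u v. (x, y) \<in> \<theta> \<Longrightarrow> (u, v) \<in> \<theta> \<Longrightarrow>
          (x \<oplus>\<^bsub>mv_transport g B\<^esub> u, y \<oplus>\<^bsub>mv_transport g B\<^esub> v) \<in> \<theta>"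
        "\<And>x y. (x, y) \<in> \<theta> \<Longrightarrow> (\<sim>\<^bsub>mv_transport g B\<^esub> x, \<sim>\<^bsub>mv_transport g B\<^esub> y) \<in> \<theta>"
      using \<theta> by (auto simp: mv_congruence_def equiv_def T)
    have "equiv (carrier B) \<eta>"
    proof (rule equivI)
      show "refl_on (carrier B) \<eta>" using eq(2) by (auto simp: \<eta>_def refl_on_def)
      show "Relation.sym \<eta>" using eq(3) by (auto simp: \<eta>_def sym_def)
      show "Relation.trans \<eta>" using eq(4) unfolding \<eta>_def trans_def by blast
    qed (auto simp: \<eta>_def)
    moreover have "(x \<oplus>\<^bsub>B\<^esub> u, y \<oplus>\<^bsub>B\<^esub> v) \<in> \<eta>" if "(x, y) \<in> \<eta>" "(u, v) \<in> \<eta>" for x y u v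
      using that cong(1)[of "g x" "g y" "g u" "g v"] by (auto simp: \<eta>_def T closed)
    moreover have "(\<sim>\<^bsub>B\<^esub> x, \<sim>\<^bsub>B\<^esub> y) \<in> \<eta>" if "(x, y) \<in> \<eta>" for x y
      using that cong(2)[of "g x" "g y"] by (auto simp: \<eta>_def T closed)
    ultimately have "mv_congruence B \<eta>"
      by (auto simp: mv_congruence_def)
    then have "\<eta> = Id_on (carrier B) \<or> \<eta> = carrier B \<times> carrier B"
      using simple by (auto simp: mv_simple_def)
    moreover have img: "\<theta> = (\<lambda>(x, y). (g x, g y)) ` \<eta>"
    proof (intro equalityI subsetI)
      fix z assume "z \<in> \<theta>"
      moreover from this eq(1) obtain x y where "x \<in> carrier B" "y \<in> carrier B" "z = (g x, g y)"
        by blast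
      ultimately show "z \<in> (\<lambda>(x, y). (g x, g y)) ` \<eta>"
        by (intro image_eqI[of _ _ "(x, y)"]) (auto simp: \<eta>_def)
    qed (auto simp: \<eta>_def)
    moreover have "(\<lambda>(x, y). (g x, g y)) ` Id_on (carrier B) = Id_on (g ` carrier B)"
      by (auto simp: image_iff Id_on_def)
    moreover have "(\<lambda>(x, y). (g x, g y)) ` (carrier B \<times> carrier B) = g ` carrier B \<times> g ` carrier B"
      by auto
    ultimately show ?thesis by (metis T(1))
  qed
  ultimately show ?thesis by (auto simp: mv_simple_def)
qed

theorem mv_semisimpleI:
  fixes A :: "('a, 'm) mv_struct_scheme" and I :: "'i set" and B :: "'i \<Rightarrow> ('b, 'n) mv_struct_scheme"
  assumes simple: "\<forall>i\<in>I. mv_simple (B i)" and rep: "mv_subdirect_rep A I B f"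
  shows "mv_semisimple A"
proof -
  define ker where "ker i = {(x, y). x \<in> carrier A \<and> y \<in> carrier A \<and> f x i = f y i}" for i
  define r where "r = inv_into I ker"
  define g where "g i c = {x \<in> carrier A. f x i = c}" for i c
  define C where "C \<theta> = mv_transport (g (r \<theta>)) (B (r \<theta>))" for \<theta>
  define f' where "f' x = (\<lambda>\<theta>\<in>ker ` I. g (r \<theta>) (f x (r \<theta>)))" for x
  have r: "r \<theta> \<in> I" "ker (r \<theta>) = \<theta>" if "\<theta> \<in> ker ` I" for \<theta>
    using that by (auto simp: r_def inv_into_into f_inv_into_f)
  have f: "f \<in> mv_hom A (mv_product I B)" "inj_on f (carrier A)"
    and surj: "\<And>i. i \<in> I \<Longrightarrow> (\<lambda>x. f x i) ` carrier A = carrier (B i)"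
    using rep by (auto simp: mv_subdirect_rep_def)
  have inj: "inj_on (g i) (carrier (B i))" if i: "i \<in> I" for i
  proof (rule inj_onI)
    fix c d assume cd: "c \<in> carrier (B i)" "d \<in> carrier (B i)" "g i c = g i d"
    then obtain x where "x \<in> carrier A" "f x i = c" using surj[OF i] by (metis imageE)
    then show "c = d" using cd(3) by (auto simp: g_def)
  qed
  have mem: "f x i \<in> carrier (B i)" if "x \<in> carrier A" "i \<in> I" for x i
    using surj[OF that(2)] that(1) by auto
  have f_ext: "f x \<in> extensional I" if "x \<in> carrier A" for x
    using f(1) that by (auto simp: mv_hom_def mv_product_def PiE_iff)
  have hom: "f (x \<oplus>\<^bsub>A\<^esub> y) i = f x i \<oplus>\<^bsub>B i\<^esub> f y i" "f (\<sim>\<^bsub>A\<^esub> x) i = \<sim>\<^bsub>B i\<^esub> (f x i)" "f \<zero>\<^bsub>A\<^esub> i = \<zero>\<^bsub>B i\<^esub>"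
    if "x \<in> carrier A" "y \<in> carrier A" "i \<in> I" for x y i
    using f(1) that by (auto simp: mv_hom_def mv_product_def)
  have hom0: "f \<zero>\<^bsub>A\<^esub> i = \<zero>\<^bsub>B i\<^esub>" if "i \<in> I" for i
    using f(1) that by (auto simp: mv_hom_def mv_product_def)
  have T: "carrier (C \<theta>) = g (r \<theta>) ` carrier (B (r \<theta>))" "\<zero>\<^bsub>C \<theta>\<^esub> = g (r \<theta>) \<zero>\<^bsub>B (r \<theta>)\<^esub>"
    "\<And>x y. x \<in> carrier (B (r \<theta>)) \<Longrightarrow> y \<in> carrier (B (r \<theta>)) \<Longrightarrow>
        g (r \<theta>) x \<oplus>\<^bsub>C \<theta>\<^esub> g (r \<theta>) y = g (r \<theta>) (x \<oplus>\<^bsub>B (r \<theta>)\<^esub> y)"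
    "\<And>x. x \<in> carrier (B (r \<theta>)) \<Longrightarrow> \<sim>\<^bsub>C \<theta>\<^esub> (g (r \<theta>) x) = g (r \<theta>) (\<sim>\<^bsub>B (r \<theta>)\<^esub> x)"
    if "\<theta> \<in> ker ` I" for \<theta>
    unfolding C_def using mv_transport_simps[OF inj[OF r(1)[OF that]]] by auto
  have "\<forall>\<theta>\<in>ker ` I. mv_simple (C \<theta>)"
    unfolding C_def using simple r inj by (blast intro: mv_simple_transport)
  moreover have "mv_subdirect_rep A (ker ` I) C f'"
    unfolding mv_subdirect_rep_def
  proof (intro conjI ballI)
    have "f' (x \<oplus>\<^bsub>A\<^esub> y) = f' x \<oplus>\<^bsub>mv_product (ker ` I) C\<^esub> f' y"
      if xy: "x \<in> carrier A" "y \<in> carrier A" for x y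
      unfolding mv_product_def f'_def
      by (simp, rule restrict_ext) (use xy T r mem hom in simp)
    moreover have "f' (\<sim>\<^bsub>A\<^esub> x) = \<sim>\<^bsub>mv_product (ker ` I) C\<^esub> (f' x)" if x: "x \<in> carrier A" for x
      unfolding mv_product_def f'_def
      by (simp, rule restrict_ext) (use x T r mem hom in simp)
    moreover have "f' \<zero>\<^bsub>A\<^esub> = \<zero>\<^bsub>mv_product (ker ` I) C\<^esub>"
      unfolding mv_product_def f'_def
      by (simp, rule restrict_ext) (use T r mem hom0 in simp)
    moreover have "f' x \<in> carrier (mv_product (ker ` I) C)" if x: "x \<in> carrier A" for x
      unfolding mv_product_def f'_def using x mem r by (auto simp: T)
    ultimately show "f' \<in> mv_hom A (mv_product (ker ` I) C)"
      by (simp add: mv_hom_def)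
    show "inj_on f' (carrier A)"
    proof (rule inj_onI)
      fix x y assume xy: "x \<in> carrier A" "y \<in> carrier A" "f' x = f' y"
      have "f x i = f y i" if i: "i \<in> I" for i
      proof -
        have k: "ker i \<in> ker ` I" using i by simp
        from fun_cong[OF xy(3), of "ker i"] k
        have "g (r (ker i)) (f x (r (ker i))) = g (r (ker i)) (f y (r (ker i)))"
          by (simp add: f'_def)
        then have "f x (r (ker i)) = f y (r (ker i))"
          using inj_onD[OF inj[OF r(1)[OF k]]] mem[OF xy(1) r(1)[OF k]] mem[OF xy(2) r(1)[OF k]] by blast
        then have "(x, y) \<in> ker (r (ker i))" using xy by (simp add: ker_def)
        then have "(x, y) \<in> ker i" unfolding r(2)[OF k] .
        then show ?thesis by (simp add: ker_def)
      qed
      then have "f x = f y" using f_ext[OF xy(1)] f_ext[OF xy(2)] by (rule extensionalityI[rotated 2])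
      then show "x = y" using f(2) xy by (auto dest: inj_onD)
    qed
    fix \<theta> assume \<theta>: "\<theta> \<in> ker ` I"
    have "(\<lambda>x. f' x \<theta>) ` carrier A = g (r \<theta>) ` ((\<lambda>x. f x (r \<theta>)) ` carrier A)"
      using \<theta> by (simp add: f'_def image_image)
    then show "(\<lambda>x. f' x \<theta>) ` carrier A = carrier (C \<theta>)"
      by (simp add: T(1)[OF \<theta>] surj[OF r(1)[OF \<theta>]])
  qed
  ultimately show ?thesis unfolding mv_semisimple_def by blast
qed


section \<open>Free MV-algebras\<close>

datatype 'i mv_term = MVar 'i | MZero | MNeg "'i mv_term" | MPlus "'i mv_term" "'i mv_term"

text \<open>Equations between terms that follow from the axioms of MV-algebras.\<close>

inductive mv_eq :: "'i mv_term \<Rightarrow> 'i mv_term \<Rightarrow> bool" (infix \<open>\<doteq>\<close> 50) where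
  refl: "t \<doteq> t"
| sym: "s \<doteq> t \<Longrightarrow> t \<doteq> s"
| trans: "s \<doteq> t \<Longrightarrow> t \<doteq> u \<Longrightarrow> s \<doteq> u"
| cong_plus: "s \<doteq> s' \<Longrightarrow> t \<doteq> t' \<Longrightarrow> MPlus s t \<doteq> MPlus s' t'"
| cong_neg: "s \<doteq> s' \<Longrightarrow> MNeg s \<doteq> MNeg s'"
| assoc: "MPlus (MPlus s t) u \<doteq> MPlus s (MPlus t u)"
| comm: "MPlus s t \<doteq> MPlus t s"
| zero: "MPlus MZero s \<doteq> s"
| neg_neg: "MNeg (MNeg s) \<doteq> s"
| plus_neg_zero: "MPlus s (MNeg MZero) \<doteq> MNeg MZero"
| lukasiewicz: "MPlus s (MNeg (MPlus s (MNeg t))) \<doteq> MPlus t (MNeg (MPlus t (MNeg s)))"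

definition mv_terms :: "'i set \<Rightarrow> 'i mv_term set" where
  "mv_terms I = {t. set_mv_term t \<subseteq> I}"

definition mv_eq_rel :: "'i set \<Rightarrow> 'i mv_term rel" where
  "mv_eq_rel I = {(s, t). s \<in> mv_terms I \<and> t \<in> mv_terms I \<and> s \<doteq> t}"

definition free_mv :: "'i set \<Rightarrow> 'i mv_term set mv_struct" where
  "free_mv I = \<lparr>carrier = mv_terms I // mv_eq_rel I,
     mv_plus = (\<lambda>C D. \<Union>s\<in>C. \<Union>t\<in>D. mv_eq_rel I `` {MPlus s t}),
     mv_zero = mv_eq_rel I `` {MZero},
     mv_neg = (\<lambda>C. \<Union>s\<in>C. mv_eq_rel I `` {MNeg s})\<rparr>"

definition free_gen :: "'i set \<Rightarrow> 'i \<Rightarrow> 'i mv_term set" where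
  "free_gen I i = mv_eq_rel I `` {MVar i}"



lemma mv_terms_simps [simp]:
  "MVar i \<in> mv_terms I \<longleftrightarrow> i \<in> I" "MZero \<in> mv_terms I" "MNeg s \<in> mv_terms I \<longleftrightarrow> s \<in> mv_terms I"
  "MPlus s t \<in> mv_terms I \<longleftrightarrow> s \<in> mv_terms I \<and> t \<in> mv_terms I"
  by (auto simp: mv_terms_def)

lemma equiv_mv_eq_rel: "equiv (mv_terms I) (mv_eq_rel I)"
  by (rule equivI)
    (auto simp: mv_eq_rel_def refl_on_def sym_def trans_def intro: mv_eq.refl mv_eq.sym mv_eq.trans)

lemma mv_eq_class_eq:
  "s \<in> mv_terms I \<Longrightarrow> t \<in> mv_terms I \<Longrightarrow> s \<doteq> t \<Longrightarrow> mv_eq_rel I `` {s} = mv_eq_rel I `` {t}"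
  by (rule equiv_class_eq[OF equiv_mv_eq_rel]) (simp add: mv_eq_rel_def)

lemma free_mv_plus:
  assumes "s \<in> mv_terms I" "t \<in> mv_terms I"
  shows "mv_eq_rel I `` {s} \<oplus>\<^bsub>free_mv I\<^esub> mv_eq_rel I `` {t} = mv_eq_rel I `` {MPlus s t}"
proof -
  have "(\<lambda>s t. mv_eq_rel I `` {MPlus s t}) respects2 mv_eq_rel I"
    by (rule congruent2I') (rule mv_eq_class_eq; simp add: mv_eq_rel_def mv_eq.cong_plus)
  from UN_equiv_class2[OF equiv_mv_eq_rel equiv_mv_eq_rel this assms] show ?thesis
    by (simp add: free_mv_def)
qed

lemma free_mv_neg:
  assumes "s \<in> mv_terms I"
  shows "\<sim>\<^bsub>free_mv I\<^esub> (mv_eq_rel I `` {s}) = mv_eq_rel I `` {MNeg s}"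
proof -
  have "(\<lambda>s. mv_eq_rel I `` {MNeg s}) respects mv_eq_rel I"
    by (rule congruentI) (rule mv_eq_class_eq; simp add: mv_eq_rel_def mv_eq.cong_neg)
  from UN_equiv_class[OF equiv_mv_eq_rel this assms] show ?thesis
    by (simp add: free_mv_def)
qed

lemma free_mv_zero: "\<zero>\<^bsub>free_mv I\<^esub> = mv_eq_rel I `` {MZero}"
  by (simp add: free_mv_def)

lemma free_mv_carrier: "carrier (free_mv I) = (\<lambda>t. mv_eq_rel I `` {t}) ` mv_terms I"
  by (auto simp: free_mv_def quotient_def)

lemmas free_mv_simps = free_mv_plus free_mv_neg free_mv_zero free_mv_carrier

lemma mv_algebra_free_mv: "mv_algebra (free_mv I)"
proof -
  let ?c = "\<lambda>t. mv_eq_rel I `` {t}"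
  have c: "?c s \<in> carrier (free_mv I)" if "s \<in> mv_terms I" for s
    using that by (auto simp: free_mv_carrier)
  note ax = mv_eq.assoc mv_eq.comm mv_eq.zero mv_eq.neg_neg mv_eq.plus_neg_zero mv_eq.lukasiewicz
  show ?thesis
    by (rule mv_algebraI; (subst (asm) free_mv_carrier, elim imageE)?;
        (subst (asm) free_mv_carrier, elim imageE)?; (subst (asm) free_mv_carrier, elim imageE)?;
        simp add: free_mv_plus free_mv_neg free_mv_zero c mv_eq_class_eq ax)
qed

primrec mv_eval :: "('a, 'm) mv_struct_scheme \<Rightarrow> ('i \<Rightarrow> 'a) \<Rightarrow> 'i mv_term \<Rightarrow> 'a" where
  "mv_eval B p (MVar i) = p i"
| "mv_eval B p MZero = \<zero>\<^bsub>B\<^esub>"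
| "mv_eval B p (MNeg s) = \<sim>\<^bsub>B\<^esub> (mv_eval B p s)"
| "mv_eval B p (MPlus s t) = mv_eval B p s \<oplus>\<^bsub>B\<^esub> mv_eval B p t"

lemma mv_eval_closed:
  assumes "mv_algebra B" "p \<in> I \<rightarrow> carrier B" "t \<in> mv_terms I"
  shows "mv_eval B p t \<in> carrier B"
proof -
  interpret mv_algebra B by fact
  show ?thesis using assms(3)
    by (induction t) (use assms(2) in \<open>auto simp: zero_closed neg_closed plus_closed\<close>)
qed

lemma mv_eval_cong:
  assumes "t \<in> mv_terms I" "\<And>i. i \<in> I \<Longrightarrow> p i = q i"
  shows "mv_eval B p t = mv_eval B q t"
  using assms(1) by (induction t) (use assms(2) in auto)

lemma mv_eq_sound:
  assumes "s \<doteq> t" "mv_algebra B" "\<And>i. p i \<in> carrier B"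
  shows "mv_eval B p s = mv_eval B p t"
proof -
  interpret mv_algebra B by fact
  have [simp]: "mv_eval B p u \<in> carrier B" for u
    by (rule mv_eval_closed[of B p UNIV]) (use assms in \<open>auto simp: mv_terms_def\<close>)
  note axioms = plus_assoc zero_plus neg_neg plus_neg_zero plus_comm lukasiewicz
  from assms(1) show ?thesis
    by induction (simp, simp, simp, simp, simp, (simp; rule axioms; simp)+)
qed

lemma mv_eq_rel_sound:
  assumes "(s, t) \<in> mv_eq_rel I" "mv_algebra B" "p \<in> I \<rightarrow> carrier B"
  shows "mv_eval B p s = mv_eval B p t"
proof -
  interpret mv_algebra B by fact
  define q where "q i = (if i \<in> I then p i else \<zero>\<^bsub>B\<^esub>)" for i
  have "mv_eval B q s = mv_eval B q t"
    using assms by (intro mv_eq_sound) (auto simp: mv_eq_rel_def q_def zero_closed)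
  moreover have "mv_eval B p u = mv_eval B q u" if "u \<in> mv_terms I" for u
    by (rule mv_eval_cong[OF that]) (simp add: q_def)
  ultimately show ?thesis using assms(1) by (auto simp: mv_eq_rel_def)
qed

lemma free_mv_hom_eval:
  assumes "h \<in> mv_hom (free_mv I) B" "\<And>i. i \<in> I \<Longrightarrow> h (free_gen I i) = p i" "t \<in> mv_terms I"
  shows "h (mv_eq_rel I `` {t}) = mv_eval B p t"
  using assms(3)
proof (induction t)
  case (MNeg t)
  then have "h (\<sim>\<^bsub>free_mv I\<^esub> (mv_eq_rel I `` {t})) = \<sim>\<^bsub>B\<^esub> (mv_eval B p t)"
    using assms(1) by (auto simp: mv_hom_def free_mv_carrier)
  with MNeg show ?case by (simp add: free_mv_neg)
next
  case (MPlus s t)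
  then have "h (mv_eq_rel I `` {s} \<oplus>\<^bsub>free_mv I\<^esub> mv_eq_rel I `` {t}) =
      mv_eval B p s \<oplus>\<^bsub>B\<^esub> mv_eval B p t"
    using assms(1) by (auto simp: mv_hom_def free_mv_carrier)
  with MPlus show ?case by (simp add: free_mv_plus)
qed (use assms in \<open>auto simp: mv_hom_def free_mv_zero free_gen_def\<close>)

theorem free_mv_universal:
  assumes "mv_algebra B" "p \<in> I \<rightarrow> carrier B"
  shows "\<exists>!h. h \<in> mv_hom (free_mv I) B \<inter> extensional (carrier (free_mv I)) \<and>
    (\<forall>i\<in>I. h (free_gen I i) = p i)"
proof (rule ex_ex1I)
  define h where "h = (\<lambda>C\<in>carrier (free_mv I). the_elem (mv_eval B p ` C))"
  have h: "h (mv_eq_rel I `` {t}) = mv_eval B p t" if t: "t \<in> mv_terms I" for t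
  proof -
    have "mv_eval B p s = mv_eval B p t" if "s \<in> mv_eq_rel I `` {t}" for s
      using mv_eq_rel_sound[OF _ assms, of t s] that by simp
    then have "mv_eval B p ` (mv_eq_rel I `` {t}) = {mv_eval B p t}"
      using equiv_class_self[OF equiv_mv_eq_rel t] by blast
    then show ?thesis using t by (auto simp: h_def free_mv_carrier)
  qed
  have "h \<in> mv_hom (free_mv I) B"
    using mv_eval_closed[OF assms] unfolding mv_hom_def free_mv_carrier
    by (simp add: free_mv_plus free_mv_neg free_mv_zero h Pi_iff)
  then show "\<exists>h. h \<in> mv_hom (free_mv I) B \<inter> extensional (carrier (free_mv I)) \<and>
      (\<forall>i\<in>I. h (free_gen I i) = p i)"
    by (intro exI[of _ h]) (auto simp: h free_gen_def, simp add: h_def)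
next
  fix h k
  assume *: "h \<in> mv_hom (free_mv I) B \<inter> extensional (carrier (free_mv I)) \<and>
      (\<forall>i\<in>I. h (free_gen I i) = p i)"
    "k \<in> mv_hom (free_mv I) B \<inter> extensional (carrier (free_mv I)) \<and>
      (\<forall>i\<in>I. k (free_gen I i) = p i)"
  show "h = k"
  proof (rule extensionalityI[of _ "carrier (free_mv I)"])
    fix C assume "C \<in> carrier (free_mv I)"
    then obtain t where t: "t \<in> mv_terms I" and C: "C = mv_eq_rel I `` {t}"
      by (auto simp: free_mv_carrier)
    have "h C = mv_eval B p t" unfolding C by (rule free_mv_hom_eval) (use * t in auto)
    moreover have "k C = mv_eval B p t" unfolding C by (rule free_mv_hom_eval) (use * t in auto)
    ultimately show "h C = k C" by simp
  qed (use * in auto)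
qed


section \<open>Homomorphisms into the standard algebra and algebras of definable maps\<close>

text \<open>Homomorphisms are extensional functions, so that \<open>mv_W A\<close> is literally a subset of the cube
  \<open>carrier A \<rightarrow>\<^sub>E {0..1}\<close>.\<close>

definition mv_W :: "('a, 'm) mv_struct_scheme \<Rightarrow> ('a \<Rightarrow> real) set" where
  "mv_W A = mv_hom A std_mv \<inter> extensional (carrier A)"

text \<open>Existence and uniqueness of this homomorphism are instances of \<open>free_mv_universal\<close>.\<close>

definition free_ext :: "'i set \<Rightarrow> ('i \<Rightarrow> real) \<Rightarrow> 'i mv_term set \<Rightarrow> real" where
  "free_ext I p = (THE h. h \<in> mv_W (free_mv I) \<and> (\<forall>i\<in>I. h (free_gen I i) = p i))"

definition mv_M :: "'i set \<Rightarrow> ('i \<Rightarrow> real) set \<Rightarrow> (('i \<Rightarrow> real) \<Rightarrow> real) mv_struct" where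
  "mv_M I X = (mv_product X (\<lambda>_. std_mv))
     \<lparr>carrier := {(\<lambda>p\<in>X. free_ext I p t) | t. t \<in> carrier (free_mv I)}\<rparr>"


lemma free_ext_eval:
  assumes "p \<in> I \<rightarrow> {0..1}" "t \<in> mv_terms I"
  shows "free_ext I p (mv_eq_rel I `` {t}) = mv_eval std_mv p t"
proof -
  have "\<exists>!h. h \<in> mv_W (free_mv I) \<and> (\<forall>i\<in>I. h (free_gen I i) = p i)"
    unfolding mv_W_def by (rule free_mv_universal) (use assms in \<open>auto simp: mv_algebra_std_mv\<close>)
  from theI'[OF this] show ?thesis
    using free_mv_hom_eval[of "free_ext I p" I std_mv p t] assms
    by (auto simp: mv_W_def free_ext_def)
qed

lemma mv_M_carrier:
  assumes "X \<subseteq> I \<rightarrow>\<^sub>E {0..1}"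
  shows "carrier (mv_M I X) = {(\<lambda>p\<in>X. mv_eval std_mv p t) | t. t \<in> mv_terms I}"
proof -
  have "(\<lambda>p\<in>X. free_ext I p (mv_eq_rel I `` {t})) = (\<lambda>p\<in>X. mv_eval std_mv p t)"
    if "t \<in> mv_terms I" for t
    using assms that by (intro restrict_ext free_ext_eval) auto
  then have "(\<lambda>t. \<lambda>p\<in>X. free_ext I p (mv_eq_rel I `` {t})) ` mv_terms I =
      (\<lambda>t. \<lambda>p\<in>X. mv_eval std_mv p t) ` mv_terms I"
    by (rule image_cong[OF HOL.refl])
  then show ?thesis
    by (simp add: mv_M_def free_mv_carrier Setcompr_eq_image image_image)
qed

section \<open>Polyhedra\<close>

text \<open>The pointwise real vector space structure makes \<^const>\<open>convex\<close>, \<^const>\<open>hull\<close> and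
  \<^const>\<open>affine_dependent\<close> available for \<^typ>\<open>'i \<Rightarrow> real\<close>.\<close>

instantiation "fun" :: (type, real_vector) real_vector
begin

definition "scaleR_fun c f = (\<lambda>x. c *\<^sub>R f x)"

instance
  by standard (auto simp: scaleR_fun_def fun_eq_iff scaleR_add_right scaleR_add_left)

end

lemma scaleR_fun_apply [simp]: "(c *\<^sub>R f) x = c *\<^sub>R f x"
  by (simp add: scaleR_fun_def)

text \<open>
  For finite \<open>Z\<close>, the space of real vectors indexed by \<open>Z\<close> is represented by the extensional functions
  \<open>Z \<rightarrow>\<^sub>E UNIV\<close>. Affine combinations preserve the common value outside \<open>Z\<close>, so convex hulls and
  affine dependence of sets of extensional functions are those of the vectors indexed by \<open>Z\<close>.
\<close>

definition fin_simplex :: "'i set \<Rightarrow> ('i \<Rightarrow> real) set \<Rightarrow> bool" where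
  "fin_simplex Z S \<longleftrightarrow> (\<exists>V. finite V \<and> V \<subseteq> Z \<rightarrow>\<^sub>E UNIV \<and> \<not> affine_dependent V \<and> S = convex hull V)"

definition fin_polyhedron :: "'i set \<Rightarrow> ('i \<Rightarrow> real) set \<Rightarrow> bool" where
  "fin_polyhedron Z P \<longleftrightarrow> (\<exists>\<S>. finite \<S> \<and> (\<forall>S\<in>\<S>. fin_simplex Z S) \<and> P = \<Union>\<S>)"

definition cube_polyhedron :: "'i set \<Rightarrow> ('i \<Rightarrow> real) set \<Rightarrow> bool" where
  "cube_polyhedron I X \<longleftrightarrow> closedin (product_topology (\<lambda>_. top_of_set {0..1}) I) X \<and>
     (\<forall>Z. finite Z \<and> Z \<subseteq> I \<longrightarrow> fin_polyhedron Z ((\<lambda>x. restrict x Z) ` X))"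

text \<open>
  Again HOL cannot quantify over the type of \<open>I\<close>. Index sets of elements of \<^typ>\<open>'a\<close> suffice:
  \<open>mv_polyhedralI\<close> below shows that \<open>A\<close> is polyhedral as soon as it is isomorphic to \<open>mv_M I X\<close> for
  a polyhedron \<open>X\<close> in a cube over a set \<open>I\<close> of any type.
\<close>

definition mv_polyhedral :: "('a, 'm) mv_struct_scheme \<Rightarrow> bool" where
  "mv_polyhedral A \<longleftrightarrow> (\<exists>(I :: 'a set) X. cube_polyhedron I X \<and> mv_isomorphic A (mv_M I X))"

lemma mv_eval_map: "mv_eval B p (map_mv_term a t) = mv_eval B (\<lambda>i. p (a i)) t"
  by (induction t) auto

lemma sum_fun_apply: "(\<Sum>v\<in>V. F v) i = (\<Sum>v\<in>V. F v i)" for F :: "'b \<Rightarrow> 'i \<Rightarrow> real"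
  by (induction V rule: infinite_finite_induct) auto

lemma fin_simplex_reindex:
  assumes s: "bij_betw s Z Z'" and S: "fin_simplex Z' S"
  shows "fin_simplex Z ((\<lambda>q. \<lambda>j\<in>Z. q (s j)) ` S)"
proof -
  obtain V where V: "finite V" "V \<subseteq> Z' \<rightarrow>\<^sub>E UNIV" "\<not> affine_dependent V" "S = convex hull V"
    using S by (auto simp: fin_simplex_def)
  define L :: "('b \<Rightarrow> real) \<Rightarrow> 'a \<Rightarrow> real" where "L q = (\<lambda>j. if j \<in> Z then q (s j) else 0)" for q
  define c :: "'a \<Rightarrow> real" where "c = (\<lambda>j. if j \<in> Z then 0 else undefined)"
  have T: "(\<lambda>q. \<lambda>j\<in>Z. q (s j)) = (\<lambda>q. c + L q)"
    by (auto simp: fun_eq_iff L_def c_def)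
  have img: "(\<lambda>q. \<lambda>j\<in>Z. q (s j)) ` U = (+) c ` (L ` U)" for U
    unfolding T image_image ..
  have "linear L"
    by (rule linearI) (auto simp: L_def fun_eq_iff)
  have inj: "inj_on L V"
  proof (rule inj_onI)
    fix u v assume uv: "u \<in> V" "v \<in> V" "L u = L v"
    have "u i = v i" if "i \<in> Z'" for i
    proof -
      obtain j where "j \<in> Z" "i = s j" using s \<open>i \<in> Z'\<close> by (metis bij_betw_def imageE)
      then show ?thesis using fun_cong[OF uv(3), of j] by (simp add: L_def)
    qed
    then show "u = v" using uv V(2) by (intro extensionalityI[of u Z' v]) (auto simp: PiE_def)
  qed
  have "\<not> affine_dependent (L ` V)"
  proof
    assume "affine_dependent (L ` V)"
    then obtain U where U: "sum U (L ` V) = 0" "\<exists>v\<in>L ` V. U v \<noteq> 0" "(\<Sum>v\<in>L ` V. U v *\<^sub>R v) = 0"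
      using affine_dependent_explicit_finite[of "L ` V"] V(1) by auto
    have sum0: "(\<Sum>v\<in>V. U (L v)) = 0"
      using U(1) by (simp add: sum.reindex[OF inj])
    have sumL: "(\<Sum>v\<in>V. U (L v) *\<^sub>R L v) = 0"
      using U(3) by (simp add: sum.reindex[OF inj])
    have "(\<Sum>v\<in>V. U (L v) *\<^sub>R v) i = 0" for i
    proof (cases "i \<in> Z'")
      case True
      then obtain j where j: "j \<in> Z" "i = s j" using s by (metis bij_betw_def imageE)
      then show ?thesis using fun_cong[OF sumL, of j] by (simp add: L_def sum_fun_apply)
    next
      case False
      then have "(\<Sum>v\<in>V. U (L v) *\<^sub>R v) i = (\<Sum>v\<in>V. U (L v) * undefined)"
        unfolding sum_fun_apply by (intro sum.cong) (use V(2) in \<open>auto simp: PiE_def extensional_def\<close>)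
      then show ?thesis using sum0 by (simp flip: sum_distrib_right)
    qed
    then have "(\<Sum>v\<in>V. U (L v) *\<^sub>R v) = 0" by (simp add: fun_eq_iff)
    with sum0 U(2) V(1) have "affine_dependent V"
      by (auto simp: affine_dependent_explicit_finite intro!: exI[of _ "\<lambda>v. U (L v)"])
    with V(3) show False by simp
  qed
  then have "\<not> affine_dependent ((\<lambda>q. \<lambda>j\<in>Z. q (s j)) ` V)"
    unfolding img using affine_dependent_translation_eq by blast
  moreover have "(\<lambda>q. \<lambda>j\<in>Z. q (s j)) ` S = convex hull ((\<lambda>q. \<lambda>j\<in>Z. q (s j)) ` V)"
    unfolding img V(4) convex_hull_linear_image[OF \<open>linear L\<close>] convex_hull_translation ..
  moreover have "(\<lambda>q. \<lambda>j\<in>Z. q (s j)) ` V \<subseteq> Z \<rightarrow>\<^sub>E UNIV" by auto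
  ultimately show ?thesis
    using V(1) unfolding fin_simplex_def by blast
qed

lemma fin_polyhedron_reindex:
  assumes s: "bij_betw s Z Z'" and P: "fin_polyhedron Z' P"
  shows "fin_polyhedron Z ((\<lambda>q. \<lambda>j\<in>Z. q (s j)) ` P)"
proof -
  let ?T = "\<lambda>q. \<lambda>j\<in>Z. q (s j)"
  obtain \<S> where "finite \<S>" "\<forall>S\<in>\<S>. fin_simplex Z' S" "P = \<Union>\<S>"
    using P by (auto simp: fin_polyhedron_def)
  then show ?thesis
    unfolding fin_polyhedron_def
    by (intro exI[of _ "(`) ?T ` \<S>"]) (auto simp: fin_simplex_reindex[OF s])
qed

theorem mv_polyhedralI:
  fixes A :: "('a, 'm) mv_struct_scheme" and I :: "'i set"
  assumes X: "cube_polyhedron I X" and iso: "mv_isomorphic A (mv_M I X)"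
  shows "mv_polyhedral A"
proof -
  have XI: "X \<subseteq> I \<rightarrow>\<^sub>E {0..1}"
    using closedin_subset[of "product_topology (\<lambda>_. top_of_set {0..1}) I" X] X
    by (simp add: cube_polyhedron_def)
  note MI = mv_M_carrier[OF XI]
  obtain h where hom: "h \<in> mv_hom A (mv_M I X)" and bij: "bij_betw h (carrier A) (carrier (mv_M I X))"
    using iso by (auto simp: mv_isomorphic_def)
  define a where "a i = inv_into (carrier A) h (\<lambda>p\<in>X. p i)" for i
  have coord: "(\<lambda>p\<in>X. p i) \<in> carrier (mv_M I X)" if "i \<in> I" for i
    unfolding MI using that by (force intro!: exI[of _ "MVar i"])
  have ha: "h (a i) = (\<lambda>p\<in>X. p i)" if "i \<in> I" for i
    unfolding a_def using bij coord[OF that] by (simp add: bij_betw_inv_into_right)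
  have aeq: "p i = p j" if "i \<in> I" "j \<in> I" "a i = a j" "p \<in> X" for i j p
    using ha[OF that(1)] ha[OF that(2)] that(3,4) by (metis restrict_apply')
  define J where "J = a ` I"
  define s where "s = inv_into I a"
  have s: "s j \<in> I" "a (s j) = j" if "j \<in> J" for j
    using that by (auto simp: J_def s_def inv_into_into f_inv_into_f)
  have aJ: "a i \<in> J" if "i \<in> I" for i using that by (simp add: J_def)
  have sinj: "inj_on s J" by (metis inj_onI s(2))
  define \<sigma> where "\<sigma> p = (\<lambda>j\<in>J. p (s j))" for p :: "'i \<Rightarrow> real"
  define \<rho> where "\<rho> y = (\<lambda>i\<in>I. y (a i))" for y :: "'a \<Rightarrow> real"
  have \<rho>\<sigma>: "\<rho> (\<sigma> p) = p" if p: "p \<in> X" for p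
  proof (rule extensionalityI[of _ I])
    show "p \<in> extensional I" using p XI by (auto simp: PiE_def)
    fix i assume i: "i \<in> I"
    then show "\<rho> (\<sigma> p) i = p i"
      using aeq[OF s(1)[OF aJ[OF i]] i s(2)[OF aJ[OF i]] p] by (simp add: \<rho>_def \<sigma>_def aJ)
  qed (simp add: \<rho>_def)
  have \<sigma>\<rho>: "\<sigma> (\<rho> y) = y" if "y \<in> extensional J" for y
    using that by (intro extensionalityI[of _ J]) (auto simp: \<sigma>_def \<rho>_def s)
  define Y where "Y = \<sigma> ` X"
  have \<rho>Y: "\<rho> y \<in> X" if "y \<in> Y" for y using that \<rho>\<sigma> by (auto simp: Y_def)
  have YJ: "Y \<subseteq> J \<rightarrow>\<^sub>E {0..1}" using XI s by (fastforce simp: Y_def \<sigma>_def)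
  note MJ = mv_M_carrier[OF YJ]

  have "cube_polyhedron J Y"
    unfolding cube_polyhedron_def
  proof (intro conjI allI impI)
    let ?cube = "\<lambda>K. product_topology (\<lambda>_. top_of_set {0..1::real}) K"
    have "continuous_map (?cube J) (?cube I) \<rho>"
      unfolding continuous_map_componentwise
    proof (intro conjI ballI)
      fix i assume i: "i \<in> I"
      have "continuous_map (?cube J) (top_of_set {0..1}) (\<lambda>y. y (a i))"
        by (rule continuous_map_product_projection[OF aJ[OF i]])
      then show "continuous_map (?cube J) (top_of_set {0..1}) (\<lambda>y. \<rho> y i)"
        using i by (simp add: \<rho>_def)
    qed (auto simp: \<rho>_def)
    then have "closedin (?cube J) {y \<in> topspace (?cube J). \<rho> y \<in> X}"
      by (rule closedin_continuous_map_preimage) (use X in \<open>auto simp: cube_polyhedron_def\<close>)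
    also have "{y \<in> topspace (?cube J). \<rho> y \<in> X} = Y"
    proof (intro equalityI subsetI)
      fix y assume "y \<in> {y \<in> topspace (?cube J). \<rho> y \<in> X}"
      then show "y \<in> Y" using \<sigma>\<rho>[of y] by (auto simp: Y_def PiE_def intro: image_eqI[of y \<sigma> "\<rho> y"])
    next
      fix y assume "y \<in> Y"
      then show "y \<in> {y \<in> topspace (?cube J). \<rho> y \<in> X}" using YJ \<rho>Y by auto
    qed
    finally show "closedin (?cube J) Y" .
  next
    fix Z assume Z: "finite Z \<and> Z \<subseteq> J"
    have "bij_betw s Z (s ` Z)"
      using sinj Z by (auto simp: bij_betw_def intro: inj_on_subset)
    moreover have "fin_polyhedron (s ` Z) ((\<lambda>x. restrict x (s ` Z)) ` X)"
    proof -
      have "s ` Z \<subseteq> I" using Z s(1) by blast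
      with X Z show ?thesis by (simp add: cube_polyhedron_def)
    qed
    ultimately have "fin_polyhedron Z ((\<lambda>q. \<lambda>j\<in>Z. q (s j)) ` (\<lambda>x. restrict x (s ` Z)) ` X)"
      by (rule fin_polyhedron_reindex)
    also have "(\<lambda>q. \<lambda>j\<in>Z. q (s j)) ` (\<lambda>x. restrict x (s ` Z)) ` X = (\<lambda>x. restrict x Z) ` Y"
      unfolding Y_def image_image \<sigma>_def
      by (intro image_cong refl restrict_ext) (use Z in auto)
    finally show "fin_polyhedron Z ((\<lambda>x. restrict x Z) ` Y)" .
  qed
  moreover have "mv_isomorphic A (mv_M J Y)"
  proof -
    define \<phi> where "\<phi> F = (\<lambda>y\<in>Y. F (\<rho> y) :: real)" for F
    have "\<phi> F \<in> carrier (mv_M J Y)" if "F \<in> carrier (mv_M I X)" for F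
    proof -
      obtain t where t: "t \<in> mv_terms I" "F = (\<lambda>p\<in>X. mv_eval std_mv p t)"
        using \<open>F \<in> _\<close> by (auto simp: MI)
      have "\<phi> F = (\<lambda>y\<in>Y. mv_eval std_mv y (map_mv_term a t))"
        unfolding \<phi>_def mv_eval_map
        by (rule restrict_ext) (use t \<rho>Y in \<open>auto simp: \<rho>_def intro!: mv_eval_cong[OF t(1)]\<close>)
      moreover have "map_mv_term a t \<in> mv_terms J"
        using t(1) by (auto simp: mv_terms_def mv_term.set_map J_def)
      ultimately show ?thesis by (auto simp: MJ)
    qed
    moreover have "G \<in> \<phi> ` carrier (mv_M I X)" if "G \<in> carrier (mv_M J Y)" for G
    proof -
      obtain t where t: "t \<in> mv_terms J" "G = (\<lambda>y\<in>Y. mv_eval std_mv y t)"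
        using \<open>G \<in> _\<close> by (auto simp: MJ)
      have "G = \<phi> (\<lambda>p\<in>X. mv_eval std_mv p (map_mv_term s t))"
        unfolding \<phi>_def mv_eval_map t(2)
        by (rule restrict_ext)
          (use \<rho>Y s in \<open>auto simp: \<rho>_def intro!: mv_eval_cong[OF t(1)]\<close>)
      moreover have "map_mv_term s t \<in> mv_terms I"
        using t(1) s by (auto simp: mv_terms_def mv_term.set_map)
      ultimately show ?thesis by (auto simp: MI)
    qed
    moreover have "inj_on \<phi> (carrier (mv_M I X))"
    proof (rule inj_onI)
      fix F G assume FG: "F \<in> carrier (mv_M I X)" "G \<in> carrier (mv_M I X)" "\<phi> F = \<phi> G"
      have "F p = G p" if p: "p \<in> X" for p
        using fun_cong[OF FG(3), of "\<sigma> p"] p by (simp add: \<phi>_def Y_def \<rho>\<sigma>)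
      moreover have "F \<in> extensional X" "G \<in> extensional X" using FG by (auto simp: MI)
      ultimately show "F = G" by (intro extensionalityI[of F X G]) auto
    qed
    ultimately have "bij_betw \<phi> (carrier (mv_M I X)) (carrier (mv_M J Y))"
      by (auto simp: bij_betw_def)
    then have "bij_betw (\<phi> \<circ> h) (carrier A) (carrier (mv_M J Y))"
      using bij bij_betw_trans by blast
    moreover have "\<phi> (F \<oplus>\<^bsub>mv_M I X\<^esub> G) = \<phi> F \<oplus>\<^bsub>mv_M J Y\<^esub> \<phi> G" for F G
      by (auto simp: \<phi>_def mv_M_def mv_product_def \<rho>Y intro!: restrict_ext)
    moreover have "\<phi> (\<sim>\<^bsub>mv_M I X\<^esub> F) = \<sim>\<^bsub>mv_M J Y\<^esub> (\<phi> F)" for F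
      by (auto simp: \<phi>_def mv_M_def mv_product_def \<rho>Y intro!: restrict_ext)
    moreover have "\<phi> \<zero>\<^bsub>mv_M I X\<^esub> = \<zero>\<^bsub>mv_M J Y\<^esub>"
      by (auto simp: \<phi>_def mv_M_def mv_product_def \<rho>Y intro!: restrict_ext)
    ultimately have "\<phi> \<circ> h \<in> mv_hom A (mv_M J Y)"
      using hom by (auto simp: mv_hom_def bij_betw_def)
    with \<open>bij_betw (\<phi> \<circ> h) _ _\<close> show ?thesis
      unfolding mv_isomorphic_def by blast
  qed
  ultimately show ?thesis unfolding mv_polyhedral_def by blast
qed

end

theory Submission
  imports Defs
begin

text \<open>
  A hom from \<open>\<M>(X)\<close> to \<open>[0,1]\<close> is evaluation at a point of \<open>X\<close>, since for a point outside the closed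
  set \<open>X\<close> some term takes the value 0 there and 1 on \<open>X\<close>. So if \<open>A\<close> is isomorphic to \<open>\<M>(X)\<close>, then the
  projections of \<open>\<W>(A)\<close> are images of projections of \<open>X\<close> under definable, hence piecewise affine, maps,
  and these preserve polyhedra. Conversely, if homs separate the points of \<open>A\<close>, every subalgebra
  generated by a set \<open>Z\<close> is isomorphic to \<open>\<M>(\<pi>\<^sub>Z(\<W>(A)))\<close>. If the finitely generated subalgebras are
  polyhedral, homs extend from one of them to the larger ones, and by compactness to \<open>A\<close>; thus \<open>\<W>(A)\<close>
  has the same finite projections as the spaces of the finitely generated subalgebras.

  Semisimplicity means separation by homs because a simple algebra is a chain, and a chain has a hom to
  \<open>[0,1]\<close>: the value of \<open>x\<close> is the limit of \<open>\<lfloor>n x\<rfloor> / n\<close>, where \<open>\<lfloor>n x\<rfloor>\<close> counts the carries in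
  adding \<open>x\<close> to itself \<open>n\<close> times.
\<close>

section \<open>Homomorphisms of MV-chains to the unit interval\<close>

text \<open>The truncated sum forgets by how much it exceeds 1, so multiples of an element cannot be
  compared inside the algebra; the pair \<open>(m, z)\<close> keeps the lost integer part. Hoelder's
  argument then rests on one fact, that addition steps commute: it bounds all counting errors
  independently of \<open>n\<close>, and Archimedes' principle turns bounded errors into equalities.
  A chain may contain infinitesimals, which its value map collapses; so simplicity is used twice, to
  get a chain and to get injectivity. Algebras and closed sets are compared through equations
  \<open>t = 1\<close> only. Homs preserve them, and in a separated algebra such an equation holds
  once it holds under every hom. When only the finitely generated subalgebras are known to be
  polyhedral, \<open>A\<close> itself is not yet known to have any homs; hence extension is done
  inside finitely generated subalgebras before compactness is invoked. Definable maps send simplices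
  to unions of polytopes that need not be simplices. The piecewise affine part therefore works with
  convex hulls of arbitrary finite sets, and splits them into simplices only at the end.\<close>

context mv_algebra
begin

section \<open>Order, join and meet in an arbitrary MV-algebra\<close>

definition mv_times (infixl \<open>\<odot>\<close> 70) where "x \<odot> y = \<sim> (\<sim> x \<oplus> \<sim> y)"

definition mv_le (infix \<open>\<preceq>\<close> 50) where "x \<preceq> y \<longleftrightarrow> \<sim> x \<oplus> y = \<sim> \<zero>"

lemma times_closed [simp]: "x \<in> carrier A \<Longrightarrow> y \<in> carrier A \<Longrightarrow> x \<odot> y \<in> carrier A"
  by (simp add: mv_times_def plus_closed neg_closed)

declare plus_closed [simp] neg_closed [simp] zero_closed [simp] neg_neg [simp] plus_neg_zero [simp]
  zero_plus [simp]

lemma plus_zero [simp]: "x \<in> carrier A \<Longrightarrow> x \<oplus> \<zero> = x"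
  using plus_comm[of x \<zero>] by simp

lemma neg_zero_plus [simp]: "x \<in> carrier A \<Longrightarrow> \<sim> \<zero> \<oplus> x = \<sim> \<zero>"
  using plus_comm[of x "\<sim> \<zero>"] by simp

lemma plus_left_comm:
  "x \<in> carrier A \<Longrightarrow> y \<in> carrier A \<Longrightarrow> z \<in> carrier A \<Longrightarrow> x \<oplus> (y \<oplus> z) = y \<oplus> (x \<oplus> z)"
  by (metis plus_assoc plus_comm)

lemmas plus_ac = plus_assoc plus_comm plus_left_comm

lemma plus_neg [simp]: "x \<in> carrier A \<Longrightarrow> x \<oplus> \<sim> x = \<sim> \<zero>"
  using lukasiewicz[of x "\<sim> \<zero>"] by simp

lemma neg_plus [simp]: "x \<in> carrier A \<Longrightarrow> \<sim> x \<oplus> x = \<sim> \<zero>"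
  using plus_neg[of x] plus_comm[of x "\<sim> x"] by simp

lemma neg_eq_iff: "x \<in> carrier A \<Longrightarrow> y \<in> carrier A \<Longrightarrow> \<sim> x = \<sim> y \<longleftrightarrow> x = y"
  by (metis neg_neg)

lemma times_comm: "x \<in> carrier A \<Longrightarrow> y \<in> carrier A \<Longrightarrow> x \<odot> y = y \<odot> x"
  by (simp add: mv_times_def plus_comm)

lemma times_assoc:
  "x \<in> carrier A \<Longrightarrow> y \<in> carrier A \<Longrightarrow> z \<in> carrier A \<Longrightarrow> (x \<odot> y) \<odot> z = x \<odot> (y \<odot> z)"
  by (simp add: mv_times_def plus_assoc)

lemma times_one [simp]: "x \<in> carrier A \<Longrightarrow> x \<odot> \<sim> \<zero> = x"
  by (simp add: mv_times_def)

lemma times_zero [simp]: "x \<in> carrier A \<Longrightarrow> x \<odot> \<zero> = \<zero>"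
  by (simp add: mv_times_def)

lemma times_neg [simp]: "x \<in> carrier A \<Longrightarrow> x \<odot> \<sim> x = \<zero>"
  by (simp add: mv_times_def)

lemma neg_times: "x \<in> carrier A \<Longrightarrow> y \<in> carrier A \<Longrightarrow> \<sim> (x \<odot> y) = \<sim> x \<oplus> \<sim> y"
  by (simp add: mv_times_def)

lemma neg_plus_times: "x \<in> carrier A \<Longrightarrow> y \<in> carrier A \<Longrightarrow> \<sim> (x \<oplus> y) = \<sim> x \<odot> \<sim> y"
  by (simp add: mv_times_def)

text \<open>Both sides are the join of \<open>x\<close> and \<open>y\<close>: this is the
  Lukasiewicz axiom written with the truncated difference \<open>y \<odot> \<sim> x\<close>. Dually,
  both sides of \<open>meet_comm\<close> are the meet.\<close>

lemma join_comm:
  "x \<in> carrier A \<Longrightarrow> y \<in> carrier A \<Longrightarrow> x \<oplus> (y \<odot> \<sim> x) = y \<oplus> (x \<odot> \<sim> y)"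
  using lukasiewicz[of x y] by (simp add: mv_times_def plus_comm)

lemma meet_comm:
  "x \<in> carrier A \<Longrightarrow> y \<in> carrier A \<Longrightarrow> x \<odot> (\<sim> x \<oplus> y) = y \<odot> (\<sim> y \<oplus> x)"
  using arg_cong[OF join_comm[of "\<sim> x" "\<sim> y"], of "mv_neg A"]
  by (simp add: neg_times neg_plus_times plus_comm)

lemma le_refl [simp]: "x \<in> carrier A \<Longrightarrow> x \<preceq> x"
  by (simp add: mv_le_def)

lemma le_imp_plus: "x \<in> carrier A \<Longrightarrow> y \<in> carrier A \<Longrightarrow> x \<preceq> y \<Longrightarrow> x \<oplus> (y \<odot> \<sim> x) = y"
  using join_comm[of x y] by (simp add: mv_le_def mv_times_def)

lemma le_plus: "x \<in> carrier A \<Longrightarrow> y \<in> carrier A \<Longrightarrow> x \<preceq> x \<oplus> y"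
  by (simp add: mv_le_def plus_assoc[symmetric])

lemma le_antisym: "x \<in> carrier A \<Longrightarrow> y \<in> carrier A \<Longrightarrow> x \<preceq> y \<Longrightarrow> y \<preceq> x \<Longrightarrow> x = y"
  using lukasiewicz[of x y] by (simp add: mv_le_def plus_comm)

lemma le_trans:
  assumes "x \<in> carrier A" "y \<in> carrier A" "z \<in> carrier A" "x \<preceq> y" "y \<preceq> z"
  shows "x \<preceq> z"
proof -
  have "z = x \<oplus> (y \<odot> \<sim> x \<oplus> z \<odot> \<sim> y)"
    using le_imp_plus[of x y] le_imp_plus[of y z] assms by (simp add: plus_assoc[symmetric])
  then show ?thesis using le_plus[of x "y \<odot> \<sim> x \<oplus> z \<odot> \<sim> y"] assms by simp
qed

lemma zero_le [simp]: "x \<in> carrier A \<Longrightarrow> \<zero> \<preceq> x"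
  by (simp add: mv_le_def)

lemma plus_mono:
  assumes "x \<in> carrier A" "y \<in> carrier A" "z \<in> carrier A" "x \<preceq> y"
  shows "x \<oplus> z \<preceq> y \<oplus> z"
proof -
  have "y \<oplus> z = (x \<oplus> z) \<oplus> (y \<odot> \<sim> x)"
    using le_imp_plus[of x y] assms by (metis plus_assoc plus_comm times_closed neg_closed)
  then show ?thesis using le_plus[of "x \<oplus> z" "y \<odot> \<sim> x"] assms by simp
qed

lemma neg_le_neg: "x \<in> carrier A \<Longrightarrow> y \<in> carrier A \<Longrightarrow> \<sim> x \<preceq> \<sim> y \<longleftrightarrow> y \<preceq> x"
  by (simp add: mv_le_def plus_comm)

lemma times_mono:
  assumes "x \<in> carrier A" "y \<in> carrier A" "z \<in> carrier A" "x \<preceq> y"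
  shows "x \<odot> z \<preceq> y \<odot> z"
  using plus_mono[of "\<sim> y" "\<sim> x" "\<sim> z"] assms by (simp add: mv_times_def neg_le_neg)

lemma times_le: "x \<in> carrier A \<Longrightarrow> y \<in> carrier A \<Longrightarrow> x \<odot> y \<preceq> x"
  using le_plus[of "\<sim> x" "\<sim> y"] by (simp add: mv_times_def neg_le_neg[symmetric, of x])

text \<open>Truncated subtraction of \<open>y\<close> is adjoint to truncated addition of
  \<open>y\<close>; after unfolding, associativity is all there is to it.\<close>

lemma residuation:
  "x \<in> carrier A \<Longrightarrow> y \<in> carrier A \<Longrightarrow> z \<in> carrier A \<Longrightarrow> x \<odot> \<sim> y \<preceq> z \<longleftrightarrow> x \<preceq> y \<oplus> z"
  by (simp add: mv_le_def mv_times_def plus_assoc)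

lemma plus_eq_one_iff: "x \<in> carrier A \<Longrightarrow> y \<in> carrier A \<Longrightarrow> x \<oplus> y = \<sim> \<zero> \<longleftrightarrow> \<sim> y \<preceq> x"
  by (simp add: mv_le_def plus_comm)

lemma times_eq_zero_iff: "x \<in> carrier A \<Longrightarrow> y \<in> carrier A \<Longrightarrow> x \<odot> y = \<zero> \<longleftrightarrow> x \<preceq> \<sim> y"
  by (metis mv_le_def mv_times_def neg_closed neg_neg zero_closed plus_closed)

section \<open>Interchanging two additions, with and without overflow\<close>

lemma le_neg_imp_eq: "x \<in> carrier A \<Longrightarrow> y \<in> carrier A \<Longrightarrow> x \<preceq> y \<Longrightarrow> y = x \<oplus> \<sim> (x \<oplus> \<sim> y)"
  using le_imp_plus[of x y] by (simp add: mv_times_def plus_comm)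

text \<open>Both sides are \<open>z + x + y - 1\<close>, cut off at zero. From
  \<open>z \<preceq> \<sim> v\<close> follows
  \<open>\<sim> v = z \<oplus> \<sim> (z \<oplus> v)\<close>, and substituting this makes the
  expression symmetric in \<open>u\<close> and \<open>v\<close>.\<close>

lemma carry_comm_low:
  assumes c: "x \<in> carrier A" "y \<in> carrier A" "z \<in> carrier A" and le: "z \<preceq> \<sim> x" "z \<preceq> \<sim> y"
  shows "(z \<oplus> x) \<odot> y = (z \<oplus> y) \<odot> x"
proof -
  have "(z \<oplus> u) \<odot> v = \<sim> (\<sim> (z \<oplus> u) \<oplus> (z \<oplus> \<sim> (z \<oplus> v)))"
    if "u \<in> carrier A" "v \<in> carrier A" "z \<preceq> \<sim> v" for u v
    using le_neg_imp_eq[of z "\<sim> v"] that c by (simp add: mv_times_def)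
  then show ?thesis using c le by (simp add: plus_ac)
qed

lemma carry_comm_high:
  assumes c: "x \<in> carrier A" "y \<in> carrier A" "z \<in> carrier A" and le: "\<sim> x \<preceq> z" "\<sim> y \<preceq> z"
  shows "z \<odot> x \<oplus> y = z \<odot> y \<oplus> x"
proof -
  have "\<sim> z \<preceq> x" "\<sim> z \<preceq> y"
    using le neg_le_neg[of z "\<sim> x"] neg_le_neg[of z "\<sim> y"] c by simp_all
  then have "\<sim> (z \<odot> x \<oplus> y) = \<sim> (z \<odot> y \<oplus> x)"
    using carry_comm_low[of "\<sim> x" "\<sim> y" "\<sim> z"] c
    by (simp add: neg_plus_times neg_times)
  then show ?thesis using c by (simp add: neg_eq_iff)
qed

text \<open>Adding \<open>x\<close> to \<open>z\<close> overflows, adding \<open>y\<close> does not;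
  in either order \<open>z + x + y - 1\<close> remains. The bound by \<open>x\<close> later excludes
  a second overflow.\<close>

lemma carry_comm_mixed:
  assumes c: "x \<in> carrier A" "y \<in> carrier A" "z \<in> carrier A" and le: "\<sim> x \<preceq> z" "z \<preceq> \<sim> y"
  shows "z \<odot> x \<oplus> y = (z \<oplus> y) \<odot> x" "z \<odot> x \<oplus> y \<preceq> x"
proof -
  have yx: "y \<preceq> x"
    using le_trans[of "\<sim> x" z "\<sim> y"] c le by (simp add: neg_le_neg)
  have "z \<odot> x \<preceq> \<sim> y \<odot> x" using c le by (simp add: times_mono)
  then have "z \<odot> x \<oplus> y \<preceq> \<sim> y \<odot> x \<oplus> y" using c by (simp add: plus_mono)
  also have "\<sim> y \<odot> x \<oplus> y = x"
    using le_imp_plus[of y x] yx c by (simp add: plus_comm times_comm)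
  finally show le': "z \<odot> x \<oplus> y \<preceq> x" .
  \<comment> \<open>Splitting \<open>z\<close> into \<open>\<sim> x\<close> and the remainder
    \<open>z \<odot> x\<close> exhibits \<open>(z \<oplus> y) \<odot> x\<close> as the meet of
    \<open>x\<close> and \<open>z \<odot> x \<oplus> y\<close>, and the bound just shown makes this
    meet equal to its second entry.\<close>
  have "z = \<sim> x \<oplus> z \<odot> x" using le_imp_plus[of "\<sim> x" z] c le by simp
  then have "z \<oplus> y = \<sim> x \<oplus> (z \<odot> x \<oplus> y)" using c by (metis plus_assoc times_closed neg_closed)
  then have "(z \<oplus> y) \<odot> x = x \<odot> (\<sim> x \<oplus> (z \<odot> x \<oplus> y))"
    using c by (simp add: times_comm)
  also have "\<dots> = (z \<odot> x \<oplus> y) \<odot> (\<sim> (z \<odot> x \<oplus> y) \<oplus> x)" using c by (simp add: meet_comm)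
  also have "\<dots> = z \<odot> x \<oplus> y" using le' c by (simp add: mv_le_def)
  finally show "z \<odot> x \<oplus> y = (z \<oplus> y) \<odot> x" by simp
qed

lemma one_le_imp_eq: "x \<in> carrier A \<Longrightarrow> \<sim> \<zero> \<preceq> x \<Longrightarrow> x = \<sim> \<zero>"
  by (simp add: mv_le_def)

text \<open>The expression is the meet of the two truncated differences of \<open>x\<close> and
  \<open>y\<close>. Repeated use of the symmetry of meets brings a factor \<open>y\<close>, taken
  from \<open>e\<close>, next to a factor \<open>\<sim> y\<close>, taken from
  \<open>\<sim> w\<close>. No totality of the order is available here.\<close>

lemma meet_diff_zero:
  assumes c: "x \<in> carrier A" "y \<in> carrier A"
  shows "(x \<odot> \<sim> y) \<odot> (\<sim> (x \<odot> \<sim> y) \<oplus> y \<odot> \<sim> x) = \<zero>"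
proof -
  define e w where "e = y \<odot> \<sim> x" and "w = y \<oplus> e"
  have [simp]: "e \<in> carrier A" "w \<in> carrier A" using c by (auto simp: e_def w_def)
  have times_left_comm: "a \<odot> (b \<odot> u) = b \<odot> (a \<odot> u)"
    if "a \<in> carrier A" "b \<in> carrier A" "u \<in> carrier A" for a b u
    using that by (metis times_assoc times_comm)
  note ac = times_assoc times_comm times_left_comm
  have "(x \<odot> \<sim> y) \<odot> (\<sim> (x \<odot> \<sim> y) \<oplus> e) = \<sim> y \<odot> (x \<odot> (\<sim> x \<oplus> w))"
    using c by (simp add: ac neg_times w_def plus_assoc)
  also have "x \<odot> (\<sim> x \<oplus> w) = w \<odot> (\<sim> w \<oplus> x)" using c by (simp add: meet_comm)
  also have "\<sim> y \<odot> (w \<odot> (\<sim> w \<oplus> x)) = (\<sim> y \<odot> (y \<oplus> e)) \<odot> (\<sim> w \<oplus> x)"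
    using c by (simp add: w_def times_assoc)
  also have "\<sim> y \<odot> (y \<oplus> e) = e \<odot> (\<sim> e \<oplus> \<sim> y)" using c meet_comm[of "\<sim> y" e] by simp
  also have "e \<odot> (\<sim> e \<oplus> \<sim> y) \<odot> (\<sim> w \<oplus> x) = (\<sim> e \<oplus> \<sim> y) \<odot> (y \<odot> (\<sim> x \<odot> (x \<oplus> \<sim> w)))"
    using c by (simp add: ac plus_comm e_def)
  also have "\<sim> x \<odot> (x \<oplus> \<sim> w) = \<sim> w \<odot> (w \<oplus> \<sim> x)" using c meet_comm[of "\<sim> x" "\<sim> w"] by simp
  also have "\<sim> w = \<sim> y \<odot> \<sim> e" using c by (simp add: w_def neg_plus_times)
  also have "y \<odot> ((\<sim> y \<odot> \<sim> e) \<odot> (w \<oplus> \<sim> x)) = (y \<odot> \<sim> y) \<odot> (\<sim> e \<odot> (w \<oplus> \<sim> x))"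
    using c by (simp only: times_assoc times_closed plus_closed neg_closed \<open>e \<in> _\<close> \<open>w \<in> _\<close>)
  also have "(\<sim> e \<oplus> \<sim> y) \<odot> ((y \<odot> \<sim> y) \<odot> (\<sim> e \<odot> (w \<oplus> \<sim> x))) = \<zero>"
    using c times_comm[of \<zero>] by simp
  finally show ?thesis unfolding e_def .
qed

text \<open>\<open>d \<odot> \<sim> e\<close> is \<open>d\<close> minus the meet of \<open>d\<close>
  and \<open>e\<close>, and that meet is zero. Disjointness in this form, free of meets, is what the
  polars below are defined by.\<close>

lemma diff_disjoint:
  assumes c: "x \<in> carrier A" "y \<in> carrier A"
  shows "(x \<odot> \<sim> y) \<odot> \<sim> (y \<odot> \<sim> x) = x \<odot> \<sim> y"
proof -
  define d e where "d = x \<odot> \<sim> y" and "e = y \<odot> \<sim> x"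
  have [simp]: "e \<in> carrier A" "d \<in> carrier A" using c by (auto simp: e_def d_def)
  have z: "d \<odot> (\<sim> d \<oplus> e) = \<zero>" unfolding d_def e_def using c by (rule meet_diff_zero)
  have "d \<odot> \<sim> e = (d \<odot> \<sim> e) \<odot> (\<sim> (d \<odot> \<sim> e) \<oplus> d)"
    using times_le[of d "\<sim> e"] by (simp add: mv_le_def)
  also have "\<dots> = d \<odot> (\<sim> d \<oplus> d \<odot> \<sim> e)" by (simp add: meet_comm)
  also have "\<dots> = d \<odot> \<sim> (d \<odot> (\<sim> d \<oplus> e))" by (simp add: neg_times neg_plus_times)
  also have "\<dots> = d" by (simp add: z)
  finally show ?thesis by (simp add: d_def e_def)
qed

end

section \<open>Steps with carries in a totally ordered algebra\<close>

locale mv_chain = mv_algebra +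
  assumes total: "x \<in> carrier A \<Longrightarrow> y \<in> carrier A \<Longrightarrow> x \<preceq> y \<or> y \<preceq> x"
    and nontrivial: "\<zero> \<noteq> \<sim> \<zero>"
begin

text \<open>Addition of \<open>x\<close> in Chang's lattice-ordered group; the pair \<open>(m, z)\<close> stands for \<open>m + z\<close>.\<close>

fun carry_step :: "'a \<Rightarrow> nat \<times> 'a \<Rightarrow> nat \<times> 'a" where
  "carry_step x (m, z) = (if z \<oplus> x = \<sim> \<zero> then (Suc m, z \<odot> x) else (m, z \<oplus> x))"

text \<open>The unit is excluded as a remainder because \<open>(m, \<sim> \<zero>)\<close> and
  \<open>(Suc m, \<zero>)\<close> would stand for the same element.\<close>

definition states :: "(nat \<times> 'a) set" where
  "states = UNIV \<times> (carrier A - {\<sim> \<zero>})"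

lemma carry_step_closed:
  assumes x: "x \<in> carrier A" and p: "p \<in> states"
  shows "carry_step x p \<in> states"
proof -
  obtain m z where [simp]: "p = (m, z)" by (cases p)
  have z: "z \<in> carrier A" "z \<noteq> \<sim> \<zero>" using p by (auto simp: states_def)
  have "z \<odot> x \<noteq> \<sim> \<zero>"
    using times_le[of z x] one_le_imp_eq[of z] x z by auto
  then show ?thesis using x z by (auto simp: states_def)
qed

lemma funpow_carry_step_closed:
  "x \<in> carrier A \<Longrightarrow> p \<in> states \<Longrightarrow> (carry_step x ^^ n) p \<in> states"
  by (induction n) (auto simp: carry_step_closed)

lemma plus_ne_one_imp_le:
  "x \<in> carrier A \<Longrightarrow> y \<in> carrier A \<Longrightarrow> x \<oplus> y \<noteq> \<sim> \<zero> \<Longrightarrow> x \<preceq> \<sim> y"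
  using total[of x "\<sim> y"] by (auto simp: plus_eq_one_iff)

lemma carry_step_commute_mixed:
  assumes c: "x \<in> carrier A" "y \<in> carrier A" "z \<in> carrier A"
    and xy: "z \<oplus> x = \<sim> \<zero>" "z \<oplus> y \<noteq> \<sim> \<zero>"
  shows "carry_step x (carry_step y (m, z)) = carry_step y (carry_step x (m, z))"
proof -
  have le: "\<sim> x \<preceq> z" "z \<preceq> \<sim> y" using c xy by (auto simp: plus_eq_one_iff plus_ne_one_imp_le)
  note mixed = carry_comm_mixed[OF c le]
  have "z \<oplus> y \<oplus> x = \<sim> \<zero>"
    using c xy by (metis plus_assoc plus_comm neg_zero_plus)
  moreover have "z \<odot> x \<oplus> y \<noteq> \<sim> \<zero>"
  proof
    assume *: "z \<odot> x \<oplus> y = \<sim> \<zero>"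
    then have "x = \<sim> \<zero>" using mixed(2) one_le_imp_eq c by simp
    with * xy(2) c show False by simp
  qed
  ultimately show ?thesis using xy mixed(1) by simp
qed

text \<open>Four cases, according to which of the two additions to \<open>z\<close> overflows; each
  reduces to one of the \<open>carry_comm\<close> identities.\<close>

lemma carry_step_commute:
  assumes c: "x \<in> carrier A" "y \<in> carrier A" and p: "p \<in> states"
  shows "carry_step x (carry_step y p) = carry_step y (carry_step x p)"
proof -
  obtain m z where [simp]: "p = (m, z)" by (cases p)
  have z: "z \<in> carrier A" using p by (auto simp: states_def)
  consider "z \<oplus> x = \<sim> \<zero>" "z \<oplus> y \<noteq> \<sim> \<zero>" | "z \<oplus> x \<noteq> \<sim> \<zero>" "z \<oplus> y = \<sim> \<zero>"
    | "z \<oplus> x = \<sim> \<zero>" "z \<oplus> y = \<sim> \<zero>" | "z \<oplus> x \<noteq> \<sim> \<zero>" "z \<oplus> y \<noteq> \<sim> \<zero>" by blast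
  then show ?thesis
  proof cases
    case 3
    then have "\<sim> x \<preceq> z" "\<sim> y \<preceq> z" using c z by (auto simp: plus_eq_one_iff)
    then show ?thesis using 3 carry_comm_high[OF c z] c z
      by (simp add: times_assoc times_comm[of x y])
  next
    case 4
    then have "z \<preceq> \<sim> x" "z \<preceq> \<sim> y" using c z by (auto simp: plus_ne_one_imp_le)
    then show ?thesis using 4 carry_comm_low[OF c z] c z
      by (simp add: plus_assoc plus_comm[of x y])
  qed (use c z carry_step_commute_mixed in auto)
qed

lemma funpow_carry_step_commute:
  "x \<in> carrier A \<Longrightarrow> y \<in> carrier A \<Longrightarrow> p \<in> states \<Longrightarrow>
    (carry_step x ^^ n) (carry_step y p) = carry_step y ((carry_step x ^^ n) p)"
  by (induction n) (auto simp: carry_step_commute funpow_carry_step_closed)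

lemma funpow_carry_step_comp:
  "x \<in> carrier A \<Longrightarrow> y \<in> carrier A \<Longrightarrow> p \<in> states \<Longrightarrow>
    ((carry_step x \<circ> carry_step y) ^^ n) p = (carry_step x ^^ n) ((carry_step y ^^ n) p)"
  by (induction n)
    (auto simp: funpow_carry_step_closed carry_step_closed carry_step_commute funpow_carry_step_commute)

lemma funpow_carry_step_shift:
  "(carry_step x ^^ n) (m + k, z) = map_prod ((+) m) id ((carry_step x ^^ n) (k, z))"
proof (induction n)
  case (Suc n)
  then show ?case by (cases "(carry_step x ^^ n) (k, z)") simp
qed simp

section \<open>Integer parts of multiples and the value they converge to\<close>

definition mult_floor :: "nat \<Rightarrow> 'a \<Rightarrow> nat" where
  "mult_floor n x = fst ((carry_step x ^^ n) (0, \<zero>))"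

lemma carry_step_zero: "x \<in> carrier A \<Longrightarrow> x \<noteq> \<sim> \<zero> \<Longrightarrow> carry_step x (m, \<zero>) = (m, x)"
  by simp

lemma zero_state [simp]: "(m, \<zero>) \<in> states"
  using nontrivial by (simp add: states_def)

lemma fst_carry_step: "fst p \<le> fst (carry_step x p)" "fst (carry_step x p) \<le> Suc (fst p)"
  by (cases p; simp)+

text \<open>Up to a shift by \<open>m\<close>, the start \<open>(m, z)\<close> is reached from zero
  by a step with \<open>z\<close>. Commuting that step past the others puts it at the end, where it
  raises the count by at most 1.\<close>

lemma fst_funpow_carry_step:
  assumes x: "x \<in> carrier A" and p: "p \<in> states"
  shows "fst p + mult_floor n x \<le> fst ((carry_step x ^^ n) p)"
    "fst ((carry_step x ^^ n) p) \<le> fst p + mult_floor n x + 1"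
proof -
  obtain m z where [simp]: "p = (m, z)" by (cases p)
  have z: "z \<in> carrier A" "z \<noteq> \<sim> \<zero>" using p by (auto simp: states_def)
  have "(carry_step x ^^ n) (0, z) = carry_step z ((carry_step x ^^ n) (0, \<zero>))"
    using funpow_carry_step_commute[where x = x and y = z and p = "(0, \<zero>)" and n = n] x z by (simp add: states_def nontrivial)
  then have "fst ((carry_step x ^^ n) (m, z)) = m + fst (carry_step z ((carry_step x ^^ n) (0, \<zero>)))"
    using funpow_carry_step_shift[where x = x and n = n and m = m and k = 0 and z = z] by simp
  then show "fst p + mult_floor n x \<le> fst ((carry_step x ^^ n) p)"
    "fst ((carry_step x ^^ n) p) \<le> fst p + mult_floor n x + 1"
    using fst_carry_step[where p = "(carry_step x ^^ n) (0, \<zero>)" and x = z] by (auto simp: mult_floor_def)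
qed

lemma mult_floor_add:
  assumes "x \<in> carrier A"
  shows "mult_floor n x + mult_floor k x \<le> mult_floor (n + k) x"
    "mult_floor (n + k) x \<le> mult_floor n x + mult_floor k x + 1"
  using fst_funpow_carry_step[OF assms funpow_carry_step_closed[where x = x and p = "(0, \<zero>)" and n = k], of n] assms
  by (auto simp: mult_floor_def funpow_add)

lemma mult_floor_mult:
  assumes "x \<in> carrier A"
  shows "k * mult_floor n x \<le> mult_floor (k * n) x"
    "mult_floor (k * n) x \<le> k * mult_floor n x + k"
proof (induction k)
  case (Suc k)
  { case 1 then show ?case using Suc(1) mult_floor_add(1)[OF assms, of n "k * n"] by simp }
  { case 2 then show ?case using Suc(2) mult_floor_add(2)[OF assms, of n "k * n"] by simp }
qed (auto simp: mult_floor_def)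

text \<open>A supremum needs no proof of convergence; by \<open>chain_val_approx\<close> it is also
  the limit, with error at most \<open>1 / n\<close>.\<close>

definition chain_val :: "'a \<Rightarrow> real" where
  "chain_val x = (SUP n\<in>{1..}. mult_floor n x / n)"

text \<open>Comparing both sides with the count for the multiple \<open>k * n\<close> shows that
  every lower estimate is below every upper one, so the supremum lies between them.\<close>

lemma mult_floor_div_le:
  assumes x: "x \<in> carrier A" and "n \<ge> 1" "k \<ge> 1"
  shows "mult_floor n x / n \<le> (mult_floor k x + 1) / k"
proof -
  have "k * mult_floor n x \<le> n * mult_floor k x + n"
    using mult_floor_mult(1)[OF x, of k n] mult_floor_mult(2)[OF x, of n k] by (simp add: mult.commute)
  then have "real k * mult_floor n x \<le> real n * (mult_floor k x + 1)"
    by (simp add: distrib_left flip: of_nat_mult of_nat_add)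
  then show ?thesis using assms by (simp add: field_simps)
qed

lemma chain_val_approx:
  assumes x: "x \<in> carrier A"
  shows "\<bar>real n * chain_val x - mult_floor n x\<bar> \<le> 1"
proof (cases "n \<ge> 1")
  case True
  have "mult_floor n x / n \<le> chain_val x"
    unfolding chain_val_def using True
    by (intro cSUP_upper bdd_aboveI[of _ "(mult_floor 1 x + 1) / (1::nat)"])
      (use mult_floor_div_le[OF x, of _ 1] in auto)
  moreover have "chain_val x \<le> (mult_floor n x + 1) / n"
    unfolding chain_val_def using True
    by (intro cSUP_least) (use mult_floor_div_le[OF x] in auto)
  ultimately show ?thesis using True by (simp add: field_simps abs_le_iff)
next
  case False
  then have "n = 0" by simp
  then show ?thesis by (simp add: mult_floor_def)
qed

lemma eq_if_multiples_close:
  fixes a b :: real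
  assumes "\<And>n :: nat. \<bar>n * a - n * b\<bar> \<le> C"
  shows "a = b"
proof (rule ccontr)
  assume "a \<noteq> b"
  then obtain n :: nat where "C < n * \<bar>a - b\<bar>" using reals_Archimedean3[of "\<bar>a - b\<bar>"] by auto
  also have "\<dots> = \<bar>n * a - n * b\<bar>" by (simp add: abs_mult flip: right_diff_distrib)
  finally show False using assms[of n] by simp
qed

lemma mult_floor_pair:
  assumes "x \<in> carrier A" "y \<in> carrier A"
  shows "mult_floor n x + mult_floor n y \<le> fst (((carry_step x \<circ> carry_step y) ^^ n) (0, \<zero>))"
    "fst (((carry_step x \<circ> carry_step y) ^^ n) (0, \<zero>)) \<le> mult_floor n x + mult_floor n y + 1"
  using fst_funpow_carry_step[OF assms(1) funpow_carry_step_closed[where x = y and p = "(0, \<zero>)" and n = n], of n] assms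
  by (auto simp: funpow_carry_step_comp mult_floor_def)

lemma chain_val_add:
  assumes c: "x \<in> carrier A" "y \<in> carrier A" "w \<in> carrier A"
    and pow: "\<And>n. fst (((carry_step x \<circ> carry_step y) ^^ n) (0, \<zero>)) = n * m + mult_floor n w"
  shows "chain_val x + chain_val y = m + chain_val w"
proof (rule eq_if_multiples_close)
  fix n :: nat
  have "real (mult_floor n x) + mult_floor n y \<le> n * m + mult_floor n w"
    "n * m + mult_floor n w \<le> real (mult_floor n x) + mult_floor n y + 1"
    using mult_floor_pair[OF c(1,2), of n] unfolding pow by linarith+
  \<comment> \<open>The constant 4 collects an error of 1 for each of the three values and 1 for
    counting the two summands together.\<close>
  then show "\<bar>n * (chain_val x + chain_val y) - n * (m + chain_val w)\<bar> \<le> 4"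
    using chain_val_approx[OF c(1), of n] chain_val_approx[OF c(2), of n]
      chain_val_approx[OF c(3), of n]
    unfolding distrib_left abs_le_iff of_nat_add of_nat_mult by (intro conjI; linarith)
qed

text \<open>The composition of two steps agrees with a single step because the three commute and all
  states arise from \<open>(m, \<zero>)\<close> by a step.\<close>

lemma carry_step_comp_eq:
  assumes c: "x \<in> carrier A" "y \<in> carrier A" "w \<in> carrier A" and p: "p \<in> states"
    and eq: "\<And>m. carry_step x (carry_step y (m, \<zero>)) = carry_step w (m + k, \<zero>)"
  shows "carry_step x (carry_step y p) = map_prod ((+) k) id (carry_step w p)"
proof -
  obtain m z where [simp]: "p = (m, z)" by (cases p)
  have z: "z \<in> carrier A" "z \<noteq> \<sim> \<zero>" using p by (auto simp: states_def)
  have "carry_step x (carry_step y p) = carry_step x (carry_step y (carry_step z (m, \<zero>)))"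
    using carry_step_zero[OF z] by simp
  also have "\<dots> = carry_step x (carry_step z (carry_step y (m, \<zero>)))"
    using carry_step_commute[OF c(2) z(1) zero_state] by simp
  also have "\<dots> = carry_step z (carry_step x (carry_step y (m, \<zero>)))"
    by (intro carry_step_commute carry_step_closed zero_state c z)
  also have "\<dots> = carry_step z (carry_step w (m + k, \<zero>))" by (simp only: eq)
  also have "\<dots> = carry_step w (carry_step z (m + k, \<zero>))"
    by (intro carry_step_commute carry_step_closed zero_state c z)
  also have "\<dots> = carry_step w (m + k, z)" using carry_step_zero[OF z] by simp
  also have "\<dots> = map_prod ((+) k) id (carry_step w p)" by simp
  finally show ?thesis .
qed

text \<open>An identity of steps at remainder zero spreads to all states and then to all iterates,
  so values are added by inspecting a single addition. The number \<open>k\<close> is its carry: 0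
  without overflow, 1 with it.\<close>

lemma chain_val_add_of_step:
  assumes c: "x \<in> carrier A" "y \<in> carrier A" "w \<in> carrier A"
    and eq: "\<And>m. carry_step x (carry_step y (m, \<zero>)) = carry_step w (m + k, \<zero>)"
  shows "chain_val x + chain_val y = k + chain_val w"
proof (rule chain_val_add[OF c])
  fix n
  have "((carry_step x \<circ> carry_step y) ^^ n) (0, \<zero>) = map_prod ((+) (n * k)) id ((carry_step w ^^ n) (0, \<zero>))"
  proof (induction n)
    case (Suc n)
    obtain m z where mz: "(carry_step w ^^ n) (0, \<zero>) = (m, z)" by (cases "(carry_step w ^^ n) (0, \<zero>)")
    have "(m, z) \<in> states" using funpow_carry_step_closed[OF c(3), where p = "(0, \<zero>)" and n = n] mz by simp
    then have "(n * k + m, z) \<in> states" by (simp add: states_def)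
    have "((carry_step x \<circ> carry_step y) ^^ Suc n) (0, \<zero>) = carry_step x (carry_step y (n * k + m, z))"
      by (simp only: funpow.simps comp_apply Suc mz map_prod_simp id_apply)
    also have "\<dots> = map_prod ((+) k) id (carry_step w (n * k + m, z))"
      by (rule carry_step_comp_eq[OF c \<open>(n * k + m, z) \<in> states\<close> eq])
    also have "\<dots> = map_prod ((+) (Suc n * k)) id (carry_step w (m, z))" by simp
    also have "carry_step w (m, z) = (carry_step w ^^ Suc n) (0, \<zero>)"
      by (simp only: funpow.simps comp_apply mz)
    finally show ?case .
  qed simp
  then show "fst (((carry_step x \<circ> carry_step y) ^^ n) (0, \<zero>)) = n * k + mult_floor n w"
    by (simp add: mult_floor_def)
qed

lemma chain_val_nonneg: "x \<in> carrier A \<Longrightarrow> 0 \<le> chain_val x"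
proof -
  assume x: "x \<in> carrier A"
  have "mult_floor 1 x / (1::nat) \<le> chain_val x"
    unfolding chain_val_def
    by (intro cSUP_upper bdd_aboveI[of _ "(mult_floor 1 x + 1) / (1::nat)"])
      (use mult_floor_div_le[OF x, of _ 1] in auto)
  then show ?thesis by (rule order_trans[rotated]) simp
qed

lemma chain_val_zero: "chain_val \<zero> = 0"
  using chain_val_add_of_step[of \<zero> \<zero> \<zero> 0] nontrivial by simp

lemma chain_val_one: "chain_val (\<sim> \<zero>) = 1"
proof -
  have "(carry_step (\<sim> \<zero>) ^^ n) (0, \<zero>) = (n, \<zero>)" for n
    by (induction n) auto
  then have "mult_floor n (\<sim> \<zero>) = n" for n by (simp add: mult_floor_def)
  then have "(\<lambda>n. mult_floor n (\<sim> \<zero>) / n) ` {1..} = {1}" by (auto simp: image_iff intro: exI[of _ 1])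
  then show ?thesis by (simp add: chain_val_def)
qed

lemma chain_val_plus_low:
  assumes c: "x \<in> carrier A" "y \<in> carrier A" and ne: "x \<oplus> y \<noteq> \<sim> \<zero>"
  shows "chain_val (x \<oplus> y) = chain_val x + chain_val y"
proof -
  have "y \<noteq> \<sim> \<zero>" "x \<noteq> \<sim> \<zero>" using c ne by auto
  then show ?thesis using chain_val_add_of_step[of x y "x \<oplus> y" 0] c ne by (simp add: plus_comm)
qed

lemma chain_val_plus_high:
  assumes c: "x \<in> carrier A" "y \<in> carrier A" and eq: "x \<oplus> y = \<sim> \<zero>"
  shows "chain_val x + chain_val y = 1 + chain_val (x \<odot> y)"
\<comment> \<open>The step from zero must leave \<open>y\<close> as a remainder, which the unit
  cannot be.\<close>
proof (cases "y = \<sim> \<zero>")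
  case False
  have "x \<odot> y \<noteq> \<sim> \<zero>"
    using False times_le[of y x] one_le_imp_eq[of y] c by (auto simp: times_comm)
  then show ?thesis using chain_val_add_of_step[of x y "x \<odot> y" 1] c eq False
    by (simp add: plus_comm times_comm)
qed (use c in \<open>simp add: chain_val_one\<close>)

lemma chain_val_neg:
  assumes "x \<in> carrier A"
  shows "chain_val (\<sim> x) = 1 - chain_val x"
  using chain_val_plus_high[of x "\<sim> x"] assms by (simp add: chain_val_zero)

theorem chain_val_hom: "chain_val \<in> mv_hom A std_mv"
proof -
  have range: "chain_val x \<in> {0..1}" if "x \<in> carrier A" for x
    using that chain_val_nonneg[of x] chain_val_nonneg[of "\<sim> x"] chain_val_neg[of x] by auto
  have "chain_val (x \<oplus> y) = min (chain_val x + chain_val y) 1"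
    if "x \<in> carrier A" "y \<in> carrier A" for x y
  proof (cases "x \<oplus> y = \<sim> \<zero>")
    case True
    then show ?thesis
      using that chain_val_plus_high[of x y] chain_val_nonneg[of "x \<odot> y"] by (simp add: chain_val_one)
  next
    case False
    then show ?thesis
      using that chain_val_plus_low[of x y] range[of "x \<oplus> y"] by simp
  qed
  then show ?thesis using range chain_val_neg chain_val_zero by (auto simp: mv_hom_def)
qed

end

section \<open>Semisimplicity as separation by homomorphisms\<close>

context mv_algebra
begin

text \<open>With \<open>diff_plus\<close> it bounds differences by sums of differences; this is what
  makes an ideal define a transitive relation compatible with addition.\<close>

lemma diff_triangle:
  assumes c: "x \<in> carrier A" "y \<in> carrier A" "z \<in> carrier A"
  shows "x \<odot> \<sim> z \<preceq> x \<odot> \<sim> y \<oplus> y \<odot> \<sim> z"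
proof -
  have "x \<preceq> y \<oplus> x \<odot> \<sim> y" using residuation[of x y "x \<odot> \<sim> y"] c by simp
  moreover have "y \<oplus> x \<odot> \<sim> y \<preceq> (z \<oplus> y \<odot> \<sim> z) \<oplus> x \<odot> \<sim> y"
    using residuation[of y z "y \<odot> \<sim> z"] c by (intro plus_mono) auto
  ultimately have "x \<preceq> z \<oplus> (x \<odot> \<sim> y \<oplus> y \<odot> \<sim> z)"
    using le_trans[of x "y \<oplus> x \<odot> \<sim> y" "z \<oplus> (x \<odot> \<sim> y \<oplus> y \<odot> \<sim> z)"] c by (simp add: plus_ac)
  then show ?thesis using residuation c by simp
qed

lemma diff_plus:
  assumes c: "x \<in> carrier A" "y \<in> carrier A" "u \<in> carrier A" "v \<in> carrier A"
  shows "(x \<oplus> u) \<odot> \<sim> (y \<oplus> v) \<preceq> x \<odot> \<sim> y \<oplus> u \<odot> \<sim> v"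
proof -
  have "x \<oplus> u \<preceq> (y \<oplus> x \<odot> \<sim> y) \<oplus> u"
    using residuation[of x y "x \<odot> \<sim> y"] c by (intro plus_mono) auto
  moreover have "u \<oplus> (y \<oplus> x \<odot> \<sim> y) \<preceq> (v \<oplus> u \<odot> \<sim> v) \<oplus> (y \<oplus> x \<odot> \<sim> y)"
    using residuation[of u v "u \<odot> \<sim> v"] c by (intro plus_mono) auto
  ultimately have "x \<oplus> u \<preceq> (y \<oplus> v) \<oplus> (x \<odot> \<sim> y \<oplus> u \<odot> \<sim> v)"
    using le_trans[of "x \<oplus> u" "u \<oplus> (y \<oplus> x \<odot> \<sim> y)" "(y \<oplus> v) \<oplus> (x \<odot> \<sim> y \<oplus> u \<odot> \<sim> v)"] c
    by (simp add: plus_ac)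
  then show ?thesis using residuation c by simp
qed

text \<open>\<open>e \<odot> \<sim> u = e\<close> says that \<open>u\<close> and \<open>e\<close> are disjoint; the elements disjoint from \<open>e\<close> form an ideal.\<close>

definition polar :: "'a \<Rightarrow> 'a set" where
  "polar e = {u \<in> carrier A. e \<odot> \<sim> u = e}"

lemma polar_plus:
  assumes "e \<in> carrier A" "u \<in> polar e" "v \<in> polar e"
  shows "u \<oplus> v \<in> polar e"
  using assms by (simp add: polar_def neg_plus_times times_assoc[symmetric])

lemma polar_le:
  assumes e: "e \<in> carrier A" and u: "u \<in> polar e" and w: "w \<in> carrier A" "w \<preceq> u"
  shows "w \<in> polar e"
proof -
  have u': "u \<in> carrier A" "e \<odot> \<sim> u = e" using u by (auto simp: polar_def)
  have "\<sim> u \<odot> e \<preceq> \<sim> w \<odot> e" using u' w e by (intro times_mono) (auto simp: neg_le_neg)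
  then have "e \<preceq> e \<odot> \<sim> w" using u' e w times_comm[of _ e] by simp
  then have "e \<odot> \<sim> w = e" using times_le[of e "\<sim> w"] le_antisym[of "e \<odot> \<sim> w" e] e w by simp
  then show ?thesis using w by (simp add: polar_def)
qed

definition polar_cong :: "'a \<Rightarrow> 'a rel" where
  "polar_cong e = {(x, y). x \<in> carrier A \<and> y \<in> carrier A \<and> x \<odot> \<sim> y \<in> polar e \<and> y \<odot> \<sim> x \<in> polar e}"

lemma polar_cong_congruence:
  assumes e: "e \<in> carrier A"
  shows "mv_congruence A (polar_cong e)"
  unfolding mv_congruence_def
proof (intro conjI)
  have zero: "\<zero> \<in> polar e" using e by (simp add: polar_def)
  have tri: "x \<odot> \<sim> z \<in> polar e"
    if "x \<in> carrier A" "y \<in> carrier A" "z \<in> carrier A" "x \<odot> \<sim> y \<in> polar e" "y \<odot> \<sim> z \<in> polar e"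
    for x y z
    using polar_le[OF e polar_plus[OF e that(4,5)] _ diff_triangle[OF that(1-3)]] that by simp
  show "equiv (carrier A) (polar_cong e)"
  proof (rule equivI)
    show "refl_on (carrier A) (polar_cong e)"
      using zero by (auto simp: refl_on_def polar_cong_def)
    show "Relation.sym (polar_cong e)" by (auto simp: sym_def polar_cong_def)
    show "Relation.trans (polar_cong e)"
      unfolding trans_def polar_cong_def using tri by blast
  qed (auto simp: polar_cong_def)
  have "(x \<oplus> u) \<odot> \<sim> (y \<oplus> v) \<in> polar e"
    if "x \<in> carrier A" "y \<in> carrier A" "u \<in> carrier A" "v \<in> carrier A"
      "x \<odot> \<sim> y \<in> polar e" "u \<odot> \<sim> v \<in> polar e" for x y u v
    using polar_le[OF e polar_plus[OF e that(5,6)] _ diff_plus[OF that(1-4)]] that by simp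
  then show "\<forall>(x, y)\<in>polar_cong e. \<forall>(u, v)\<in>polar_cong e. (x \<oplus> u, y \<oplus> v) \<in> polar_cong e"
    by (auto simp: polar_cong_def)
  show "\<forall>(x, y)\<in>polar_cong e. (\<sim> x, \<sim> y) \<in> polar_cong e"
    by (auto simp: polar_cong_def times_comm)
qed

text \<open>The difference \<open>d\<close> is disjoint from the opposite difference
  \<open>e\<close>, hence congruent to zero modulo the polar of \<open>e\<close>. If that congruence
  is equality, then \<open>d = \<zero>\<close>. If it is everything, the unit is disjoint from
  \<open>e\<close>, which forces \<open>e = \<zero>\<close>.\<close>

lemma mv_simple_imp_chain:
  assumes simple: "mv_simple A"
  shows "mv_chain A"
proof unfold_locales
  have nt: "\<exists>x\<in>carrier A. \<exists>y\<in>carrier A. x \<noteq> y"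
    and cong: "\<And>\<theta>. mv_congruence A \<theta> \<Longrightarrow> \<theta> = Id_on (carrier A) \<or> \<theta> = carrier A \<times> carrier A"
    using simple by (auto simp: mv_simple_def)
  show "\<zero> \<noteq> \<sim> \<zero>"
  proof
    assume *: "\<zero> = \<sim> \<zero>"
    have "x = \<zero>" if "x \<in> carrier A" for x using times_one[OF that] times_zero[OF that] * by simp
    with nt show False by metis
  qed
  fix x y assume c: "x \<in> carrier A" "y \<in> carrier A"
  define d e where "d = x \<odot> \<sim> y" and "e = y \<odot> \<sim> x"
  have ed [simp]: "e \<in> carrier A" "d \<in> carrier A" using c by (auto simp: e_def d_def)
  have "e \<odot> \<sim> d = e" using diff_disjoint[OF c(2,1)] by (simp add: d_def e_def)
  then have d: "(d, \<zero>) \<in> polar_cong e"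
    using times_comm[of \<zero>] by (simp add: polar_cong_def polar_def)
  have "d = \<zero> \<or> e = \<zero>"
    using cong[OF polar_cong_congruence[OF ed(1)]]
  proof
    assume "polar_cong e = Id_on (carrier A)"
    then show ?thesis using d by (auto simp: Id_on_def)
  next
    assume "polar_cong e = carrier A \<times> carrier A"
    then have "(\<sim> \<zero>, \<zero>) \<in> polar_cong e" by simp
    then show ?thesis by (auto simp: polar_cong_def polar_def)
  qed
  then show "x \<preceq> y \<or> y \<preceq> x"
    using times_eq_zero_iff[of x "\<sim> y"] times_eq_zero_iff[of y "\<sim> x"] c by (simp add: d_def e_def)
qed

end

lemma mv_homD:
  assumes "h \<in> mv_hom A B"
  shows "x \<in> carrier A \<Longrightarrow> h x \<in> carrier B"
    "x \<in> carrier A \<Longrightarrow> y \<in> carrier A \<Longrightarrow> h (x \<oplus>\<^bsub>A\<^esub> y) = h x \<oplus>\<^bsub>B\<^esub> h y"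
    "h \<zero>\<^bsub>A\<^esub> = \<zero>\<^bsub>B\<^esub>" "x \<in> carrier A \<Longrightarrow> h (\<sim>\<^bsub>A\<^esub> x) = \<sim>\<^bsub>B\<^esub> (h x)"
  using assms by (auto simp: mv_hom_def)

text \<open>The kernel of \<open>chain_val\<close> is a congruence that keeps zero and unit apart,
  so by simplicity it is equality.\<close>

theorem mv_simple_embed:
  assumes simple: "mv_simple A"
  shows "\<exists>h \<in> mv_hom A std_mv. inj_on h (carrier A)"
proof -
  interpret mv_algebra A using simple by (simp add: mv_simple_def)
  interpret mv_chain A by (rule mv_simple_imp_chain[OF simple])
  define \<theta> where "\<theta> = {(x, y). x \<in> carrier A \<and> y \<in> carrier A \<and> chain_val x = chain_val y}"
  note hom = mv_homD[OF chain_val_hom]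
  have "mv_congruence A \<theta>"
    unfolding mv_congruence_def equiv_def refl_on_def sym_def trans_def \<theta>_def by (auto simp: hom)
  then have "\<theta> = Id_on (carrier A) \<or> \<theta> = carrier A \<times> carrier A"
    using simple by (simp add: mv_simple_def)
  moreover have "(\<zero>\<^bsub>A\<^esub>, \<sim>\<^bsub>A\<^esub> \<zero>\<^bsub>A\<^esub>) \<in> carrier A \<times> carrier A - \<theta>" by (simp add: \<theta>_def chain_val_zero chain_val_one)
  ultimately have \<theta>: "\<theta> = Id_on (carrier A)" by blast
  have "inj_on chain_val (carrier A)"
  proof (rule inj_onI)
    fix x y assume "x \<in> carrier A" "y \<in> carrier A" "chain_val x = chain_val y"
    then have "(x, y) \<in> Id_on (carrier A)" by (simp add: \<theta>_def flip: \<theta>)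
    then show "x = y" by (auto simp: Id_on_def)
  qed
  with chain_val_hom show ?thesis by blast
qed

section \<open>Subalgebras of the unit interval and separation by homs\<close>

lemma mv_subalgebra_algebra:
  assumes "mv_algebra A" and S: "mv_subalgebra S A"
  shows "mv_algebra (A\<lparr>carrier := S\<rparr>)"
proof -
  interpret mv_algebra A by fact
  have "x \<in> carrier A" if "x \<in> S" for x using S that by (auto simp: mv_subalgebra_def)
  then show ?thesis
    using S by (intro mv_algebraI)
      (auto simp: mv_subalgebra_def plus_assoc intro: plus_comm lukasiewicz)
qed

text \<open>Adding \<open>1 - y\<close> to an identified pair \<open>x < y\<close> and negating
  identifies \<open>y - x\<close> with 0. By Archimedes some truncated multiple of
  \<open>y - x\<close> is 1, so 1 and 0 are identified; adding \<open>z\<close> to both identifies 1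
  with every \<open>z\<close>.\<close>

lemma std_subalgebra_simple:
  assumes S: "mv_subalgebra S std_mv"
  shows "mv_simple (std_mv\<lparr>carrier := S\<rparr>)"
proof -
  let ?S = "std_mv\<lparr>carrier := S\<rparr>"
  have S: "S \<subseteq> {0..1}" "0 \<in> S" "\<And>x y. x \<in> S \<Longrightarrow> y \<in> S \<Longrightarrow> min (x + y) 1 \<in> S" "\<And>x. x \<in> S \<Longrightarrow> 1 - x \<in> S"
    and alg: "mv_algebra ?S"
    using S mv_subalgebra_algebra[OF mv_algebra_std_mv S] by (auto simp: mv_subalgebra_def)
  have "1 \<in> S" using S(4)[OF S(2)] by simp
  moreover have "\<theta> = S \<times> S" if \<theta>: "mv_congruence ?S \<theta>" and ne: "\<theta> \<noteq> Id_on S" for \<theta>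
  proof -
    have eq: "equiv S \<theta>" using \<theta> by (simp add: mv_congruence_def)
    have refl: "\<And>x. x \<in> S \<Longrightarrow> (x, x) \<in> \<theta>" and sym: "\<And>x y. (x, y) \<in> \<theta> \<Longrightarrow> (y, x) \<in> \<theta>"
      and trans: "\<And>x y z. (x, y) \<in> \<theta> \<Longrightarrow> (y, z) \<in> \<theta> \<Longrightarrow> (x, z) \<in> \<theta>" and sub: "\<theta> \<subseteq> S \<times> S"
      using eq by (blast elim: equivE dest: refl_onD symD transD)+
    have plus: "(min (x + u) 1, min (y + v) 1) \<in> \<theta>" if "(x, y) \<in> \<theta>" "(u, v) \<in> \<theta>" for x y u v
      using \<theta> that by (fastforce simp: mv_congruence_def)
    have neg: "(1 - x, 1 - y) \<in> \<theta>" if "(x, y) \<in> \<theta>" for x y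
      using \<theta> that by (fastforce simp: mv_congruence_def)
    obtain x y where xy: "(x, y) \<in> \<theta>" "x \<noteq> y"
      using ne sub refl by (auto simp: Id_on_def)
    then obtain x y where xy: "(x, y) \<in> \<theta>" "x < y"
      using sym by (metis linorder_less_linear)
    have xyS: "x \<in> S" "y \<in> S" using xy sub by auto
    define d where "d = y - x"
    have "(min (x + (1 - y)) 1, min (y + (1 - y)) 1) \<in> \<theta>"
      by (rule plus[OF xy(1) refl[OF S(4)[OF xyS(2)]]])
    then have "(1 - d, 1) \<in> \<theta>" using xy xyS S(1) by (simp add: d_def min_def algebra_simps)
    from neg[OF this] have d: "(d, 0) \<in> \<theta>" by simp
    have "(min (n * d) 1, 0) \<in> \<theta>" for n :: nat
    proof (induction n)
      case (Suc n)
      have "min (min (n * d) 1 + d) 1 = min (Suc n * d) 1"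
        using xy by (auto simp: min_def d_def algebra_simps)
      then show ?case using plus[OF Suc d] by simp
    qed (use refl S in simp)
    moreover obtain n :: nat where "1 < n * d" using reals_Archimedean3[of d] xy by (auto simp: d_def)
    ultimately have one: "(1, 0) \<in> \<theta>" by (metis min.absorb2 less_imp_le)
    have "(1, z) \<in> \<theta>" if "z \<in> S" for z
    proof -
      have "0 \<le> z" "z \<le> 1" using that S(1) by auto
      then show ?thesis using plus[OF one refl[OF that]] by simp
    qed
    then have "(x, y) \<in> \<theta>" if "x \<in> S" "y \<in> S" for x y using that sym trans by meson
    with sub show ?thesis by auto
  qed
  ultimately show ?thesis using S(2) alg unfolding mv_simple_def by fastforce
qed

definition mv_separated :: "('a, 'm) mv_struct_scheme \<Rightarrow> bool" where
  "mv_separated A \<longleftrightarrow> (\<forall>x\<in>carrier A. \<forall>y\<in>carrier A. (\<forall>h\<in>mv_hom A std_mv. h x = h y) \<longrightarrow> x = y)"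

lemma mv_hom_restrict:
  assumes "mv_algebra A" "h \<in> mv_hom A B"
  shows "restrict h (carrier A) \<in> mv_hom A B"
proof -
  interpret mv_algebra A by fact
  show ?thesis using mv_homD[OF assms(2)]
    by (auto simp: mv_hom_def plus_closed zero_closed neg_closed)
qed

lemma mv_hom_compose:
  "g \<in> mv_hom B C \<Longrightarrow> h \<in> mv_hom A B \<Longrightarrow> g \<circ> h \<in> mv_hom A C"
  by (auto simp: mv_hom_def Pi_iff)

lemma mv_hom_image_subalgebra:
  assumes "mv_algebra A" "h \<in> mv_hom A B"
  shows "mv_subalgebra (h ` carrier A) B"
proof -
  interpret mv_algebra A by fact
  note h = mv_homD[OF assms(2)]
  show ?thesis unfolding mv_subalgebra_def
    using h(1) by (auto simp flip: h(2-4) intro!: imageI plus_closed zero_closed neg_closed)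
qed

theorem mv_semisimple_iff_separated:
  fixes A :: "('a, 'm) mv_struct_scheme"
  assumes A: "mv_algebra A"
  shows "mv_semisimple A \<longleftrightarrow> mv_separated A"
proof
  assume "mv_semisimple A"
  then obtain I :: "'a rel set" and B :: "'a rel \<Rightarrow> 'a set mv_struct" and f
    where simple: "\<forall>i\<in>I. mv_simple (B i)" and rep: "mv_subdirect_rep A I B f"
    by (auto simp: mv_semisimple_def)
  have f: "f \<in> mv_hom A (mv_product I B)" and inj: "inj_on f (carrier A)"
    using rep by (auto simp: mv_subdirect_rep_def)
  show "mv_separated A"
    unfolding mv_separated_def
  proof (intro ballI impI, rule ccontr)
    fix x y assume xy: "x \<in> carrier A" "y \<in> carrier A" "\<forall>h\<in>mv_hom A std_mv. h x = h y" "x \<noteq> y"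
    have "f x \<noteq> f y" using inj xy by (auto dest: inj_onD)
    moreover have "f x \<in> extensional I" "f y \<in> extensional I"
      using mv_homD(1)[OF f] xy by (auto simp: mv_product_def PiE_def)
    ultimately obtain i where i: "i \<in> I" "f x i \<noteq> f y i" by (meson extensionalityI)
    obtain g where g: "g \<in> mv_hom (B i) std_mv" "inj_on g (carrier (B i))"
      using mv_simple_embed simple i(1) by blast
    have fi: "(\<lambda>x. f x i) \<in> mv_hom A (B i)"
      using f i(1) by (auto simp: mv_hom_def mv_product_def)
    then have "g \<circ> (\<lambda>x. f x i) \<in> mv_hom A std_mv" using g(1) mv_hom_compose by blast
    then have "g (f x i) = g (f y i)" using xy(3) by force
    then show False using g(2) i(2) mv_homD(1)[OF fi] xy(1,2) by (auto dest: inj_onD)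
  qed
next
  assume sep: "mv_separated A"
  \<comment> \<open>The canonical representation: one factor for each hom, namely its image. Its
    index type consists of real functions, and \<open>mv_semisimpleI\<close> converts it to the type
    fixed in the definition.\<close>
  let ?I = "mv_hom A std_mv" and ?B = "\<lambda>h. std_mv\<lparr>carrier := h ` carrier A\<rparr>"
    and ?f = "\<lambda>x. \<lambda>h\<in>mv_hom A std_mv. h x"
  interpret mv_algebra A by fact
  show "mv_semisimple A"
  proof (rule mv_semisimpleI)
    show "\<forall>h\<in>?I. mv_simple (?B h)"
      using std_subalgebra_simple mv_hom_image_subalgebra[OF A] by blast
    have "?f \<in> mv_hom A (mv_product ?I ?B)"
      unfolding mv_hom_def mv_product_def
      by (auto simp: mv_homD intro!: restrict_ext)
    moreover have "inj_on ?f (carrier A)"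
    proof (rule inj_onI)
      fix x y assume xy: "x \<in> carrier A" "y \<in> carrier A" "?f x = ?f y"
      have "h x = h y" if "h \<in> ?I" for h using fun_cong[OF xy(3), of h] that by simp
      then show "x = y" using sep xy by (auto simp: mv_separated_def)
    qed
    ultimately show "mv_subdirect_rep A ?I ?B ?f"
      by (auto simp: mv_subdirect_rep_def)
  qed
qed

section \<open>Separating closed sets from points by terms\<close>

text \<open>With \<open>c(r)\<close> for \<open>max 0 (min 1 r)\<close>, the induction rests on
  \<open>c(y + x) = (c(y) \<oplus> x) \<odot> c(y + 1)\<close> for \<open>x\<close> in the unit
  interval, an identity familiar from McNaughton's theorem. It needs the hypothesis for
  \<open>m - 1\<close> too, so \<open>m\<close> ranges over all integers.\<close>

lemma clamp_term:
  "\<exists>t. set_mv_term t \<subseteq> set_mv_term s \<and>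
    (\<forall>p. mv_eval std_mv p s \<in> {0..1} \<longrightarrow>
      mv_eval std_mv p t = max 0 (min 1 (real n * mv_eval std_mv p s - of_int m)))"
proof (induction n arbitrary: m)
  case 0
  show ?case
  proof (cases "m \<ge> 0")
    case True
    then show ?thesis by (intro exI[of _ MZero]) (simp add: max_def)
  next
    case False
    then have "m \<le> -1" by simp
    then have "real_of_int m \<le> -1" by linarith
    then show ?thesis by (intro exI[of _ "MNeg MZero"]) (simp add: min_def)
  qed
next
  case (Suc n)
  obtain u where u: "set_mv_term u \<subseteq> set_mv_term s" "\<And>p. mv_eval std_mv p s \<in> {0..1} \<Longrightarrow>
      mv_eval std_mv p u = max 0 (min 1 (real n * mv_eval std_mv p s - of_int m))"
    using Suc[of m] by auto
  obtain v where v: "set_mv_term v \<subseteq> set_mv_term s" "\<And>p. mv_eval std_mv p s \<in> {0..1} \<Longrightarrow>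
      mv_eval std_mv p v = max 0 (min 1 (real n * mv_eval std_mv p s - of_int (m - 1)))"
    using Suc[of "m - 1"] by auto
  let ?t = "MNeg (MPlus (MNeg (MPlus u s)) (MNeg v))"
  have "mv_eval std_mv p ?t = max 0 (min 1 (real (Suc n) * mv_eval std_mv p s - of_int m))"
    if "mv_eval std_mv p s \<in> {0..1}" for p
  proof -
    define x y where "x = mv_eval std_mv p s" and "y = real n * x - of_int m"
    have "1 - min (1 - min (max 0 (min 1 y) + x) 1 + (1 - max 0 (min 1 (y + 1)))) 1 =
        max 0 (min 1 (y + x))"
      using that by (auto simp: x_def min_def max_def)
    moreover have "real n * x - of_int (m - 1) = y + 1" "real (Suc n) * x - of_int m = y + x"
      by (simp_all add: y_def algebra_simps)
    moreover have "mv_eval std_mv p ?t = 1 - min (1 - min (mv_eval std_mv p u + x) 1 + (1 - mv_eval std_mv p v)) 1"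
      by (simp add: x_def)
    ultimately show ?thesis
      unfolding u(2)[OF that] v(2)[OF that] by (simp only: x_def[symmetric] y_def[symmetric])
  qed
  with u(1) v(1) show ?case by (intro exI[of _ ?t]) auto
qed

lemma threshold_term:
  assumes "a < b"
  shows "\<exists>t. set_mv_term t \<subseteq> set_mv_term s \<and> (\<forall>p. mv_eval std_mv p s \<in> {0..1} \<longrightarrow>
    (mv_eval std_mv p s \<le> a \<longrightarrow> mv_eval std_mv p t = 0) \<and>
    (mv_eval std_mv p s \<ge> b \<longrightarrow> mv_eval std_mv p t = 1))"
proof -
  \<comment> \<open>Length 2 leaves 1 for rounding \<open>n * a\<close> up to an integer and 1 for
    the ramp from 0 to 1.\<close>
  obtain n :: nat where n: "2 < n * (b - a)"
    using reals_Archimedean3[of "b - a"] assms by auto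
  define m where "m = \<lceil>n * a\<rceil>"
  have m: "n * a \<le> m" "m < n * a + 1" unfolding m_def by linarith+
  obtain t where t: "set_mv_term t \<subseteq> set_mv_term s"
    "\<And>p. mv_eval std_mv p s \<in> {0..1} \<Longrightarrow>
      mv_eval std_mv p t = max 0 (min 1 (real n * mv_eval std_mv p s - of_int m))"
    using clamp_term[of s n m] by auto
  have "max 0 (min 1 (n * x - m)) = 0" if "x \<le> a" for x :: real
    using mult_left_mono[OF that, of "real n"] m by (simp add: min_def max_def)
  moreover have "max 0 (min 1 (n * x - m)) = 1" if "x \<ge> b" for x :: real
    using mult_left_mono[OF that, of "real n"] m n by (simp add: right_diff_distrib)
  ultimately show ?thesis using t by (intro exI[of _ t]) simp
qed

abbreviation cube :: "'i set \<Rightarrow> ('i \<Rightarrow> real) topology" where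
  "cube I \<equiv> product_topology (\<lambda>_. top_of_set {0..1}) I"

text \<open>One ramp rises from \<open>p i\<close> to \<open>p i + e\<close>; another, built on the
  negated variable, falls from \<open>p i - e\<close> to \<open>p i\<close>. Their truncated sum
  vanishes at \<open>p\<close> and is 1 at distance \<open>e\<close> or more.\<close>

lemma coordinate_separating_term:
  assumes U: "openin (top_of_set {0..1}) U" and p: "p i \<in> U"
  shows "\<exists>t. set_mv_term t \<subseteq> {i} \<and> mv_eval std_mv p t = 0 \<and>
    (\<forall>q. q i \<in> {0..1} - U \<longrightarrow> mv_eval std_mv q t = 1)"
proof -
  have p01: "p i \<in> {0..1}" using openin_subset[OF U] p by auto
  obtain e where e: "e > 0" "\<And>x. x \<in> {0..1} \<Longrightarrow> dist x (p i) < e \<Longrightarrow> x \<in> U"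
    using U p unfolding openin_euclidean_subtopology_iff by blast
  obtain s where s: "set_mv_term s \<subseteq> {i}" "\<And>q. q i \<in> {0..1} \<Longrightarrow>
      (q i \<le> p i \<longrightarrow> mv_eval std_mv q s = 0) \<and> (q i \<ge> p i + e \<longrightarrow> mv_eval std_mv q s = 1)"
    using threshold_term[of "p i" "p i + e" "MVar i"] e(1) by auto
  obtain t where t: "set_mv_term t \<subseteq> {i}" "\<And>q. q i \<in> {0..1} \<Longrightarrow>
      (1 - q i \<le> 1 - p i \<longrightarrow> mv_eval std_mv q t = 0) \<and>
      (1 - q i \<ge> 1 - p i + e \<longrightarrow> mv_eval std_mv q t = 1)"
    using threshold_term[of "1 - p i" "1 - p i + e" "MNeg (MVar i)"] e(1) by auto
  have "mv_eval std_mv q (MPlus s t) = 1" if q: "q i \<in> {0..1} - U" for q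
  proof -
    have "\<not> \<bar>q i - p i\<bar> < e" using e(2)[of "q i"] q by (auto simp: dist_real_def)
    then have "q i \<le> p i \<and> 1 - q i \<ge> 1 - p i + e \<or> q i \<ge> p i + e \<and> 1 - q i \<le> 1 - p i"
      by linarith
    then show ?thesis using s(2)[of q] t(2)[of q] q by auto
  qed
  moreover have "mv_eval std_mv p (MPlus s t) = 0" using s(2)[of p] t(2)[of p] p01 by simp
  ultimately show ?thesis using s(1) t(1) by (intro exI[of _ "MPlus s t"]) auto
qed

lemma mv_eval_std_range:
  "t \<in> mv_terms I \<Longrightarrow> p \<in> I \<rightarrow> {0..1} \<Longrightarrow> mv_eval std_mv p t \<in> {0..1}"
  using mv_eval_closed[OF mv_algebra_std_mv, of p I t] by simp

lemma finite_separating_term: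
  assumes "finite Z" "Z \<subseteq> I" "p \<in> I \<rightarrow> {0..1}"
    and "\<And>i. i \<in> Z \<Longrightarrow> openin (top_of_set {0..1}) (U i) \<and> p i \<in> U i"
  shows "\<exists>t\<in>mv_terms I. mv_eval std_mv p t = 0 \<and>
    (\<forall>q\<in>I \<rightarrow> {0..1}. (\<exists>i\<in>Z. q i \<notin> U i) \<longrightarrow> mv_eval std_mv q t = 1)"
  using assms(1,2,4)
proof (induction Z)
  case empty
  show ?case by (intro bexI[of _ MZero]) auto
next
  case (insert i Z)
  obtain t where t: "t \<in> mv_terms I" "mv_eval std_mv p t = 0"
    "\<And>q. q \<in> I \<rightarrow> {0..1} \<Longrightarrow> \<exists>i\<in>Z. q i \<notin> U i \<Longrightarrow> mv_eval std_mv q t = 1"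
    using insert.IH insert.prems by auto
  obtain s where s: "set_mv_term s \<subseteq> {i}" "mv_eval std_mv p s = 0"
    "\<And>q. q i \<in> {0..1} - U i \<Longrightarrow> mv_eval std_mv q s = 1"
    using coordinate_separating_term[of "U i" p i] insert.prems(2) by blast
  have sI: "s \<in> mv_terms I" using s(1) insert.prems(1) by (auto simp: mv_terms_def)
  have "mv_eval std_mv q (MPlus s t) = 1"
    if q: "q \<in> I \<rightarrow> {0..1}" and j: "\<exists>j\<in>insert i Z. q j \<notin> U j" for q
  proof -
    have range: "0 \<le> mv_eval std_mv q s" "0 \<le> mv_eval std_mv q t"
      using mv_eval_std_range[OF sI q] mv_eval_std_range[OF t(1) q] by auto
    show ?thesis
    proof (cases "q i \<in> U i")
      case True
      then show ?thesis using t(3)[OF q] j range by auto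
    next
      case False
      moreover have "q i \<in> {0..1}" using q insert.prems(1) by auto
      ultimately show ?thesis using s(3)[of q] range by auto
    qed
  qed
  then show ?case using s(2) t(1,2) sI by (intro bexI[of _ "MPlus s t"]) auto
qed

text \<open>A basic open box around a point outside \<open>X\<close> restricts only finitely many
  coordinates. A finite truncated sum of coordinate terms is therefore 0 at the point and 1 on
  \<open>X\<close>.\<close>

theorem mem_closed_of_terms:
  assumes X: "closedin (cube I) X" and p: "p \<in> I \<rightarrow>\<^sub>E {0..1}"
    and imp: "\<And>t. t \<in> mv_terms I \<Longrightarrow> \<forall>q\<in>X. mv_eval std_mv q t = 1 \<Longrightarrow> mv_eval std_mv p t = 1"
  shows "p \<in> X"
proof (rule ccontr)
  assume "p \<notin> X"
  have top: "topspace (cube I) = I \<rightarrow>\<^sub>E {0..1}" by simp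
  have op: "openin (cube I) (topspace (cube I) - X)" using X by (simp add: closedin_def)
  have pX: "p \<in> topspace (cube I) - X" using p \<open>p \<notin> X\<close> top by auto
  obtain U where "finite {i \<in> I. U i \<noteq> topspace (top_of_set {0..1::real})} \<and>
      (\<forall>i\<in>I. openin (top_of_set {0..1}) (U i)) \<and> p \<in> Pi\<^sub>E I U \<and> Pi\<^sub>E I U \<subseteq> topspace (cube I) - X"
    using bspec[OF iffD1[OF openin_product_topology_alt op] pX] ..
  then have U: "finite {i \<in> I. U i \<noteq> topspace (top_of_set {0..1::real})}"
    "\<And>i. i \<in> I \<Longrightarrow> openin (top_of_set {0..1}) (U i)" "p \<in> Pi\<^sub>E I U"
    "Pi\<^sub>E I U \<subseteq> topspace (cube I) - X"
    by simp_all
  define Z where "Z = {i \<in> I. U i \<noteq> topspace (top_of_set {0..1::real})}"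
  have "\<exists>t\<in>mv_terms I. mv_eval std_mv p t = 0 \<and>
      (\<forall>q\<in>I \<rightarrow> {0..1}. (\<exists>i\<in>Z. q i \<notin> U i) \<longrightarrow> mv_eval std_mv q t = 1)"
    using U p by (intro finite_separating_term) (auto simp: Z_def)
  then obtain t where t: "t \<in> mv_terms I" "mv_eval std_mv p t = 0"
    "\<And>q. q \<in> I \<rightarrow> {0..1} \<Longrightarrow> \<exists>i\<in>Z. q i \<notin> U i \<Longrightarrow> mv_eval std_mv q t = 1" by blast
  have "mv_eval std_mv q t = 1" if q: "q \<in> X" for q
  proof (rule t(3))
    have qI: "q \<in> I \<rightarrow>\<^sub>E {0..1}" using closedin_subset[OF X] q by auto
    then show "q \<in> I \<rightarrow> {0..1}" by auto
    have "q \<notin> Pi\<^sub>E I U" using U(4) q by blast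
    then obtain i where "i \<in> I" "q i \<notin> U i" using qI by (auto simp: PiE_def)
    moreover from this have "i \<in> Z" using qI by (auto simp: Z_def)
    ultimately show "\<exists>i\<in>Z. q i \<notin> U i" by blast
  qed
  with imp[OF t(1)] t(2) show False by simp
qed

lemma compact_space_cube: "compact_space (cube I)"
  by (simp add: compact_space_product_topology compact_space_subtopology)

lemma Hausdorff_space_cube: "Hausdorff_space (cube I)"
  by (simp add: Hausdorff_space_product_topology Hausdorff_space_subtopology)

text \<open>Projections are closed maps here because the cube is compact and the target
  Hausdorff.\<close>

lemma closedin_cube_restrict:
  assumes X: "closedin (cube I) X" and Z: "Z \<subseteq> I"
  shows "closedin (cube Z) ((\<lambda>x. restrict x Z) ` X)"
proof -
  have "continuous_map (cube I) (cube Z) (\<lambda>x. restrict x Z)"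
    unfolding continuous_map_componentwise
  proof (intro conjI ballI)
    fix i assume i: "i \<in> Z"
    then have "continuous_map (cube I) (top_of_set {0..1}) (\<lambda>x. x i)"
      using Z by (intro continuous_map_product_projection) auto
    then show "continuous_map (cube I) (top_of_set {0..1}) (\<lambda>x. restrict x Z i)"
      using i by simp
  qed auto
  then show ?thesis
    using continuous_imp_closed_map[OF _ compact_space_cube Hausdorff_space_cube] X
    by (auto simp: closed_map_def)
qed

lemma continuous_map_cube_component:
  "i \<in> I \<Longrightarrow> continuous_map (cube I) euclideanreal (\<lambda>x. x i)"
  using continuous_map_product_projection[of i I "\<lambda>_. top_of_set {0..1::real}"]
  by (simp add: continuous_map_in_subtopology)

lemma closedin_equalizers:
  assumes "\<And>e. e \<in> E \<Longrightarrow> continuous_map X euclideanreal (f e)"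
    and "\<And>e. e \<in> E \<Longrightarrow> continuous_map X euclideanreal (g e)"
  shows "closedin X {x \<in> topspace X. \<forall>e\<in>E. f e x = g e x}"
proof -
  \<comment> \<open>The whole space is added to the family because \<open>E\<close> may be
    empty.\<close>
  have "closedin X (\<Inter>(insert (topspace X) ((\<lambda>e. {x \<in> topspace X. f e x = g e x}) ` E)))"
  proof (rule closedin_Inter)
    fix S assume "S \<in> insert (topspace X) ((\<lambda>e. {x \<in> topspace X. f e x = g e x}) ` E)"
    then show "closedin X S"
      using assms by (auto intro!: closedin_continuous_maps_eq[of euclideanreal])
  qed simp
  also have "\<Inter>(insert (topspace X) ((\<lambda>e. {x \<in> topspace X. f e x = g e x}) ` E)) =
      {x \<in> topspace X. \<forall>e\<in>E. f e x = g e x}" by auto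
  finally show ?thesis .
qed

section \<open>Piecewise affine images of polyhedra\<close>

text \<open>Bookkeeping for the redistribution of weights in the next lemma: \<open>e\<close> is the
  identity when points are summed, and constantly 1 when weights are summed.\<close>

lemma sum_product_weights:
  fixes l g :: "'v \<Rightarrow> real" and e :: "'v \<Rightarrow> 'u::real_vector"
  assumes a: "(\<Sum>v\<in>P. l v * g v) = a" "a \<noteq> 0"
  shows "(\<Sum>v\<in>P. \<Sum>w\<in>N. (l w * (l v * g v) / a) *\<^sub>R e w + (l v * (l w * - g w) / a) *\<^sub>R e v) =
    (\<Sum>w\<in>N. l w *\<^sub>R e w) + (\<Sum>v\<in>P. (l v * (\<Sum>w\<in>N. l w * - g w) / a) *\<^sub>R e v)"
proof -
  have "(\<Sum>v\<in>P. \<Sum>w\<in>N. (l w * (l v * g v) / a) *\<^sub>R e w) = (\<Sum>w\<in>N. l w *\<^sub>R e w)"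
  proof (subst sum.swap, rule sum.cong[OF HOL.refl])
    fix w
    have "(\<Sum>v\<in>P. l w * (l v * g v) / a) = l w"
      using a(2) by (simp only: a(1) flip: sum_distrib_left sum_divide_distrib) simp
    then show "(\<Sum>v\<in>P. (l w * (l v * g v) / a) *\<^sub>R e w) = l w *\<^sub>R e w"
      by (simp flip: scaleR_sum_left)
  qed
  moreover have "(\<Sum>w\<in>N. (l v * (l w * - g w) / a) *\<^sub>R e v) =
      (l v * (\<Sum>w\<in>N. l w * - g w) / a) *\<^sub>R e v" for v
    by (simp only: sum_distrib_left sum_divide_distrib scaleR_sum_left)
  ultimately show ?thesis by (simp only: sum.distrib)
qed

text \<open>The part of the hull in the half-space is generated by the given points \<open>P\<close>
  inside it and the points \<open>cut v w\<close> where segments from \<open>P\<close> to the outer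
  points \<open>N\<close> cross the boundary. For a point inside, the positive moment
  \<open>a\<close> of its weights outweighs the negative moment \<open>b\<close>; so the weight on
  \<open>N\<close> can be moved entirely into crossing points, at the cost of a share
  \<open>b / a\<close> of the weight on \<open>P\<close>.\<close>

lemma convex_hull_finite_halfspace:
  fixes f :: "'v::real_vector \<Rightarrow> real"
  assumes V: "finite V" and f: "linear f"
  shows "\<exists>W. finite W \<and> convex hull V \<inter> {x. c \<le> f x} = convex hull W"
proof -
  define g where "g x = f x - c" for x
  have g_comb: "g (\<Sum>v\<in>U. a v *\<^sub>R v) = (\<Sum>v\<in>U. a v * g v)" if "sum a U = 1" for a U
    using that by (simp add: g_def linear_sum[OF f] linear_cmul[OF f] right_diff_distrib
        sum_subtractf flip: sum_distrib_right)
  define P N where "P = {v \<in> V. 0 \<le> g v}" and "N = {v \<in> V. g v < 0}"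
  have fin: "finite P" "finite N" and PN: "P \<inter> N = {}" "V = P \<union> N"
    and sub: "P \<subseteq> V" "N \<subseteq> V"
    using V by (auto simp: P_def N_def)
  define cut where "cut v w = (g v / (g v - g w)) *\<^sub>R w + (- g w / (g v - g w)) *\<^sub>R v" for v w
  define W where "W = P \<union> (\<lambda>(v, w). cut v w) ` (P \<times> N)"
  have finW: "finite W" using fin by (simp add: W_def)
  have pos: "g v - g w > 0" if "v \<in> P" "w \<in> N" for v w using that by (auto simp: P_def N_def)
  have cut_hull: "cut v w \<in> convex hull {w, v}" if "v \<in> P" "w \<in> N" for v w
    unfolding cut_def convex_hull_2
    by (rule CollectI, rule exI[of _ "g v / (g v - g w)"], rule exI[of _ "- g w / (g v - g w)"])
      (use pos[OF that] that in \<open>auto simp: P_def N_def diff_divide_distrib[symmetric] intro: divide_nonpos_pos\<close>)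
  have g_cut: "g (cut v w) = 0" if "v \<in> P" "w \<in> N" for v w
  proof -
    have "g (a *\<^sub>R w + b *\<^sub>R v) = a * g w + b * g v" if "b = 1 - a" for a b
      unfolding that g_def linear_add[OF f] linear_cmul[OF f] by (simp add: algebra_simps)
    moreover have "- g w / (g v - g w) = 1 - g v / (g v - g w)"
      using pos[OF that] by (simp add: field_simps)
    ultimately have "g (cut v w) = g v / (g v - g w) * g w + (- g w / (g v - g w)) * g v"
      unfolding cut_def by blast
    then show ?thesis by simp
  qed
  have "W \<subseteq> convex hull V \<inter> {x. c \<le> f x}"
  proof -
    have "cut v w \<in> convex hull V" if "v \<in> P" "w \<in> N" for v w
      using cut_hull[OF that] hull_mono[of "{w, v}" V convex] that sub by blast
    moreover have "c \<le> f (cut v w)" if "v \<in> P" "w \<in> N" for v w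
      using g_cut[OF that] by (simp add: g_def)
    ultimately show ?thesis
      using hull_subset[of V convex] sub by (auto simp: W_def) (auto simp: P_def g_def)
  qed
  moreover have "convex (convex hull V \<inter> {x. c \<le> f x})"
    using convex_linear_vimage[OF f, of "{c..}"] by (simp add: convex_Int vimage_def)
  ultimately have "convex hull W \<subseteq> convex hull V \<inter> {x. c \<le> f x}"
    by (rule hull_minimal)
  moreover have "x \<in> convex hull W" if x: "x \<in> convex hull V" and fx: "c \<le> f x" for x
  proof -
    obtain l where l: "\<And>v. v \<in> V \<Longrightarrow> 0 \<le> l v" "sum l V = 1" "x = (\<Sum>v\<in>V. l v *\<^sub>R v)"
      using x convex_hull_finite[OF V] by auto
    define a b where "a = (\<Sum>v\<in>P. l v * g v)" and "b = (\<Sum>w\<in>N. l w * - g w)"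
    have "g x = a - b"
      using g_comb[OF l(2)] l(3) unfolding a_def b_def PN(2)
      by (simp add: sum.union_disjoint[OF fin PN(1)] sum_negf)
    then have ab: "b \<le> a" using fx by (simp add: g_def)
    have lN: "0 \<le> l w * - g w" if "w \<in> N" for w
      using that l(1) by (intro mult_nonneg_nonneg) (auto simp: N_def)
    then have "0 \<le> b" unfolding b_def by (rule sum_nonneg)
    have x: "x = (\<Sum>v\<in>P. l v *\<^sub>R v) + (\<Sum>w\<in>N. l w *\<^sub>R w)" and one: "sum l P + sum l N = 1"
      using l(2,3) unfolding PN(2) by (simp_all add: sum.union_disjoint[OF fin PN(1)])
    show ?thesis
    proof (cases "a = 0")
      case True
      then have "b = 0" using ab \<open>0 \<le> b\<close> by simp
      then have "l w * - g w = 0" if "w \<in> N" for w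
        using that lN sum_nonneg_eq_0_iff[OF fin(2), of "\<lambda>w. l w * - g w"] by (simp add: b_def)
      then have l0: "l w = 0" if "w \<in> N" for w using that by (force simp: N_def)
      then have "x = (\<Sum>v\<in>P. l v *\<^sub>R v)" "sum l P = 1" using x one by simp_all
      then have "x \<in> convex hull P"
        using l(1) sub unfolding convex_hull_finite[OF fin(1)] by blast
      then show ?thesis using hull_mono[of P W convex] by (auto simp: W_def)
    next
      case False
      then have a: "a > 0" using ab \<open>0 \<le> b\<close> by simp
      \<comment> \<open>The factor \<open>g v - g w\<close> cancels the denominators in
        \<open>cut v w\<close>; division by \<open>a\<close> makes the contributions of all
        \<open>v\<close> to a fixed \<open>w\<close> add up to exactly \<open>l w\<close>.\<close>
      let ?p = "\<lambda>(v, w). l v * l w * (g v - g w) / a"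
      have pcut: "?p (v, w) *\<^sub>R cut v w = (l w * (l v * g v) / a) *\<^sub>R w + (l v * (l w * - g w) / a) *\<^sub>R v"
        if "v \<in> P" "w \<in> N" for v w
        unfolding cut_def prod.case scaleR_add_right scaleR_scaleR
        using pos[OF that] by (intro arg_cong2[where f = "(+)"] arg_cong2[where f = scaleR] HOL.refl) simp_all
      \<comment> \<open>The combination is indexed by a disjoint sum, not by points, since crossing
        points may coincide with each other or with points of \<open>P\<close>: for
        \<open>g v = 0\<close> the point \<open>cut v w\<close> is \<open>v\<close> itself.\<close>
      let ?y = "case_sum id (\<lambda>(v, w). cut v w)" and ?q = "case_sum (\<lambda>v. l v * (1 - b / a)) ?p"
      have "(\<Sum>z\<in>P \<times> N. ?p z *\<^sub>R (\<lambda>(v, w). cut v w) z) =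
          (\<Sum>v\<in>P. \<Sum>w\<in>N. (l w * (l v * g v) / a) *\<^sub>R w + (l v * (l w * - g w) / a) *\<^sub>R v)"
        unfolding sum.cartesian_product by (rule sum.cong[OF HOL.refl]) (use pcut in auto)
      also have "\<dots> = (\<Sum>w\<in>N. l w *\<^sub>R w) + (\<Sum>v\<in>P. (l v * b / a) *\<^sub>R v)"
        using a unfolding a_def b_def by (intro sum_product_weights HOL.refl) simp
      finally have "(\<Sum>z\<in>P <+> P \<times> N. ?q z *\<^sub>R ?y z) = x"
        unfolding x using fin
        by (simp add: sum.Plus sum.distrib[symmetric] algebra_simps)
      moreover have "sum ?q (P <+> P \<times> N) = 1"
      proof -
        have "sum ?p (P \<times> N) =
            (\<Sum>v\<in>P. \<Sum>w\<in>N. (l w * (l v * g v) / a) *\<^sub>R 1 + (l v * (l w * - g w) / a) *\<^sub>R 1)"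
          unfolding sum.cartesian_product
          by (rule sum.cong[OF HOL.refl]) (use a in \<open>auto simp: field_simps\<close>)
        also have "\<dots> = (\<Sum>w\<in>N. l w *\<^sub>R 1) + (\<Sum>v\<in>P. (l v * b / a) *\<^sub>R 1)"
          using a unfolding a_def b_def by (intro sum_product_weights HOL.refl) simp
        finally have "sum ?q (P <+> P \<times> N) = (\<Sum>v\<in>P. l v * (1 - b / a) + l v * b / a) + sum l N"
          using fin by (simp add: sum.Plus sum.distrib)
        also have "\<dots> = sum l P + sum l N" by (simp add: algebra_simps)
        finally show ?thesis using one by simp
      qed
      moreover have "0 \<le> ?q z" if "z \<in> P <+> P \<times> N" for z
      proof (cases z)
        case (Inl v)
        then show ?thesis using that l(1) sub ab a by (auto intro!: mult_nonneg_nonneg)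
      next
        case (Inr z')
        then show ?thesis using that l(1) sub pos a
          by (auto intro!: mult_nonneg_nonneg divide_nonneg_pos) (metis diff_gt_0_iff_gt less_imp_le)
      qed
      moreover have "?y z \<in> convex hull W" if "z \<in> P <+> P \<times> N" for z
        using that hull_subset[of W convex] by (auto simp: W_def)
      ultimately show ?thesis
        using convex_sum[of "P <+> P \<times> N" "convex hull W" ?q ?y] fin by simp
    qed
  qed
  ultimately have "convex hull V \<inter> {x. c \<le> f x} = convex hull W" by blast
  then show ?thesis using finW by blast
qed

section \<open>Caratheodory's theorem and splitting polytopes into simplices\<close>

lemma convex_hull_affine_dependent:
  fixes V :: "'v::real_vector set"
  assumes V: "finite V" "affine_dependent V" and x: "x \<in> convex hull V"
  shows "\<exists>v\<in>V. x \<in> convex hull (V - {v})"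
proof -
  obtain l where l: "\<And>v. v \<in> V \<Longrightarrow> 0 \<le> l v" "sum l V = 1" "x = (\<Sum>v\<in>V. l v *\<^sub>R v)"
    using x convex_hull_finite[OF V(1)] by auto
  obtain U where U: "sum U V = 0" "\<exists>v\<in>V. U v \<noteq> 0" "(\<Sum>v\<in>V. U v *\<^sub>R v) = 0"
    using affine_dependent_explicit_finite[OF V(1)] V(2) by auto
  define P where "P = {v \<in> V. U v > 0}"
  have "P \<noteq> {}"
  proof
    assume "P = {}"
    then have "\<And>v. v \<in> V \<Longrightarrow> 0 \<le> - U v" by (force simp: P_def)
    then have "\<forall>v\<in>V. - U v = 0"
      using sum_nonneg_eq_0_iff[OF V(1), of "\<lambda>v. - U v"] U(1) by (simp add: sum_negf)
    then show False using U(2) by simp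
  qed
  moreover have "finite P" using V(1) by (simp add: P_def)
  ultimately obtain w where w: "w \<in> P" "\<And>v. v \<in> P \<Longrightarrow> l w / U w \<le> l v / U v"
    by (meson arg_min_if_finite(1) arg_min_least)
  \<comment> \<open>The largest multiple of the dependence that can be subtracted with all
    coefficients staying nonnegative; the coefficient at the minimiser \<open>w\<close> then
    vanishes.\<close>
  define r where "r = l w / U w"
  define m where "m v = l v - r * U v" for v
  have "0 \<le> r" using w(1) l(1) by (simp add: P_def r_def)
  have "0 \<le> m v" if "v \<in> V" for v
  proof (cases "U v > 0")
    case True
    then have "r * U v \<le> l v / U v * U v"
      unfolding r_def using w(2)[of v] that by (intro mult_right_mono) (auto simp: P_def)
    with True show ?thesis by (simp add: m_def)
  next
    case False
    then have "r * U v \<le> 0" using \<open>0 \<le> r\<close> by (intro mult_nonneg_nonpos) auto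
    with l(1)[OF that] show ?thesis by (simp add: m_def)
  qed
  moreover have wV: "w \<in> V" and mw: "m w = 0" using w(1) by (auto simp: P_def m_def r_def)
  moreover have "sum m (V - {w}) = 1"
  proof -
    have "sum m V = 1" unfolding m_def
      by (simp add: sum_subtractf l(2) U(1) sum_distrib_left[symmetric])
    then show ?thesis using sum.remove[OF V(1) wV, of m] mw by simp
  qed
  moreover have "(\<Sum>v\<in>V - {w}. m v *\<^sub>R v) = x"
  proof -
    have "(\<Sum>v\<in>V. m v *\<^sub>R v) = x - r *\<^sub>R (\<Sum>v\<in>V. U v *\<^sub>R v)"
      by (simp add: m_def l(3) scaleR_left_diff_distrib sum_subtractf scaleR_sum_right)
    then show ?thesis using sum.remove[OF V(1) wV, of "\<lambda>v. m v *\<^sub>R v"] mw U(3) by simp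
  qed
  ultimately have "x \<in> convex hull (V - {w})"
    unfolding convex_hull_finite[OF finite_Diff[OF V(1)]] by auto
  with wV show ?thesis by blast
qed

lemma caratheodory_affine_independent:
  fixes V :: "'v::real_vector set"
  assumes "finite V" "x \<in> convex hull V"
  shows "\<exists>S\<subseteq>V. \<not> affine_dependent S \<and> x \<in> convex hull S"
  using assms
proof (induction V rule: finite_psubset_induct)
  case (psubset V)
  show ?case
  proof (cases "affine_dependent V")
    case True
    then obtain v where v: "v \<in> V" "x \<in> convex hull (V - {v})"
      using convex_hull_affine_dependent psubset.hyps psubset.prems by blast
    have "V - {v} \<subset> V" using v(1) by auto
    from psubset.IH[OF this v(2)] show ?thesis by blast
  qed (use psubset.prems in blast)
qed

text \<open>By Caratheodory the hull is the union of the hulls of the affinely independent subsets.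
  These simplices may overlap, which \<open>fin_polyhedron\<close> permits.\<close>

lemma fin_polyhedron_convex_hull:
  assumes V: "finite V" "V \<subseteq> Z \<rightarrow>\<^sub>E UNIV"
  shows "fin_polyhedron Z (convex hull V)"
  unfolding fin_polyhedron_def
proof (intro exI conjI ballI)
  let ?S = "(hull) convex ` {S. S \<subseteq> V \<and> \<not> affine_dependent S}"
  show "finite ?S" using V(1) by simp
  fix C assume "C \<in> ?S"
  then obtain S where S: "C = convex hull S" "S \<subseteq> V" "\<not> affine_dependent S" by auto
  then show "fin_simplex Z C"
    unfolding fin_simplex_def using V finite_subset[OF S(2)] by (intro exI[of _ S]) simp
next
  show "convex hull V = \<Union>((hull) convex ` {S. S \<subseteq> V \<and> \<not> affine_dependent S})"
  proof (intro equalityI subsetI)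
    fix x assume "x \<in> convex hull V"
    then obtain S where "S \<subseteq> V" "\<not> affine_dependent S" "x \<in> convex hull S"
      using caratheodory_affine_independent[OF V(1)] by metis
    then show "x \<in> \<Union>((hull) convex ` {S. S \<subseteq> V \<and> \<not> affine_dependent S})" by auto
  next
    fix x assume "x \<in> \<Union>((hull) convex ` {S. S \<subseteq> V \<and> \<not> affine_dependent S})"
    then obtain S where "S \<subseteq> V" "x \<in> convex hull S" by auto
    then show "x \<in> convex hull V" using hull_mono[of S V convex] by auto
  qed
qed

lemma fin_polyhedron_Union:
  assumes "finite \<P>" "\<And>P. P \<in> \<P> \<Longrightarrow> fin_polyhedron Z P"
  shows "fin_polyhedron Z (\<Union>\<P>)"
proof -
  have "\<forall>P\<in>\<P>. \<exists>\<S>. finite \<S> \<and> (\<forall>S\<in>\<S>. fin_simplex Z S) \<and> P = \<Union>\<S>"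
    using assms(2) unfolding fin_polyhedron_def by blast
  from bchoice[OF this] obtain s where s:
    "\<forall>P\<in>\<P>. finite (s P) \<and> (\<forall>S\<in>s P. fin_simplex Z S) \<and> P = \<Union>(s P)" ..
  have "\<Union>\<P> = (\<Union>P\<in>\<P>. \<Union>(s P))" using s by simp
  also have "\<dots> = \<Union>(\<Union>(s ` \<P>))" by blast
  finally have "\<Union>\<P> = \<Union>(\<Union>(s ` \<P>))" .
  then show ?thesis
    unfolding fin_polyhedron_def using assms(1) s by (intro exI[of _ "\<Union>(s ` \<P>)"]) auto
qed

section \<open>Subdividing polytopes\<close>

definition subdivision :: "('v::real_vector set \<Rightarrow> bool) \<Rightarrow> 'v set \<Rightarrow> 'v set set \<Rightarrow> bool" where
  "subdivision Q V \<W> \<longleftrightarrow> finite \<W> \<and> (\<forall>W\<in>\<W>. finite W \<and> Q (convex hull W)) \<and>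
    convex hull V = (\<Union>W\<in>\<W>. convex hull W)"

text \<open>The pieces must cover but may overlap, so no faces have to match. The quantifier over
  all finite \<open>V\<close> lets pieces be subdivided again.\<close>

definition piecewise :: "('v::real_vector set \<Rightarrow> bool) \<Rightarrow> bool" where
  "piecewise Q \<longleftrightarrow> (\<forall>V. finite V \<longrightarrow> (\<exists>\<W>. subdivision Q V \<W>))"

lemma piecewise_refine:
  assumes Q: "piecewise Q"
    and ref: "\<And>V. finite V \<Longrightarrow> Q (convex hull V) \<Longrightarrow> \<exists>\<W>. subdivision R V \<W>"
  shows "piecewise R"
  unfolding piecewise_def
proof (intro allI impI)
  fix V :: "'a set" assume "finite V"
  then obtain \<W> where W: "subdivision Q V \<W>" using Q by (auto simp: piecewise_def)
  then have "\<forall>W\<in>\<W>. \<exists>\<U>. subdivision R W \<U>" using ref by (auto simp: subdivision_def)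
  then obtain u where u: "\<And>W. W \<in> \<W> \<Longrightarrow> subdivision R W (u W)" by metis
  have "convex hull V = (\<Union>W\<in>\<W>. \<Union>U\<in>u W. convex hull U)"
    using W u by (auto simp: subdivision_def)
  moreover have "finite (\<Union>(u ` \<W>))" using W u by (simp add: subdivision_def)
  moreover have "finite U \<and> R (convex hull U)" if "U \<in> \<Union>(u ` \<W>)" for U
    using that u unfolding subdivision_def by blast
  ultimately have "subdivision R V (\<Union>(u ` \<W>))"
    unfolding subdivision_def by simp
  then show "\<exists>\<W>. subdivision R V \<W>" ..
qed

lemma subdivision_self: "finite V \<Longrightarrow> Q (convex hull V) \<Longrightarrow> subdivision Q V {V}"
  by (simp add: subdivision_def)

lemma piecewise_trivial:
  assumes "\<And>C. Q C"
  shows "piecewise Q"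
  unfolding piecewise_def using subdivision_self[of _ Q, OF _ assms] by blast

lemma piecewise_mono:
  assumes "piecewise Q" "\<And>C. Q C \<Longrightarrow> R C"
  shows "piecewise R"
  using assms(1)
proof (rule piecewise_refine)
  fix V :: "'a set" assume "finite V" "Q (convex hull V)"
  then have "subdivision R V {V}" using assms(2) by (intro subdivision_self)
  then show "\<exists>\<W>. subdivision R V \<W>" ..
qed

text \<open>The pieces made for \<open>Q\<close> are cut further for \<open>R\<close>, and they keep
  \<open>Q\<close> because it passes to subsets.\<close>

lemma piecewise_conj:
  assumes Q: "piecewise Q" and R: "piecewise R" and mono: "\<And>C D. C \<subseteq> D \<Longrightarrow> Q D \<Longrightarrow> Q C"
  shows "piecewise (\<lambda>C. Q C \<and> R C)"
proof (rule piecewise_refine[OF Q])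
  fix V :: "'a set" assume V: "finite V" "Q (convex hull V)"
  then obtain \<W> where W: "subdivision R V \<W>" using R by (auto simp: piecewise_def)
  then have "Q (convex hull W)" if "W \<in> \<W>" for W
    using mono[OF _ V(2)] that by (auto simp: subdivision_def)
  with W have "subdivision (\<lambda>C. Q C \<and> R C) V \<W>" by (auto simp: subdivision_def)
  then show "\<exists>\<W>. subdivision (\<lambda>C. Q C \<and> R C) V \<W>" ..
qed

lemma piecewise_ball:
  assumes "finite Z" and Q: "\<And>z. z \<in> Z \<Longrightarrow> piecewise (Q z)"
    and mono: "\<And>z C D. C \<subseteq> D \<Longrightarrow> Q z D \<Longrightarrow> Q z C"
  shows "piecewise (\<lambda>C. \<forall>z\<in>Z. Q z C)"
  using assms(1) Q
proof (induction Z)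
  case empty
  show ?case by (rule piecewise_trivial) simp
next
  case (insert z Z)
  have "piecewise (\<lambda>C. Q z C \<and> (\<forall>z\<in>Z. Q z C))"
    by (rule piecewise_conj) (use insert mono in blast)+
  then show ?case by simp
qed

section \<open>Term functions are piecewise affine\<close>

definition affine_fun_on :: "('v::real_vector \<Rightarrow> real) \<Rightarrow> 'v set \<Rightarrow> bool" where
  "affine_fun_on f C \<longleftrightarrow> (\<exists>L c. linear L \<and> (\<forall>x\<in>C. f x = L x + c))"

lemma affine_fun_onI: "linear L \<Longrightarrow> (\<And>x. x \<in> C \<Longrightarrow> f x = L x + c) \<Longrightarrow> affine_fun_on f C"
  by (auto simp: affine_fun_on_def)

lemma affine_fun_on_subset: "C \<subseteq> D \<Longrightarrow> affine_fun_on f D \<Longrightarrow> affine_fun_on f C"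
  by (auto simp: affine_fun_on_def)

lemma affine_fun_on_add:
  assumes "affine_fun_on f C" "affine_fun_on g C"
  shows "affine_fun_on (\<lambda>x. f x + g x) C"
proof -
  obtain L M c d where "linear L" "linear M" "\<forall>x\<in>C. f x = L x + c" "\<forall>x\<in>C. g x = M x + d"
    using assms by (auto simp: affine_fun_on_def)
  then show ?thesis
    by (intro affine_fun_onI[of "\<lambda>x. L x + M x" _ _ "c + d"] linear_compose_add) auto
qed

lemma affine_fun_on_diff_left:
  assumes "affine_fun_on f C"
  shows "affine_fun_on (\<lambda>x. k - f x) C"
proof -
  obtain L c where "linear L" "\<forall>x\<in>C. f x = L x + c" using assms by (auto simp: affine_fun_on_def)
  then show ?thesis
    by (intro affine_fun_onI[of "\<lambda>x. - L x" _ _ "k - c"] linear_compose_neg) auto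
qed

lemma affine_fun_on_const: "(\<And>x. x \<in> C \<Longrightarrow> f x = k) \<Longrightarrow> affine_fun_on f C"
  by (rule affine_fun_onI[of "\<lambda>x. 0" _ _ k]) (auto simp: linear_iff)

text \<open>A cut along the hyperplane where the affine function equals \<open>k\<close> leaves the
  constant \<open>k\<close> on one side and the function itself on the other.\<close>

lemma piecewise_min:
  assumes "piecewise (affine_fun_on f)"
  shows "piecewise (affine_fun_on (\<lambda>x. min (f x) k))"
proof (rule piecewise_refine[OF assms])
  fix V :: "'a set" assume V: "finite V" and f: "affine_fun_on f (convex hull V)"
  then obtain L c where L: "linear L" "\<And>x. x \<in> convex hull V \<Longrightarrow> f x = L x + c"
    by (auto simp: affine_fun_on_def)
  obtain W where W: "finite W" "convex hull V \<inter> {x. k - c \<le> L x} = convex hull W"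
    using convex_hull_finite_halfspace[OF V L(1)] by blast
  obtain U where U: "finite U" "convex hull V \<inter> {x. c - k \<le> - L x} = convex hull U"
    using convex_hull_finite_halfspace[OF V linear_compose_neg[OF L(1)]] by blast
  have "affine_fun_on (\<lambda>x. min (f x) k) (convex hull W)"
    using L(2) by (intro affine_fun_on_const[of _ _ k]) (auto simp flip: W(2))
  moreover have "affine_fun_on (\<lambda>x. min (f x) k) (convex hull U)"
    using L by (intro affine_fun_onI[of L _ _ c]) (auto simp flip: U(2))
  moreover have "convex hull V = convex hull U \<union> convex hull W"
    unfolding W(2)[symmetric] U(2)[symmetric] by auto
  ultimately have "subdivision (affine_fun_on (\<lambda>x. min (f x) k)) V {U, W}"
    using U(1) W(1) by (simp add: subdivision_def)
  then show "\<exists>\<W>. subdivision (affine_fun_on (\<lambda>x. min (f x) k)) V \<W>" ..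
qed

text \<open>The operations of \<open>std_mv\<close> are given by formulas valid for all reals, so
  the vectors need not lie in the cube. Only the truncation at 1 creates new pieces.\<close>

lemma piecewise_affine_eval: "piecewise (affine_fun_on (\<lambda>p. mv_eval std_mv p t))"
proof (induction t)
  case (MVar i)
  have "linear (\<lambda>p :: 'a \<Rightarrow> real. p i)" by (simp add: linear_iff)
  then have "affine_fun_on (\<lambda>p. mv_eval std_mv p (MVar i)) C" for C
    by (rule affine_fun_onI[where c = 0]) simp
  then show ?case by (rule piecewise_trivial)
next
  case MZero
  have "affine_fun_on (\<lambda>p. mv_eval std_mv p MZero) C" for C
    by (rule affine_fun_on_const) simp
  then show ?case by (rule piecewise_trivial)
next
  case (MNeg t)
  from affine_fun_on_diff_left[where k = 1] show ?case
    by (intro piecewise_mono[OF MNeg]) simp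
next
  case (MPlus s t)
  have "piecewise (\<lambda>C. affine_fun_on (\<lambda>p. mv_eval std_mv p s) C \<and>
      affine_fun_on (\<lambda>p. mv_eval std_mv p t) C)"
    by (rule piecewise_conj[OF MPlus affine_fun_on_subset])
  then have "piecewise (affine_fun_on (\<lambda>p. mv_eval std_mv p s + mv_eval std_mv p t))"
    by (rule piecewise_mono) (simp add: affine_fun_on_add)
  from piecewise_min[OF this, of 1] show ?case by simp
qed

lemma image_convex_hull_affine:
  fixes f :: "'j \<Rightarrow> 'v::real_vector \<Rightarrow> real"
  assumes aff: "\<And>z. z \<in> Z \<Longrightarrow> affine_fun_on (f z) (convex hull W)"
  shows "(\<lambda>p. \<lambda>z\<in>Z. f z p) ` (convex hull W) = convex hull ((\<lambda>p. \<lambda>z\<in>Z. f z p) ` W)"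
proof -
  obtain L c where L: "\<And>z. z \<in> Z \<Longrightarrow> linear (L z) \<and> (\<forall>x\<in>convex hull W. f z x = L z x + c z)"
    using aff unfolding affine_fun_on_def by metis
  define M where "M p = (\<lambda>z. if z \<in> Z then L z p else 0)" for p
  \<comment> \<open>The translation carries the value \<open>undefined\<close> of extensional
    functions outside \<open>Z\<close>, so that \<open>M\<close> can be linear.\<close>
  define d where "d = (\<lambda>z. if z \<in> Z then c z else undefined)"
  have "linear M" using L by (intro linearI) (auto simp: M_def fun_eq_iff linear_add linear_cmul)
  have eq: "(\<lambda>z\<in>Z. f z p) = d + M p" if "p \<in> convex hull W" for p
    using that L by (auto simp: fun_eq_iff M_def d_def)
  have "(\<lambda>p. \<lambda>z\<in>Z. f z p) ` (convex hull W) = (+) d ` M ` (convex hull W)"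
    unfolding image_image using eq by (intro image_cong) auto
  also have "\<dots> = convex hull ((+) d ` M ` W)"
    by (simp add: convex_hull_linear_image[OF \<open>linear M\<close>] convex_hull_translation)
  also have "(+) d ` M ` W = (\<lambda>p. \<lambda>z\<in>Z. f z p) ` W"
    unfolding image_image using eq hull_subset[of W convex] by (intro image_cong) auto
  finally show ?thesis .
qed

theorem fin_polyhedron_definable_image:
  assumes P: "fin_polyhedron J P" and Z: "finite Z"
  shows "fin_polyhedron Z ((\<lambda>p. \<lambda>z\<in>Z. mv_eval std_mv p (t z)) ` P)"
proof -
  let ?F = "\<lambda>p. \<lambda>z\<in>Z. mv_eval std_mv p (t z)"
  obtain \<S> where S: "finite \<S>" "\<forall>S\<in>\<S>. fin_simplex J S" "P = \<Union>\<S>"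
    using P by (auto simp: fin_polyhedron_def)
  have pw: "piecewise (\<lambda>C. \<forall>z\<in>Z. affine_fun_on (\<lambda>p. mv_eval std_mv p (t z)) C)"
    using Z by (intro piecewise_ball piecewise_affine_eval) (auto intro: affine_fun_on_subset)
  have "fin_polyhedron Z (?F ` S)" if "S \<in> \<S>" for S
  proof -
    have "fin_simplex J S" using S(2) that by blast
    then obtain V where V: "finite V" "S = convex hull V" by (auto simp: fin_simplex_def)
    obtain \<W> where
      "subdivision (\<lambda>C. \<forall>z\<in>Z. affine_fun_on (\<lambda>p. mv_eval std_mv p (t z)) C) V \<W>"
      using pw V(1) by (auto simp: piecewise_def)
    then have W: "finite \<W>" "\<And>W. W \<in> \<W> \<Longrightarrow> finite W"
      "\<And>W z. W \<in> \<W> \<Longrightarrow> z \<in> Z \<Longrightarrow> affine_fun_on (\<lambda>p. mv_eval std_mv p (t z)) (convex hull W)"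
      "convex hull V = (\<Union>W\<in>\<W>. convex hull W)"
      by (simp_all add: subdivision_def)
    have "?F ` S = (\<Union>W\<in>\<W>. convex hull (?F ` W))"
      unfolding V(2) W(4) image_UN by (rule SUP_cong[OF HOL.refl image_convex_hull_affine[OF W(3)]])
    moreover have "fin_polyhedron Z (convex hull (?F ` W))" if "W \<in> \<W>" for W
      using W(2)[OF that] by (intro fin_polyhedron_convex_hull) auto
    ultimately show ?thesis using W(1) by (auto intro!: fin_polyhedron_Union)
  qed
  then have "fin_polyhedron Z (\<Union>S\<in>\<S>. ?F ` S)" using S(1) by (auto intro!: fin_polyhedron_Union)
  then show ?thesis by (simp add: S(3) image_UN image_Union)
qed

section \<open>Polyhedral algebras\<close>

lemma mv_hom_eval:
  assumes A: "mv_algebra A" and h: "h \<in> mv_hom A B" and p: "p \<in> I \<rightarrow> carrier A" and t: "t \<in> mv_terms I"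
  shows "h (mv_eval A p t) = mv_eval B (\<lambda>i. h (p i)) t"
  using t
proof (induction t)
  case (MNeg t)
  then show ?case using mv_homD(4)[OF h mv_eval_closed[OF A p]] by simp
next
  case (MPlus s t)
  then show ?case using mv_homD(2)[OF h mv_eval_closed[OF A p] mv_eval_closed[OF A p]] by simp
qed (use mv_homD(3)[OF h] in auto)

section \<open>Generated subalgebras as sets of values of terms\<close>

definition mv_gen :: "('a, 'm) mv_struct_scheme \<Rightarrow> 'a set \<Rightarrow> 'a set" where
  "mv_gen A Z = (\<lambda>t. mv_eval A (\<lambda>z. z) t) ` mv_terms Z"

lemma mv_gen_subalgebra:
  assumes A: "mv_algebra A" and Z: "Z \<subseteq> carrier A"
  shows "mv_subalgebra (mv_gen A Z) A"
  unfolding mv_subalgebra_def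
proof (intro conjI ballI)
  have "(\<lambda>z. z) \<in> Z \<rightarrow> carrier A" using Z by auto
  then show "mv_gen A Z \<subseteq> carrier A" using mv_eval_closed[OF A] by (auto simp: mv_gen_def)
  show "\<zero>\<^bsub>A\<^esub> \<in> mv_gen A Z" unfolding mv_gen_def by (rule image_eqI[of _ _ MZero]) auto
  fix x assume "x \<in> mv_gen A Z"
  then obtain s where s: "s \<in> mv_terms Z" "x = mv_eval A (\<lambda>z. z) s" by (auto simp: mv_gen_def)
  show "\<sim>\<^bsub>A\<^esub> x \<in> mv_gen A Z" unfolding mv_gen_def by (rule image_eqI[of _ _ "MNeg s"]) (auto simp: s)
  fix y assume "y \<in> mv_gen A Z"
  then obtain t where t: "t \<in> mv_terms Z" "y = mv_eval A (\<lambda>z. z) t" by (auto simp: mv_gen_def)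
  show "x \<oplus>\<^bsub>A\<^esub> y \<in> mv_gen A Z" unfolding mv_gen_def
    by (rule image_eqI[of _ _ "MPlus s t"]) (auto simp: s t)
qed

lemma mv_gen_superset: "Z \<subseteq> mv_gen A Z"
  unfolding mv_gen_def by (auto intro!: image_eqI[of _ _ "MVar _"])

lemma mv_gen_minimal:
  assumes S: "mv_subalgebra S A" and Z: "Z \<subseteq> S"
  shows "mv_gen A Z \<subseteq> S"
proof -
  have "mv_eval A (\<lambda>z. z) t \<in> S" if "t \<in> mv_terms Z" for t
    using that by (induction t) (use S Z in \<open>auto simp: mv_subalgebra_def\<close>)
  then show ?thesis by (auto simp: mv_gen_def)
qed

lemma mv_gen_eq_hull:
  assumes "mv_algebra A" "Z \<subseteq> carrier A"
  shows "(\<lambda>S. mv_subalgebra S A) hull Z = mv_gen A Z"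
  by (rule hull_unique, rule mv_gen_superset, rule mv_gen_subalgebra[OF assms], rule mv_gen_minimal)

lemma mv_eval_carrier_update [simp]: "mv_eval (A\<lparr>carrier := S\<rparr>) p t = mv_eval A p t"
  by (induction t) auto

lemma mv_gen_carrier_update [simp]: "mv_gen (A\<lparr>carrier := S\<rparr>) Z = mv_gen A Z"
  by (simp add: mv_gen_def)

lemma mv_finitely_generated_iff:
  assumes A: "mv_algebra A" and S: "mv_subalgebra S A"
  shows "mv_finitely_generated (A\<lparr>carrier := S\<rparr>) \<longleftrightarrow> (\<exists>Z. finite Z \<and> Z \<subseteq> carrier A \<and> S = mv_gen A Z)"
proof -
  have SA: "S \<subseteq> carrier A" using S by (simp add: mv_subalgebra_def)
  have hull: "(\<lambda>T. mv_subalgebra T (A\<lparr>carrier := S\<rparr>)) hull Z = mv_gen A Z" if "Z \<subseteq> S" for Z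
    using mv_gen_eq_hull[OF mv_subalgebra_algebra[OF A S], of Z] that by simp
  show ?thesis
  proof
    assume "mv_finitely_generated (A\<lparr>carrier := S\<rparr>)"
    then obtain Z where "finite Z" "Z \<subseteq> S"
      "(\<lambda>T. mv_subalgebra T (A\<lparr>carrier := S\<rparr>)) hull Z = S"
      by (auto simp: mv_finitely_generated_def)
    then show "\<exists>Z. finite Z \<and> Z \<subseteq> carrier A \<and> S = mv_gen A Z"
      using hull[of Z] SA by (intro exI[of _ Z]) simp
  next
    assume "\<exists>Z. finite Z \<and> Z \<subseteq> carrier A \<and> S = mv_gen A Z"
    then obtain Z where Z: "finite Z" "mv_gen A Z = S" by auto
    moreover have "Z \<subseteq> S" using mv_gen_superset[of Z A] Z(2) by simp
    ultimately show "mv_finitely_generated (A\<lparr>carrier := S\<rparr>)"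
      using hull[of Z] unfolding mv_finitely_generated_def by (intro exI[of _ Z]) simp
  qed
qed

section \<open>The space of homs as a closed subset of the cube\<close>

lemma mv_hom_subalgebra:
  "h \<in> mv_hom A B \<Longrightarrow> S \<subseteq> carrier A \<Longrightarrow> h \<in> mv_hom (A\<lparr>carrier := S\<rparr>) B"
  by (auto simp: mv_hom_def subset_iff)

lemma mv_W_restrict: "mv_algebra A \<Longrightarrow> h \<in> mv_hom A std_mv \<Longrightarrow> restrict h (carrier A) \<in> mv_W A"
  unfolding mv_W_def using mv_hom_restrict by blast

lemma mv_W_D: "h \<in> mv_W A \<Longrightarrow> h \<in> mv_hom A std_mv"
  by (simp add: mv_W_def)

lemma mv_W_subset_cube: "mv_W A \<subseteq> carrier A \<rightarrow>\<^sub>E {0..1}"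
  using mv_homD(1)[of _ A std_mv] by (auto simp: mv_W_def PiE_def)

lemma mv_separatedD:
  assumes A: "mv_algebra A" and "mv_separated A" "x \<in> carrier A" "y \<in> carrier A"
    and eq: "\<And>h. h \<in> mv_W A \<Longrightarrow> h x = h y"
  shows "x = y"
proof -
  have "h x = h y" if "h \<in> mv_hom A std_mv" for h
    using eq[OF mv_W_restrict[OF A that]] assms(3,4) by simp
  then show ?thesis using assms(2-4) by (auto simp: mv_separated_def)
qed

text \<open>The equations of a hom are required only for arguments in \<open>F\<close>, and
  agreement with \<open>k\<close> on \<open>Z\<close>. Finite \<open>F\<close> gives closed sets for
  a compactness argument; \<open>F = carrier A\<close> with \<open>Z = {}\<close> gives
  \<open>mv_W A\<close>.\<close>

definition partial_homs ::
    "('a, 'm) mv_struct_scheme \<Rightarrow> 'a set \<Rightarrow> 'a set \<Rightarrow> ('a \<Rightarrow> real) \<Rightarrow> ('a \<Rightarrow> real) set" where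
  "partial_homs A F Z k = {p \<in> carrier A \<rightarrow>\<^sub>E {0..1}. (\<forall>z\<in>Z. p z = k z) \<and> p \<zero>\<^bsub>A\<^esub> = 0 \<and>
     (\<forall>x\<in>F. p (\<sim>\<^bsub>A\<^esub> x) = 1 - p x) \<and> (\<forall>x\<in>F. \<forall>y\<in>F. p (x \<oplus>\<^bsub>A\<^esub> y) = min (p x + p y) 1)}"

lemma closedin_partial_homs:
  assumes A: "mv_algebra A" and F: "F \<subseteq> carrier A" and Z: "Z \<subseteq> carrier A"
  shows "closedin (cube (carrier A)) (partial_homs A F Z k)"
proof -
  interpret mv_algebra A by fact
  let ?P = "cube (carrier A)"
  have top: "topspace ?P = carrier A \<rightarrow>\<^sub>E {0..1}" by simp
  note cont = continuous_map_cube_component[of _ "carrier A"]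
  have "closedin ?P {p \<in> topspace ?P. \<forall>z\<in>Z. p z = k z}"
    using Z by (intro closedin_equalizers cont) auto
  moreover have "closedin ?P {p \<in> topspace ?P. \<forall>z\<in>{\<zero>\<^bsub>A\<^esub>}. p z = 0}"
    by (intro closedin_equalizers cont) (auto simp: zero_closed)
  moreover have "closedin ?P {p \<in> topspace ?P. \<forall>x\<in>F. p (\<sim>\<^bsub>A\<^esub> x) = 1 - p x}"
    using F by (intro closedin_equalizers cont continuous_map_diff continuous_map_canonical_const)
      (auto intro: neg_closed)
  moreover have "closedin ?P {p \<in> topspace ?P. \<forall>e\<in>F \<times> F. p (fst e \<oplus>\<^bsub>A\<^esub> snd e) = min (p (fst e) + p (snd e)) 1}"
    using F by (intro closedin_equalizers cont continuous_map_real_min continuous_map_add continuous_map_canonical_const)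
      (auto intro!: plus_closed)
  ultimately have "closedin ?P ({p \<in> topspace ?P. \<forall>z\<in>Z. p z = k z} \<inter>
      ({p \<in> topspace ?P. \<forall>z\<in>{\<zero>\<^bsub>A\<^esub>}. p z = 0} \<inter>
      ({p \<in> topspace ?P. \<forall>x\<in>F. p (\<sim>\<^bsub>A\<^esub> x) = 1 - p x} \<inter>
       {p \<in> topspace ?P. \<forall>e\<in>F \<times> F. p (fst e \<oplus>\<^bsub>A\<^esub> snd e) = min (p (fst e) + p (snd e)) 1})))"
    by (intro closedin_Int)
  also have "\<dots> = partial_homs A F Z k"
    unfolding top partial_homs_def by auto
  finally show ?thesis .
qed

lemma mv_W_eq_partial_homs: "mv_W A = partial_homs A (carrier A) {} k"
  by (auto simp: mv_W_def mv_hom_def partial_homs_def PiE_def)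

lemma closedin_mv_W: "mv_algebra A \<Longrightarrow> closedin (cube (carrier A)) (mv_W A)"
  unfolding mv_W_eq_partial_homs[where k = "\<lambda>_. 0"] by (rule closedin_partial_homs) auto

text \<open>If \<open>restrict k Z\<close> lay outside the closed projection of
  \<open>mv_W A\<close>, some term would be 1 on that projection but not at \<open>k\<close>. By
  separation its value in \<open>A\<close> is the unit, and \<open>k\<close> sends the unit to 1, a
  contradiction.\<close>

lemma mv_hom_extend_separated:
  assumes A: "mv_algebra A" and sep: "mv_separated A" and S: "mv_subalgebra S A" and Z: "Z \<subseteq> S"
    and k: "k \<in> mv_hom (A\<lparr>carrier := S\<rparr>) std_mv"
  shows "\<exists>q\<in>mv_W A. \<forall>z\<in>Z. q z = k z"
proof -
  interpret mv_algebra A by fact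
  have SA: "S \<subseteq> carrier A" and one: "\<sim>\<^bsub>A\<^esub> \<zero>\<^bsub>A\<^esub> \<in> S" using S by (auto simp: mv_subalgebra_def)
  note algS = mv_subalgebra_algebra[OF A S]
  let ?X = "(\<lambda>x. restrict x Z) ` mv_W A"
  have ZA: "Z \<subseteq> carrier A" using Z SA by auto
  have "restrict k Z \<in> ?X"
  proof (rule mem_closed_of_terms)
    show "closedin (cube Z) ?X" by (rule closedin_cube_restrict[OF closedin_mv_W[OF A] ZA])
    show "restrict k Z \<in> Z \<rightarrow>\<^sub>E {0..1}" using mv_homD(1)[OF k] Z by auto
    fix t assume t: "t \<in> mv_terms Z" and all: "\<forall>q\<in>?X. mv_eval std_mv q t = 1"
    let ?a = "mv_eval A (\<lambda>z. z) t"
    have ZS: "(\<lambda>z. z) \<in> Z \<rightarrow> carrier (A\<lparr>carrier := S\<rparr>)" using Z by auto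
    have aS: "?a \<in> S" using mv_eval_closed[OF algS ZS t] by simp
    have "?a = \<sim>\<^bsub>A\<^esub> \<zero>\<^bsub>A\<^esub>"
    proof (rule mv_separatedD[OF A sep])
      fix h assume h: "h \<in> mv_W A"
      have "h ?a = mv_eval std_mv h t"
        using mv_hom_eval[OF A mv_W_D[OF h] _ t, where p = "\<lambda>z. z"] ZA by auto
      also have "\<dots> = mv_eval std_mv (restrict h Z) t" by (rule mv_eval_cong[OF t]) simp
      also have "\<dots> = 1" using all h by blast
      also have "1 = h (\<sim>\<^bsub>A\<^esub> \<zero>\<^bsub>A\<^esub>)"
        using mv_homD(3,4)[OF mv_W_D[OF h]] zero_closed by simp
      finally show "h ?a = h (\<sim>\<^bsub>A\<^esub> \<zero>\<^bsub>A\<^esub>)" .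
    qed (use aS SA one in auto)
    moreover have "k (\<sim>\<^bsub>A\<^esub> \<zero>\<^bsub>A\<^esub>) = 1"
      using mv_homD(3,4)[OF k] S by (simp add: mv_subalgebra_def)
    ultimately have "k ?a = 1" by simp
    then have "mv_eval std_mv k t = 1"
      using mv_hom_eval[OF algS k ZS t] by simp
    moreover have "mv_eval std_mv (restrict k Z) t = mv_eval std_mv k t"
      by (rule mv_eval_cong[OF t]) simp
    ultimately show "mv_eval std_mv (restrict k Z) t = 1" by simp
  qed
  then obtain q where "q \<in> mv_W A" "restrict k Z = restrict q Z" by auto
  then show ?thesis by (metis restrict_apply')
qed

text \<open>An element goes to the function defined by a term naming it. Terms naming the same
  element agree at every restricted hom, and by separation elements with the same function
  coincide.\<close>

theorem mv_gen_isomorphic_M: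
  assumes A: "mv_algebra A" and sep: "mv_separated A" and Z: "Z \<subseteq> carrier A"
  shows "mv_isomorphic (A\<lparr>carrier := mv_gen A Z\<rparr>) (mv_M Z ((\<lambda>x. restrict x Z) ` mv_W A))"
proof -
  let ?Y = "(\<lambda>x. restrict x Z) ` mv_W A" and ?G = "mv_gen A Z"
  have YZ: "?Y \<subseteq> Z \<rightarrow>\<^sub>E {0..1}" using mv_W_subset_cube[of A] Z by fastforce
  note MZ = mv_M_carrier[OF YZ]
  have sub: "mv_subalgebra ?G A" by (rule mv_gen_subalgebra[OF A Z])
  then have GA: "?G \<subseteq> carrier A" by (simp add: mv_subalgebra_def)
  define \<tau> where "\<tau> a = (SOME t. t \<in> mv_terms Z \<and> mv_eval A (\<lambda>z. z) t = a)" for a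
  have \<tau>: "\<tau> a \<in> mv_terms Z" "mv_eval A (\<lambda>z. z) (\<tau> a) = a" if "a \<in> ?G" for a
    using someI_ex[of "\<lambda>t. t \<in> mv_terms Z \<and> mv_eval A (\<lambda>z. z) t = a"] that
    by (auto simp: \<tau>_def mv_gen_def)
  define \<Phi> where "\<Phi> a = (\<lambda>y\<in>?Y. mv_eval std_mv y (\<tau> a))" for a
  have ev: "mv_eval std_mv (restrict h Z) t = h (mv_eval A (\<lambda>z. z) t)"
    if "h \<in> mv_W A" "t \<in> mv_terms Z" for h t
  proof -
    have "mv_eval std_mv (restrict h Z) t = mv_eval std_mv h t" by (rule mv_eval_cong[OF that(2)]) simp
    also have "\<dots> = h (mv_eval A (\<lambda>z. z) t)"
      by (rule mv_hom_eval[OF A mv_W_D[OF that(1)] _ that(2), where p = "\<lambda>z. z", symmetric]) (use Z in auto)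
    finally show ?thesis .
  qed
  have \<Phi>_eval: "\<Phi> (mv_eval A (\<lambda>z. z) t) = (\<lambda>y\<in>?Y. mv_eval std_mv y t)" if t: "t \<in> mv_terms Z" for t
  proof -
    have G: "mv_eval A (\<lambda>z. z) t \<in> ?G" using t by (auto simp: mv_gen_def)
    show ?thesis unfolding \<Phi>_def
      by (rule restrict_ext) (use ev t \<tau>[OF G] in auto)
  qed
  have \<Phi>_at: "\<Phi> a (restrict h Z) = h a" if "h \<in> mv_W A" "a \<in> ?G" for h a
    using that ev[OF that(1) \<tau>(1)[OF that(2)]] \<tau>(2)[OF that(2)] by (simp add: \<Phi>_def)
  have "\<Phi> ` ?G = carrier (mv_M Z ?Y)"
  proof -
    have "\<Phi> ` ?G = (\<lambda>t. \<lambda>y\<in>?Y. mv_eval std_mv y t) ` mv_terms Z"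
      unfolding mv_gen_def image_image by (rule image_cong) (auto simp: \<Phi>_eval)
    then show ?thesis unfolding MZ by auto
  qed
  moreover have "inj_on \<Phi> ?G"
  proof (rule inj_onI)
    fix a b assume ab: "a \<in> ?G" "b \<in> ?G" "\<Phi> a = \<Phi> b"
    show "a = b"
    proof (rule mv_separatedD[OF A sep])
      fix h assume "h \<in> mv_W A"
      then show "h a = h b" using \<Phi>_at ab by metis
    qed (use ab GA in auto)
  qed
  ultimately have bij: "bij_betw \<Phi> ?G (carrier (mv_M Z ?Y))" by (simp add: bij_betw_def)
  have "\<Phi> (a \<oplus>\<^bsub>A\<^esub> b) = \<Phi> a \<oplus>\<^bsub>mv_M Z ?Y\<^esub> \<Phi> b" if "a \<in> ?G" "b \<in> ?G" for a b
  proof -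
    have "\<Phi> (a \<oplus>\<^bsub>A\<^esub> b) = (\<lambda>y\<in>?Y. mv_eval std_mv y (MPlus (\<tau> a) (\<tau> b)))"
      using \<Phi>_eval[of "MPlus (\<tau> a) (\<tau> b)"] \<tau>[OF that(1)] \<tau>[OF that(2)] by simp
    then show ?thesis
      by (simp add: mv_M_def mv_product_def \<Phi>_def cong: restrict_cong)
  qed
  moreover have "\<Phi> (\<sim>\<^bsub>A\<^esub> a) = \<sim>\<^bsub>mv_M Z ?Y\<^esub> (\<Phi> a)" if "a \<in> ?G" for a
  proof -
    have "\<Phi> (\<sim>\<^bsub>A\<^esub> a) = (\<lambda>y\<in>?Y. mv_eval std_mv y (MNeg (\<tau> a)))"
      using \<Phi>_eval[of "MNeg (\<tau> a)"] \<tau>[OF that] by simp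
    then show ?thesis
      by (simp add: mv_M_def mv_product_def \<Phi>_def cong: restrict_cong)
  qed
  moreover have "\<Phi> \<zero>\<^bsub>A\<^esub> = \<zero>\<^bsub>mv_M Z ?Y\<^esub>"
    using \<Phi>_eval[of MZero] by (simp add: mv_M_def mv_product_def)
  ultimately have "\<Phi> \<in> mv_hom (A\<lparr>carrier := ?G\<rparr>) (mv_M Z ?Y)"
    using bij by (auto simp: mv_hom_def bij_betw_def)
  with bij show ?thesis by (auto simp: mv_isomorphic_def)
qed

text \<open>Finite \<open>Z\<close> gives the finitely generated subalgebras, and
  \<open>Z = carrier A\<close> gives \<open>A\<close> itself. Finite projections of the projection
  to \<open>Z\<close> are finite projections of \<open>mv_W A\<close>.\<close>

lemma mv_gen_polyhedral:
  assumes A: "mv_algebra A" and sep: "mv_separated A" and Z: "Z \<subseteq> carrier A"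
    and W: "cube_polyhedron (carrier A) (mv_W A)"
  shows "mv_polyhedral (A\<lparr>carrier := mv_gen A Z\<rparr>)"
proof -
  let ?Y = "(\<lambda>x. restrict x Z) ` mv_W A"
  have "cube_polyhedron Z ?Y"
    unfolding cube_polyhedron_def
  proof (intro conjI allI impI)
    show "closedin (cube Z) ?Y" by (rule closedin_cube_restrict[OF closedin_mv_W[OF A] Z])
    fix K assume K: "finite K \<and> K \<subseteq> Z"
    then have "(\<lambda>x. restrict x K) ` ?Y = (\<lambda>x. restrict x K) ` mv_W A"
      unfolding image_image by (intro image_cong) (auto simp: Int_absorb1)
    moreover have "fin_polyhedron K ((\<lambda>x. restrict x K) ` mv_W A)"
      using W K subset_trans[of K Z "carrier A"] Z by (simp add: cube_polyhedron_def)
    ultimately show "fin_polyhedron K ((\<lambda>x. restrict x K) ` ?Y)" by simp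
  qed
  then show ?thesis
    unfolding mv_polyhedral_def using mv_gen_isomorphic_M[OF A sep Z] by blast
qed

theorem mv_polyhedral_imp:
  fixes A :: "('a, 'm) mv_struct_scheme"
  assumes A: "mv_algebra A" and "mv_polyhedral A"
  shows "mv_separated A" "cube_polyhedron (carrier A) (mv_W A)"
proof -
  interpret mv_algebra A by fact
  obtain I :: "'a set" and X where X: "cube_polyhedron I X" and "mv_isomorphic A (mv_M I X)"
    using assms(2) by (auto simp: mv_polyhedral_def)
  then obtain h where h: "h \<in> mv_hom A (mv_M I X)" and bij: "bij_betw h (carrier A) (carrier (mv_M I X))"
    by (auto simp: mv_isomorphic_def)
  have clX: "closedin (cube I) X" using X by (simp add: cube_polyhedron_def)
  then have XI: "X \<subseteq> I \<rightarrow>\<^sub>E {0..1}" using closedin_subset by fastforce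
  note MI = mv_M_carrier[OF XI]
  define \<tau> where "\<tau> a = (SOME t. t \<in> mv_terms I \<and> h a = (\<lambda>p\<in>X. mv_eval std_mv p t))" for a
  have \<tau>: "\<tau> a \<in> mv_terms I" "h a = (\<lambda>p\<in>X. mv_eval std_mv p (\<tau> a))" if "a \<in> carrier A" for a
  proof -
    have "h a \<in> carrier (mv_M I X)" using mv_homD(1)[OF h that] .
    then have "\<exists>t. t \<in> mv_terms I \<and> h a = (\<lambda>p\<in>X. mv_eval std_mv p t)" unfolding MI by auto
    from someI_ex[OF this] show "\<tau> a \<in> mv_terms I" "h a = (\<lambda>p\<in>X. mv_eval std_mv p (\<tau> a))"
      by (simp_all add: \<tau>_def)
  qed
  define e where "e p = (\<lambda>a\<in>carrier A. h a p)" for p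
  have e_hom: "e p \<in> mv_W A" if p: "p \<in> X" for p
  proof -
    have "h a p \<in> {0..1}" if "a \<in> carrier A" for a
      using mv_eval_std_range[OF \<tau>(1)[OF that], of p] \<tau>(2)[OF that] p XI by auto
    then show ?thesis
      using p mv_homD(2-4)[OF h]
      by (auto simp: mv_W_def mv_hom_def e_def zero_closed neg_closed plus_closed mv_M_def mv_product_def)
  qed
  have h_ext: "h a \<in> extensional X" if "a \<in> carrier A" for a
    by (subst \<tau>(2)[OF that]) simp
  have h_eqI: "a = b" if ab: "a \<in> carrier A" "b \<in> carrier A" and eq: "\<And>p. p \<in> X \<Longrightarrow> h a p = h b p" for a b
  proof -
    have "h a = h b" by (rule extensionalityI[OF h_ext[OF ab(1)] h_ext[OF ab(2)] eq])
    then show ?thesis using bij ab by (auto simp: bij_betw_def dest: inj_onD)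
  qed
  show sep: "mv_separated A"
    unfolding mv_separated_def
  proof (intro ballI impI)
    fix a b assume ab: "a \<in> carrier A" "b \<in> carrier A" "\<forall>k\<in>mv_hom A std_mv. k a = k b"
    show "a = b"
    proof (rule h_eqI[OF ab(1,2)])
      fix p assume "p \<in> X"
      then have "e p a = e p b" using ab(3) mv_W_D e_hom by blast
      then show "h a p = h b p" using ab by (simp add: e_def)
    qed
  qed
  \<comment> \<open>\<open>g i\<close> is the element represented by the \<open>i\<close>-th
    coordinate function; every element of \<open>A\<close> is the value of a term at these.\<close>
  define g where "g i = inv_into (carrier A) h (\<lambda>p\<in>X. p i)" for i
  have g: "g i \<in> carrier A" "h (g i) = (\<lambda>p\<in>X. p i)" if "i \<in> I" for i
  proof -
    have "(\<lambda>p\<in>X. p i) \<in> carrier (mv_M I X)"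
      unfolding MI using that by (force intro!: exI[of _ "MVar i"])
    then have "(\<lambda>p\<in>X. p i) \<in> h ` carrier A" using bij by (simp add: bij_betw_def)
    then show "g i \<in> carrier A" "h (g i) = (\<lambda>p\<in>X. p i)"
      unfolding g_def by (auto intro: inv_into_into f_inv_into_f)
  qed
  have gI: "g \<in> I \<rightarrow> carrier A" using g by auto
  have h_eval: "h (mv_eval A g t) p = mv_eval std_mv p t" if t: "t \<in> mv_terms I" and p: "p \<in> X" for t p
  proof -
    have "h (mv_eval A g t) p = e p (mv_eval A g t)" using mv_eval_closed[OF A gI t] by (simp add: e_def)
    also have "\<dots> = mv_eval std_mv (\<lambda>i. e p (g i)) t"
      by (rule mv_hom_eval[OF A mv_W_D[OF e_hom[OF p]] gI t])
    also have "\<dots> = mv_eval std_mv p t"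
      by (rule mv_eval_cong[OF t]) (use g p in \<open>simp add: e_def\<close>)
    finally show ?thesis .
  qed
  have W: "mv_W A = e ` X"
  proof (intro equalityI subsetI)
    fix k assume kW: "k \<in> mv_W A"
    note k = mv_W_D[OF kW]
    \<comment> \<open>A hom is determined by its values on the \<open>g i\<close>, so this is the
      only point at which \<open>k\<close> can be evaluation.\<close>
    define \<pi> where "\<pi> = (\<lambda>i\<in>I. k (g i))"
    have k_eval: "k (mv_eval A g t) = mv_eval std_mv \<pi> t" if t: "t \<in> mv_terms I" for t
    proof -
      have "mv_eval std_mv (\<lambda>i. k (g i)) t = mv_eval std_mv \<pi> t"
        by (rule mv_eval_cong[OF t]) (simp add: \<pi>_def)
      then show ?thesis using mv_hom_eval[OF A k gI t] by simp
    qed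
    have "\<pi> \<in> X"
    proof (rule mem_closed_of_terms[OF clX])
      show "\<pi> \<in> I \<rightarrow>\<^sub>E {0..1}" using mv_homD(1)[OF k] g(1) by (auto simp: \<pi>_def)
      fix t assume t: "t \<in> mv_terms I" and all: "\<forall>q\<in>X. mv_eval std_mv q t = 1"
      have "mv_eval A g t = \<sim>\<^bsub>A\<^esub> \<zero>\<^bsub>A\<^esub>"
      proof (rule h_eqI)
        fix p assume p: "p \<in> X"
        have "h (\<sim>\<^bsub>A\<^esub> \<zero>\<^bsub>A\<^esub>) p = 1"
          using h_eval[OF _ p, of "MNeg MZero"] by simp
        then show "h (mv_eval A g t) p = h (\<sim>\<^bsub>A\<^esub> \<zero>\<^bsub>A\<^esub>) p" using h_eval[OF t p] all p by simp
      qed (use mv_eval_closed[OF A gI t] neg_closed zero_closed in auto)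
      then show "mv_eval std_mv \<pi> t = 1"
        using k_eval[OF t] mv_homD(3,4)[OF k] zero_closed by simp
    qed
    moreover have "k = e \<pi>"
    proof (rule extensionalityI[of _ "carrier A"])
      fix a assume a: "a \<in> carrier A"
      have "a = mv_eval A g (\<tau> a)"
        by (rule h_eqI) (use a h_eval \<tau>[OF a] mv_eval_closed[OF A gI] in auto)
      then have "k a = mv_eval std_mv \<pi> (\<tau> a)" using k_eval[OF \<tau>(1)[OF a]] by simp
      also have "\<dots> = h a \<pi>" using \<tau>(2)[OF a] \<open>\<pi> \<in> X\<close> by simp
      finally show "k a = e \<pi> a" using a by (simp add: e_def)
    qed (use kW in \<open>auto simp: mv_W_def e_def\<close>)
    ultimately show "k \<in> e ` X" by blast
  qed (use e_hom in auto)
  show "cube_polyhedron (carrier A) (mv_W A)"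
    unfolding cube_polyhedron_def
  proof (intro conjI allI impI)
    show "closedin (cube (carrier A)) (mv_W A)" by (rule closedin_mv_W[OF A])
    fix Z assume Z: "finite Z \<and> Z \<subseteq> carrier A"
    \<comment> \<open>Finitely many terms involve finitely many coordinates: the projection of
      \<open>mv_W A\<close> to \<open>Z\<close> is a definable image of the projection of
      \<open>X\<close> to \<open>J\<close>.\<close>
    define J where "J = (\<Union>z\<in>Z. set_mv_term (\<tau> z))"
    have "set_mv_term (\<tau> z) \<subseteq> I" if "z \<in> Z" for z using \<tau>(1)[of z] that Z by (auto simp: mv_terms_def)
    moreover have "finite (set_mv_term t)" for t :: "'a mv_term" by (induction t) auto
    ultimately have J: "finite J" "J \<subseteq> I" using Z by (auto simp: J_def)
    have \<tau>J: "\<tau> z \<in> mv_terms J" if "z \<in> Z" for z using that by (auto simp: J_def mv_terms_def)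
    have "(\<lambda>x. restrict x Z) ` mv_W A = (\<lambda>p. \<lambda>z\<in>Z. mv_eval std_mv p (\<tau> z)) ` (\<lambda>x. restrict x J) ` X"
      unfolding W image_image
    proof (intro image_cong HOL.refl)
      fix p assume p: "p \<in> X"
      have "e p z = mv_eval std_mv (restrict p J) (\<tau> z)" if z: "z \<in> Z" for z
      proof -
        have "mv_eval std_mv (restrict p J) (\<tau> z) = mv_eval std_mv p (\<tau> z)"
          by (rule mv_eval_cong[OF \<tau>J[OF z]]) simp
        moreover have "z \<in> carrier A" using z Z by auto
        ultimately show ?thesis using \<tau>(2)[of z] p by (simp add: e_def)
      qed
      then show "restrict (e p) Z = (\<lambda>z\<in>Z. mv_eval std_mv (restrict p J) (\<tau> z))"
        by (intro restrict_ext)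
    qed
    moreover have "fin_polyhedron J ((\<lambda>x. restrict x J) ` X)"
      using X J by (simp add: cube_polyhedron_def)
    ultimately show "fin_polyhedron Z ((\<lambda>x. restrict x Z) ` mv_W A)"
      using Z by (simp add: fin_polyhedron_definable_image)
  qed
qed

section \<open>From the finitely generated subalgebras to the whole algebra\<close>

lemma partial_homs_antimono: "F \<subseteq> G \<Longrightarrow> partial_homs A G Z k \<subseteq> partial_homs A F Z k"
  unfolding partial_homs_def by blast

text \<open>Compactness of the cube glues extensions to finitely generated subalgebras.\<close>

lemma mv_hom_extend_locally_separated:
  assumes A: "mv_algebra A"
    and sep: "\<And>F. finite F \<Longrightarrow> F \<subseteq> carrier A \<Longrightarrow> mv_separated (A\<lparr>carrier := mv_gen A F\<rparr>)"
    and Z: "finite Z" "Z \<subseteq> carrier A" and k: "k \<in> mv_hom (A\<lparr>carrier := mv_gen A Z\<rparr>) std_mv"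
  shows "\<exists>q\<in>mv_W A. \<forall>z\<in>Z. q z = k z"
proof -
  let ?P = "cube (carrier A)"
  let ?U = "(\<lambda>F. partial_homs A F Z k) ` {F. finite F \<and> F \<subseteq> carrier A}"
  have ne: "partial_homs A F Z k \<noteq> {}" if F: "finite F" "F \<subseteq> carrier A" for F
  proof -
    let ?S = "mv_gen A (Z \<union> F)"
    let ?B = "A\<lparr>carrier := ?S\<rparr>"
    have ZF: "finite (Z \<union> F)" "Z \<union> F \<subseteq> carrier A" using Z F by auto
    have subS: "mv_subalgebra ?S A" by (rule mv_gen_subalgebra[OF A ZF(2)])
    have B: "mv_algebra ?B" by (rule mv_subalgebra_algebra[OF A subS])
    have ZS: "Z \<subseteq> ?S" "F \<subseteq> ?S" using mv_gen_superset[of "Z \<union> F" A] by auto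
    have "mv_subalgebra (mv_gen A Z) ?B"
      using mv_gen_subalgebra[OF B, of Z] ZS by simp
    moreover have "Z \<subseteq> mv_gen A Z" by (rule mv_gen_superset)
    moreover have "k \<in> mv_hom (?B\<lparr>carrier := mv_gen A Z\<rparr>) std_mv" using k by simp
    ultimately obtain q where q: "q \<in> mv_W ?B" "\<forall>z\<in>Z. q z = k z"
      using mv_hom_extend_separated[OF B sep[OF ZF]] by blast
    \<comment> \<open>The default 0 outside \<open>?S\<close> is harmless: the equations are tested
      only on arguments in \<open>F\<close>, whose sums and negations stay in
      \<open>?S\<close>.\<close>
    define p where "p = (\<lambda>a\<in>carrier A. if a \<in> ?S then q a else 0)"
    note qh = mv_W_D[OF q(1)]
    have S: "?S \<subseteq> carrier A" "\<zero>\<^bsub>A\<^esub> \<in> ?S" "\<And>x y. x \<in> ?S \<Longrightarrow> y \<in> ?S \<Longrightarrow> x \<oplus>\<^bsub>A\<^esub> y \<in> ?S"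
      "\<And>x. x \<in> ?S \<Longrightarrow> \<sim>\<^bsub>A\<^esub> x \<in> ?S"
      using subS by (auto simp: mv_subalgebra_def)
    have pS: "p x = q x" if "x \<in> ?S" for x using that S(1) by (auto simp: p_def)
    have "p \<in> carrier A \<rightarrow>\<^sub>E {0..1}" using mv_homD(1)[OF qh] by (auto simp: p_def)
    moreover have "\<forall>z\<in>Z. p z = k z" using q(2) pS ZS(1) by auto
    moreover have "p \<zero>\<^bsub>A\<^esub> = 0" using pS[OF S(2)] mv_homD(3)[OF qh] by simp
    moreover have "p (\<sim>\<^bsub>A\<^esub> x) = 1 - p x" if "x \<in> F" for x
      using that ZS(2) mv_homD(4)[OF qh, of x] pS S(4) by auto
    moreover have "p (x \<oplus>\<^bsub>A\<^esub> y) = min (p x + p y) 1" if "x \<in> F" "y \<in> F" for x y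
    proof -
      have xy: "x \<in> ?S" "y \<in> ?S" using that ZS(2) by auto
      then show ?thesis using mv_homD(2)[OF qh, of x y] pS S(3)[OF xy] by simp
    qed
    ultimately have "p \<in> partial_homs A F Z k" by (simp add: partial_homs_def)
    then show ?thesis by blast
  qed
  have closed: "\<forall>C\<in>?U. closedin ?P C"
    using closedin_partial_homs[OF A _ Z(2)] by auto
  have fip: "\<forall>\<F>. finite \<F> \<and> \<F> \<subseteq> ?U \<longrightarrow> \<Inter>\<F> \<noteq> {}"
  proof (intro allI impI)
    fix \<F> assume "finite \<F> \<and> \<F> \<subseteq> ?U"
    then obtain G where G: "finite G" "G \<subseteq> {F. finite F \<and> F \<subseteq> carrier A}"
      "\<F> = (\<lambda>F. partial_homs A F Z k) ` G"
      using finite_subset_image[of \<F> "\<lambda>F. partial_homs A F Z k" "{F. finite F \<and> F \<subseteq> carrier A}"] by auto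
    \<comment> \<open>The family is directed: the set belonging to the union of finitely many index
      sets lies below all of theirs.\<close>
    have "partial_homs A (\<Union>G) Z k \<subseteq> \<Inter>\<F>"
      unfolding G(3) by (intro INT_greatest partial_homs_antimono) auto
    moreover have "partial_homs A (\<Union>G) Z k \<noteq> {}" by (rule ne) (use G in auto)
    ultimately show "\<Inter>\<F> \<noteq> {}" by blast
  qed
  have "\<Inter>?U \<noteq> {}"
    using compact_space_cube[of "carrier A"] closed fip unfolding compact_space_fip by blast
  then obtain p where p: "\<And>F. finite F \<Longrightarrow> F \<subseteq> carrier A \<Longrightarrow> p \<in> partial_homs A F Z k"
    by blast
  \<comment> \<open>Each equation involves at most two arguments, so the sets for \<open>{x}\<close>
    and \<open>{x, y}\<close> supply all of them.\<close>
  have "p \<in> mv_W A"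
    unfolding mv_W_eq_partial_homs[of A k] partial_homs_def
  proof (intro CollectI conjI ballI)
    show "p \<in> carrier A \<rightarrow>\<^sub>E {0..1}" "p \<zero>\<^bsub>A\<^esub> = 0" using p[of "{}"] by (auto simp: partial_homs_def)
    show "p (\<sim>\<^bsub>A\<^esub> x) = 1 - p x" if "x \<in> carrier A" for x
      using p[of "{x}"] that by (auto simp: partial_homs_def)
    show "p (x \<oplus>\<^bsub>A\<^esub> y) = min (p x + p y) 1" if "x \<in> carrier A" "y \<in> carrier A" for x y
      using p[of "{x, y}"] that by (auto simp: partial_homs_def)
  qed simp
  moreover have "\<forall>z\<in>Z. p z = k z" using p[of "{}"] by (simp add: partial_homs_def)
  ultimately show ?thesis by blast
qed

text \<open>Distinct \<open>a\<close> and \<open>b\<close> are separated by a hom of the subalgebra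
  they generate, and some hom of \<open>A\<close> has the same values on both. The same extension
  property identifies the finite projections of the two spaces of homs.\<close>

theorem mv_locally_polyhedral_imp:
  assumes A: "mv_algebra A"
    and local: "\<And>F. finite F \<Longrightarrow> F \<subseteq> carrier A \<Longrightarrow> mv_polyhedral (A\<lparr>carrier := mv_gen A F\<rparr>)"
  shows "mv_separated A" "cube_polyhedron (carrier A) (mv_W A)"
proof -
  have alg: "mv_algebra (A\<lparr>carrier := mv_gen A F\<rparr>)" if "F \<subseteq> carrier A" for F
    by (rule mv_subalgebra_algebra[OF A mv_gen_subalgebra[OF A that]])
  note loc = mv_polyhedral_imp[OF alg local]
  note extend = mv_hom_extend_locally_separated[OF A loc(1)]
  show "mv_separated A"
    unfolding mv_separated_def
  proof (intro ballI impI)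
    fix a b assume ab: "a \<in> carrier A" "b \<in> carrier A" "\<forall>h\<in>mv_hom A std_mv. h a = h b"
    have F: "finite {a, b}" "{a, b} \<subseteq> carrier A" using ab by auto
    show "a = b"
    proof (rule mv_separatedD[OF alg[OF F(2)] loc(1)[OF F(2) F]])
      fix k assume "k \<in> mv_W (A\<lparr>carrier := mv_gen A {a, b}\<rparr>)"
      then obtain q where "q \<in> mv_W A" "q a = k a" "q b = k b"
        using extend[OF _ _ _ F mv_W_D] by auto
      then show "k a = k b" using ab(3) mv_W_D by metis
    qed (use mv_gen_superset[of "{a, b}" A] in auto)
  qed
  show "cube_polyhedron (carrier A) (mv_W A)"
    unfolding cube_polyhedron_def
  proof (intro conjI allI impI)
    show "closedin (cube (carrier A)) (mv_W A)" by (rule closedin_mv_W[OF A])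
    fix Z assume "finite Z \<and> Z \<subseteq> carrier A"
    then have Z: "finite Z" "Z \<subseteq> carrier A" by auto
    let ?S = "mv_gen A Z"
    let ?B = "A\<lparr>carrier := ?S\<rparr>"
    have ZS: "Z \<subseteq> ?S" by (rule mv_gen_superset)
    have SA: "?S \<subseteq> carrier A" using mv_gen_subalgebra[OF A Z(2)] by (simp add: mv_subalgebra_def)
    \<comment> \<open>Restricting homs to \<open>?S\<close> gives one inclusion, extending them from
      \<open>?S\<close> the other.\<close>
    have "(\<lambda>x. restrict x Z) ` mv_W A = (\<lambda>x. restrict x Z) ` mv_W ?B"
    proof (intro equalityI image_subsetI)
      fix h assume "h \<in> mv_W A"
      then have "restrict h ?S \<in> mv_W ?B"
        using mv_W_restrict[OF alg[OF Z(2)] mv_hom_subalgebra[OF mv_W_D SA]] by simp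
      moreover have "restrict h Z = restrict (restrict h ?S) Z" using ZS by (simp add: Int_absorb1)
      ultimately show "restrict h Z \<in> (\<lambda>x. restrict x Z) ` mv_W ?B" by blast
    next
      fix k assume "k \<in> mv_W ?B"
      then obtain q where "q \<in> mv_W A" "\<forall>z\<in>Z. q z = k z" using extend[OF _ _ _ Z mv_W_D] by blast
      then show "restrict k Z \<in> (\<lambda>x. restrict x Z) ` mv_W A"
        by (intro image_eqI[of _ _ q] restrict_ext) auto
    qed
    moreover have "fin_polyhedron Z ((\<lambda>x. restrict x Z) ` mv_W ?B)"
      using loc(2)[OF Z(2) Z] Z(1) ZS by (simp add: cube_polyhedron_def)
    ultimately show "fin_polyhedron Z ((\<lambda>x. restrict x Z) ` mv_W A)" by simp
  qed
qed

text \<open>Condition (ii) is the hub: it is shown equivalent to (i) and to (iii), with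
  semisimplicity replaced by separation throughout.\<close>

theorem theorem4p12:
  fixes A :: "('a, 'm) mv_struct_scheme"
  assumes "mv_algebra A"
  shows "(mv_polyhedral A \<longleftrightarrow> mv_semisimple A \<and> cube_polyhedron (carrier A) (mv_W A)) \<and>
    (mv_polyhedral A \<longleftrightarrow>
      (\<forall>S. mv_subalgebra S A \<and> mv_finitely_generated (A\<lparr>carrier := S\<rparr>) \<longrightarrow>
        mv_polyhedral (A\<lparr>carrier := S\<rparr>)))"
    (is "(_ \<longleftrightarrow> ?W) \<and> (_ \<longleftrightarrow> ?L)")
proof -
  note A = assms
  note semisimple = mv_semisimple_iff_separated[OF A]
  have "mv_subalgebra (carrier A) A"
    using mv_algebra.plus_closed[OF A] mv_algebra.neg_closed[OF A] mv_algebra.zero_closed[OF A]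
    by (simp add: mv_subalgebra_def)
  then have gen: "mv_gen A (carrier A) = carrier A"
    using mv_gen_minimal[of "carrier A" A "carrier A"] mv_gen_superset[of "carrier A" A] by auto
  have W: "mv_polyhedral A \<longleftrightarrow> ?W"
    using mv_polyhedral_imp[OF A] mv_gen_polyhedral[OF A _ subset_refl] semisimple by (auto simp: gen)
  moreover have "?L" if "?W"
  proof (intro allI impI)
    fix S assume S: "mv_subalgebra S A \<and> mv_finitely_generated (A\<lparr>carrier := S\<rparr>)"
    then obtain Z where "Z \<subseteq> carrier A" "S = mv_gen A Z"
      using mv_finitely_generated_iff[OF A, of S] by auto
    then show "mv_polyhedral (A\<lparr>carrier := S\<rparr>)" using mv_gen_polyhedral[OF A] that semisimple by simp
  qed
  moreover have "?W" if "?L"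
  proof -
    have "mv_polyhedral (A\<lparr>carrier := mv_gen A F\<rparr>)" if "finite F" "F \<subseteq> carrier A" for F
      using \<open>?L\<close> mv_gen_subalgebra[OF A that(2)] mv_finitely_generated_iff[OF A, of "mv_gen A F"] that
      by blast
    from mv_locally_polyhedral_imp[OF A this] show ?thesis using semisimple by simp
  qed
  ultimately show ?thesis by blast
qed

end
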